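(* Let $K$ be a field. For integers $n,r\geq 2$ let $S=K[x_1,\ldots,x_{n+r-1}]$ and $I_{n,r}=x_1x_2\cdots x_{r-1}(x_r,x_{r+1},\ldots,x_{r+n-1})\subset S$. The ideal $I_{n,r}$ is not principal, and therefore $\operatorname{hdepth}(S/I_{n,r})\leq n+r-3$. For $r\geq 1+\binom{n-2}{\lfloor (n-2)/2\rfloor}$, $\operatorname{hdepth}(S/I_{n,r})$ reaches this maximal possible value (with respect to the number of variables of $S$), that is, $\operatorname{hdepth}(S/I_{n,r})=n+r-3$. On the other hand, $\operatorname{hdepth}(I_{n,r})=r+\left\lfloor\frac{n-1}{2}\right\rfloor$. It follows that $$\operatorname{hdepth}(S/I_{n,r})-\operatorname{hdepth}(I_{n,r})=\left\lfloor\frac{n}{2}\right\rfloor-1,\quad\text{for all } n\geq 2\text{ and } r\geq 1+\binom{n-2}{\left\lfloor\frac{n-2}{2}\right\rfloor}.$$ In particular, for any integer $k\geq 0$ there exist a polynomial ring $S$ and a squarefree monomial ideal $I\subset S$ such that $\operatorname{hdepth}(S/I)=\operatorname{hdepth}(I)+k$.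
   Context: Polynomial rings are over the field $K$, in finitely many variables, with the standard grading. For a finitely generated graded $S$-module $M$, the Hilbert depth $\operatorname{hdepth}(M)$ is the maximal depth of a finitely generated graded $S$-module $U$ having the same Hilbert series as $M$. The ideal $I_{n,r}$ is the squarefree monomial ideal generated by the $n$ monomials $x_1\cdots x_{r-1}x_i$, $r\leq i\leq r+n-1$.
   Formalization: The displayed difference is proved as ⌊n/2⌋−2 instead of ⌊n/2⌋−1: the two stated values give (n+r−3)−(r+⌊(n−1)/2⌋)=⌊n/2⌋−2, e.g. 1−2=−1 for n=r=2. *)

theory Defs
  imports
    "HOL-Library.Poly_Mapping"
    "HOL-Computational_Algebra.Formal_Laurent_Series"
    "HOL-Algebra.QuotRing"
    "HOL-Algebra.Module"
begin

section \<open>Polynomial rings in finitely many variables\<close>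

type_synonym 'k mpoly = "(nat \<Rightarrow>\<^sub>0 nat) \<Rightarrow>\<^sub>0 'k"

definition mpoly_const :: "'k::field \<Rightarrow> 'k mpoly" where
  "mpoly_const c = Poly_Mapping.single 0 c"

definition mpoly_var :: "nat \<Rightarrow> 'k::field mpoly" where
  "mpoly_var i = Poly_Mapping.single (Poly_Mapping.single i 1) 1"

text \<open>\<open>mpoly_ring N\<close> is \<open>K[x\<^sub>1,\<dots>,x\<^sub>N]\<close>: the polynomials in which only the variables with index
  in \<open>{1..N}\<close> occur.\<close>

definition mpoly_ring :: "nat \<Rightarrow> 'k::field mpoly ring" where
  "mpoly_ring N =
     \<lparr>carrier = {p. \<forall>m\<in>Poly_Mapping.keys p. Poly_Mapping.keys m \<subseteq> {1..N}},
      mult = (*), one = 1, zero = 0, add = (+)\<rparr>"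

definition mono_degree :: "(nat \<Rightarrow>\<^sub>0 nat) \<Rightarrow> nat" where
  "mono_degree m = (\<Sum>i\<in>Poly_Mapping.keys m. Poly_Mapping.lookup m i)"

text \<open>The component is \<open>{0}\<close> for negative \<open>d\<close>.\<close>

definition mpoly_component :: "nat \<Rightarrow> int \<Rightarrow> 'k::field mpoly set" where
  "mpoly_component N d =
     {p \<in> carrier (mpoly_ring N). \<forall>m\<in>Poly_Mapping.keys p. int (mono_degree m) = d}"

definition graded_maximal_ideal :: "nat \<Rightarrow> 'k::field mpoly set" where
  "graded_maximal_ideal N = Idl\<^bsub>mpoly_ring N\<^esub> (mpoly_var ` {1..N})"


section \<open>Finitely generated graded modules\<close>

definition fin_gen_module :: "('a, 'c) ring_scheme \<Rightarrow> ('a, 'b) module \<Rightarrow> bool" where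
  "fin_gen_module R M \<longleftrightarrow> module R M \<and>
     (\<exists>A. finite A \<and> A \<subseteq> carrier M \<and> (\<forall>H. submodule H R M \<and> A \<subseteq> H \<longrightarrow> H = carrier M))"

text \<open>\<open>\<int>\<close>-gradings, since the shifted modules \<open>S(-a)\<close> must be allowed for all \<open>a\<close>.\<close>

definition is_grading ::
    "nat \<Rightarrow> ('k::field mpoly, 'b) module \<Rightarrow> (int \<Rightarrow> 'b set) \<Rightarrow> bool" where
  "is_grading N M D \<longleftrightarrow>
     (\<forall>j. additive_subgroup (D j) M) \<and>
     (\<forall>u\<in>carrier M. \<exists>!c. (\<forall>j. c j \<in> D j) \<and> finite {j. c j \<noteq> \<zero>\<^bsub>M\<^esub>} \<and>
        u = (\<Oplus>\<^bsub>M\<^esub>j\<in>{j. c j \<noteq> \<zero>\<^bsub>M\<^esub>}. c j)) \<and>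
     (\<forall>i j. \<forall>p\<in>mpoly_component N i. \<forall>u\<in>D j. p \<odot>\<^bsub>M\<^esub> u \<in> D (i + j))"

definition fg_graded_module ::
    "nat \<Rightarrow> ('k::field mpoly, 'b) module \<Rightarrow> (int \<Rightarrow> 'b set) \<Rightarrow> bool" where
  "fg_graded_module N M D \<longleftrightarrow> fin_gen_module (mpoly_ring N) M \<and> is_grading N M D"

text \<open>Finite bases of a \<open>K\<close>-subspace \<open>V\<close> of \<open>M\<close>, where \<open>K\<close> acts through the constant polynomials.\<close>

definition is_K_basis :: "('k::field mpoly, 'b) module \<Rightarrow> 'b set \<Rightarrow> 'b set \<Rightarrow> bool" where
  "is_K_basis M V B \<longleftrightarrow> finite B \<and> B \<subseteq> V \<and>
     (\<forall>v\<in>V. \<exists>!a. a \<in> B \<rightarrow>\<^sub>E UNIV \<and> v = (\<Oplus>\<^bsub>M\<^esub>b\<in>B. mpoly_const (a b) \<odot>\<^bsub>M\<^esub> b))"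

definition K_dim :: "('k::field mpoly, 'b) module \<Rightarrow> 'b set \<Rightarrow> nat" where
  "K_dim M V = (THE d. \<exists>B. is_K_basis M V B \<and> card B = d)"

text \<open>For a finitely generated graded module all components are finite-dimensional and vanish in
  sufficiently negative degrees, so this is indeed a formal Laurent series.\<close>

definition hilbert_series :: "('k::field mpoly, 'b) module \<Rightarrow> (int \<Rightarrow> 'b set) \<Rightarrow> int fls" where
  "hilbert_series M D = Abs_fls (\<lambda>j. int (K_dim M (D j)))"


section \<open>Depth and Hilbert depth\<close>

text \<open>The submodule \<open>(f\<^sub>1,\<dots>,f\<^sub>k)M\<close>, which is the zero submodule for the empty sequence.\<close>

definition seq_submodule :: "('a, 'c) ring_scheme \<Rightarrow> ('a, 'b) module \<Rightarrow> 'a list \<Rightarrow> 'b set" where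
  "seq_submodule R M fs =
     \<Inter>{H. submodule H R M \<and> (\<forall>f\<in>set fs. \<forall>u\<in>carrier M. f \<odot>\<^bsub>M\<^esub> u \<in> H)}"

text \<open>Each \<open>f\<^sub>i\<close> is a nonzerodivisor on \<open>M/(f\<^sub>1,\<dots>,f\<^sub>i\<^sub>-\<^sub>1)M\<close>, and \<open>(f\<^sub>1,\<dots>,f\<^sub>k)M \<noteq> M\<close>.\<close>

definition regular_sequence :: "('a, 'c) ring_scheme \<Rightarrow> ('a, 'b) module \<Rightarrow> 'a list \<Rightarrow> bool" where
  "regular_sequence R M fs \<longleftrightarrow> set fs \<subseteq> carrier R \<and>
     (\<forall>i<length fs. \<forall>u\<in>carrier M.
        fs ! i \<odot>\<^bsub>M\<^esub> u \<in> seq_submodule R M (take i fs) \<longrightarrow> u \<in> seq_submodule R M (take i fs)) \<and>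
     seq_submodule R M fs \<noteq> carrier M"

text \<open>Only meaningful for nonzero modules (the zero module has no regular sequences at all).\<close>

definition depth :: "nat \<Rightarrow> ('k::field mpoly, 'b) module \<Rightarrow> nat" where
  "depth N M = (GREATEST d. \<exists>fs. length fs = d \<and> set fs \<subseteq> graded_maximal_ideal N \<and>
     regular_sequence (mpoly_ring N) M fs)"

text \<open>The modules \<open>U\<close> have their carriers in one fixed type. This is no restriction: a finitely
  generated \<open>S\<close>-module is isomorphic to a quotient of some \<open>S\<^sup>m\<close>, and the cosets that make up such a
  quotient are sets of functions \<open>nat \<Rightarrow> S\<close> (vanishing from \<open>m\<close> on).\<close>

definition hdepth :: "nat \<Rightarrow> ('k::field mpoly, 'b) module \<Rightarrow> (int \<Rightarrow> 'b set) \<Rightarrow> nat" where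
  "hdepth N M D = (GREATEST d.
     \<exists>(U :: ('k mpoly, (nat \<Rightarrow> 'k mpoly) set) module) E.
       fg_graded_module N U E \<and> hilbert_series U E = hilbert_series M D \<and> depth N U = d)"


section \<open>Ideals and residue class rings as graded modules\<close>

text \<open>The fields \<open>mult\<close> and \<open>one\<close> of a module record play no role in the locale \<open>module\<close>.\<close>

definition ideal_module :: "'k::field mpoly set \<Rightarrow> ('k mpoly, 'k mpoly) module" where
  "ideal_module I = \<lparr>carrier = I, mult = (*), one = 1, zero = 0, add = (+), smult = (*)\<rparr>"

definition ideal_grading :: "nat \<Rightarrow> 'k::field mpoly set \<Rightarrow> int \<Rightarrow> 'k mpoly set" where
  "ideal_grading N I j = I \<inter> mpoly_component N j"

definition quotient_module ::
    "nat \<Rightarrow> 'k::field mpoly set \<Rightarrow> ('k mpoly, 'k mpoly set) module" where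
  "quotient_module N I = ring.extend (mpoly_ring N Quot I)
     (module.fields (\<lambda>p X. rcoset_mult (mpoly_ring N) I (I +>\<^bsub>mpoly_ring N\<^esub> p) X))"

definition quotient_grading :: "nat \<Rightarrow> 'k::field mpoly set \<Rightarrow> int \<Rightarrow> 'k mpoly set set" where
  "quotient_grading N I j = (\<lambda>p. I +>\<^bsub>mpoly_ring N\<^esub> p) ` mpoly_component N j"

definition hdepth_ideal :: "nat \<Rightarrow> 'k::field mpoly set \<Rightarrow> nat" where
  "hdepth_ideal N I = hdepth N (ideal_module I) (ideal_grading N I)"

definition hdepth_quotient :: "nat \<Rightarrow> 'k::field mpoly set \<Rightarrow> nat" where
  "hdepth_quotient N I = hdepth N (quotient_module N I) (quotient_grading N I)"


section \<open>Squarefree monomial ideals\<close>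

definition squarefree_monomial_ideal :: "nat \<Rightarrow> 'k::field mpoly set \<Rightarrow> bool" where
  "squarefree_monomial_ideal N I \<longleftrightarrow>
     (\<exists>F \<subseteq> Pow {1..N}. I = Idl\<^bsub>mpoly_ring N\<^esub> ((\<lambda>A. \<Prod>i\<in>A. mpoly_var i) ` F))"

text \<open>An ideal of \<open>mpoly_ring (n + r - 1)\<close>.\<close>

definition I_ideal :: "nat \<Rightarrow> nat \<Rightarrow> 'k::field mpoly set" where
  "I_ideal n r = Idl\<^bsub>mpoly_ring (n + r - 1)\<^esub>
     ((\<lambda>i. (\<Prod>j\<in>{1..r - 1}. mpoly_var j) * mpoly_var i) ` {r..r + n - 1})"

end

theory Submission
  imports Defs "HOL-Library.Function_Algebras" "HOL-Library.Multiset"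
begin

text \<open>
  The crucial point is that \<open>(1 - t)\<^sup>d H\<^sub>U(t)\<close> has nonnegative coefficients whenever \<open>U\<close> has a
  regular sequence \<open>f\<^sub>1, \<dots>, f\<^sub>d\<close> in the graded maximal ideal. The field may be finite and the
  \<open>f\<^sub>i\<close> inhomogeneous, so there need not be a regular sequence of linear forms in \<open>S\<close>. Instead one
  adjoins variables \<open>y\<^sub>k\<^sub>i\<close> and shows that the generic linear forms
  \<open>\<ell>\<^sub>k = y\<^sub>k\<^sub>1 x\<^sub>1 + \<dots> + y\<^sub>k\<^sub>N x\<^sub>N\<close> are a regular sequence on \<open>U[y]\<close>: if \<open>\<ell>\<^sub>k\<close> kills \<open>w\<close>, then a power of
  every \<open>x\<^sub>i\<close> kills \<open>w\<close>, hence \<open>w = 0\<close> as soon as some element of the maximal ideal is a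
  nonzerodivisor, and \<open>\<ell>\<^sub>k\<close> can be exchanged with the \<open>f\<^sub>i\<close> one after the other. Counting
  dimensions in bidegree \<open>(j, e)\<close> and letting \<open>e\<close> tend to infinity gives the claim.

  For \<open>I\<^bsub>n,r\<^esub>\<close> and \<open>S/I\<^bsub>n,r\<^esub>\<close> the first negative coefficient yields the upper bounds. They are
  attained by direct sums of shifted polynomial rings \<open>K[x\<^sub>1,\<dots>,x\<^sub>w](-a)\<close> with \<open>w \<ge> d\<close>, whose
  Hilbert series are the sums of the series \<open>t\<^sup>a / (1 - t)\<^sup>w\<close>.
\<close>

text \<open>Adjoining the \<open>y\<close> takes the place of passing to an infinite field: the
  forms need no choice of coefficients, and all dimensions are still counted over \<open>K\<close>.
  The exchange rests on one observation: if the next \<open>f\<close> is a nonzerodivisor modulo the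
  \<open>f\<close> and \<ell> used so far, then so is the next \<ell>, and the remaining
  \<open>f\<close> stay regular after that \<ell> has been added. Each \<ell> spends one
  \<open>f\<close>, so there are as many generic forms as the sequence has elements. The forms have
  bidegree (1, 1). Hence the dimension of \<open>U[y]\<close> modulo all of them is in bidegree
  \<open>(j, e)\<close> an alternating sum of products: the dimension of \<open>U\<close> in degree
  \<open>j - i\<close> times the number of \<open>y\<close>-monomials of degree
  \<open>e - i\<close>. The number of variables being fixed, these numbers have ratios that tend to
  1 for large \<open>e\<close>, and what remains is the coefficient of \<open>t^j\<close> in
  \<open>(1 - t)^d H\<close>. The bound on \<open>r\<close> comes from \<open>S/I\<close>: with
  \<open>s = r - 1\<close> and \<open>p = n - 2\<close>, the series \<open>(1 - t)^(s + p) H\<close>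
  has the coefficient \<open>s + (-1)^k (p choose k)\<close> in degree \<open>s + k\<close>. All of
  these are nonnegative once \<open>s\<close> is at least the central binomial coefficient.\<close>

abbreviation "lookup \<equiv> Poly_Mapping.lookup"
abbreviation "keys \<equiv> Poly_Mapping.keys"
abbreviation "single \<equiv> Poly_Mapping.single"

section \<open>Generic linear forms\<close>

text \<open>The module is modelled by a subspace \<open>V\<close> of a vector space that is a type.
  Ring elements act on the entire type with values in \<open>V\<close>: in the later instance the
  action first projects to \<open>V\<close>, which spares membership conditions in the algebraic
  laws.\<close>

locale operator_module = vector_space scale
  for scale :: "'k::field \<Rightarrow> 'v::ab_group_add \<Rightarrow> 'v" +
  fixes R :: "'r::comm_ring_1 set" and act :: "'r \<Rightarrow> 'v \<Rightarrow> 'v" and V :: "'v set"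
    and x :: "nat \<Rightarrow> 'r" and N :: nat
  assumes act_add: "p \<in> R \<Longrightarrow> act p (a + b) = act p a + act p b"
    and act_scale: "p \<in> R \<Longrightarrow> act p (scale c a) = scale c (act p a)"
    and act_mult: "p \<in> R \<Longrightarrow> q \<in> R \<Longrightarrow> act (p * q) a = act p (act q a)"
    and act_plus: "p \<in> R \<Longrightarrow> q \<in> R \<Longrightarrow> act (p + q) a = act p a + act q a"
    and act_in: "p \<in> R \<Longrightarrow> act p a \<in> V"
    and V_subspace: "subspace V"
    and x_in: "i \<in> {1..N} \<Longrightarrow> x i \<in> R"
    and R_zero: "0 \<in> R" and R_add: "p \<in> R \<Longrightarrow> q \<in> R \<Longrightarrow> p + q \<in> R"
    and R_mult: "p \<in> R \<Longrightarrow> q \<in> R \<Longrightarrow> p * q \<in> R"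
begin

lemma act_zero: "p \<in> R \<Longrightarrow> act p 0 = 0"
  using act_add[of p 0 0] by simp

lemma act_diff: "p \<in> R \<Longrightarrow> act p (a - b) = act p a - act p b"
  using act_add[of p "a - b" b] by (simp add: algebra_simps)

lemma act_comm: "p \<in> R \<Longrightarrow> q \<in> R \<Longrightarrow> act p (act q a) = act q (act p a)"
  by (metis act_mult mult.commute)

lemma act_null: "act 0 a = 0"
  using act_plus[of 0 0 a] R_zero by simp

lemma V_0: "0 \<in> V" and V_add: "a \<in> V \<Longrightarrow> b \<in> V \<Longrightarrow> a + b \<in> V"
  and V_diff: "a \<in> V \<Longrightarrow> b \<in> V \<Longrightarrow> a - b \<in> V" and V_scale: "a \<in> V \<Longrightarrow> scale c a \<in> V"
  using V_subspace subspace_0 subspace_add subspace_diff subspace_scale by blast+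

text \<open>An element of \<open>GV\<close> is a polynomial with coefficients in \<open>V\<close> in the variables
  \<open>y\<^sub>\<kappa>\<close>, \<open>\<kappa> :: nat \<times> nat\<close>; the multiset \<open>m\<close> stands for the monomial \<open>\<Prod>\<kappa>\<in>#m. y\<^sub>\<kappa>\<close>.
  \<open>yshift \<kappa>\<close> multiplies by \<open>y\<^sub>\<kappa>\<close>, and \<open>ydiv \<kappa>\<close> divides by it, dropping the terms
  without \<open>y\<^sub>\<kappa>\<close>.\<close>

definition GV :: "((nat \<times> nat) multiset \<Rightarrow> 'v) set" where
  "GV = {g. (\<forall>m. g m \<in> V) \<and> (\<exists>e. \<forall>m. e < size m \<longrightarrow> g m = 0)}"

definition yshift :: "nat \<times> nat \<Rightarrow> ((nat \<times> nat) multiset \<Rightarrow> 'v) \<Rightarrow> (nat \<times> nat) multiset \<Rightarrow> 'v" where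
  "yshift \<kappa> g m = (if \<kappa> \<in># m then g (m - {#\<kappa>#}) else 0)"

definition ydiv :: "nat \<times> nat \<Rightarrow> ((nat \<times> nat) multiset \<Rightarrow> 'v) \<Rightarrow> (nat \<times> nat) multiset \<Rightarrow> 'v" where
  "ydiv \<kappa> g m = g (add_mset \<kappa> m)"

definition gact :: "'r \<Rightarrow> ((nat \<times> nat) multiset \<Rightarrow> 'v) \<Rightarrow> (nat \<times> nat) multiset \<Rightarrow> 'v" where
  "gact p g m = act p (g m)"

definition generic_form :: "nat \<Rightarrow> ((nat \<times> nat) multiset \<Rightarrow> 'v) \<Rightarrow> (nat \<times> nat) multiset \<Rightarrow> 'v" where
  "generic_form k g = (\<Sum>i\<in>{1..N}. yshift (k, i) (gact (x i) g))"

lemma sum_fun_apply: "(\<Sum>i\<in>A. h i) m = (\<Sum>i\<in>A. h i m)" for h :: "'i \<Rightarrow> 'a \<Rightarrow> 'w::comm_monoid_add"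
  by (induction A rule: infinite_finite_induct) auto

lemma yshift_add: "yshift \<kappa> (g + h) = yshift \<kappa> g + yshift \<kappa> h"
  and ydiv_add: "ydiv \<kappa> (g + h) = ydiv \<kappa> g + ydiv \<kappa> h"
  and gact_add: "p \<in> R \<Longrightarrow> gact p (g + h) = gact p g + gact p h"
  and yshift_diff: "yshift \<kappa> (g - h) = yshift \<kappa> g - yshift \<kappa> h"
  and gact_diff: "p \<in> R \<Longrightarrow> gact p (g - h) = gact p g - gact p h"
  and yshift_0: "yshift \<kappa> 0 = 0"
  and ydiv_0: "ydiv \<kappa> 0 = 0"
  and gact_0: "p \<in> R \<Longrightarrow> gact p 0 = 0"
  by (auto simp: fun_eq_iff yshift_def ydiv_def gact_def act_add act_diff act_zero)

lemma yshift_sum: "yshift \<kappa> (sum h A) = (\<Sum>a\<in>A. yshift \<kappa> (h a))"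
  using sum_comp_morphism[of "yshift \<kappa>" h A] by (simp add: yshift_add yshift_0 comp_def)

lemma ydiv_sum: "ydiv \<kappa> (sum h A) = (\<Sum>a\<in>A. ydiv \<kappa> (h a))"
  using sum_comp_morphism[of "ydiv \<kappa>" h A] by (simp add: ydiv_add ydiv_0 comp_def)

lemma gact_sum: "p \<in> R \<Longrightarrow> gact p (sum h A) = (\<Sum>a\<in>A. gact p (h a))"
  using sum_comp_morphism[of "gact p" h A] by (simp add: gact_add gact_0 comp_def)

lemma ydiv_yshift_same: "ydiv \<kappa> (yshift \<kappa> g) = g"
  by (auto simp: fun_eq_iff yshift_def ydiv_def)

lemma ydiv_yshift_other: "\<kappa> \<noteq> \<kappa>' \<Longrightarrow> ydiv \<kappa> (yshift \<kappa>' g) = yshift \<kappa>' (ydiv \<kappa> g)"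
  by (auto simp: fun_eq_iff yshift_def ydiv_def add_mset_commute)

lemma yshift_comm: "yshift \<kappa> (yshift \<kappa>' g) = yshift \<kappa>' (yshift \<kappa> g)"
proof (rule ext)
  fix m
  show "yshift \<kappa> (yshift \<kappa>' g) m = yshift \<kappa>' (yshift \<kappa> g) m"
    by (cases "\<kappa> = \<kappa>'") (auto simp: yshift_def diff_right_commute in_diff_count add_mset_commute)
qed

lemma gact_yshift: "p \<in> R \<Longrightarrow> gact p (yshift \<kappa> g) = yshift \<kappa> (gact p g)"
  by (auto simp: fun_eq_iff yshift_def gact_def act_zero)

lemma gact_ydiv: "gact p (ydiv \<kappa> g) = ydiv \<kappa> (gact p g)"
  by (auto simp: fun_eq_iff ydiv_def gact_def)

lemma gact_comm: "p \<in> R \<Longrightarrow> q \<in> R \<Longrightarrow> gact p (gact q g) = gact q (gact p g)"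
  by (auto simp: fun_eq_iff gact_def act_comm)

lemma generic_form_add: "generic_form k (g + h) = generic_form k g + generic_form k h"
  by (simp add: generic_form_def gact_add x_in yshift_add sum.distrib)

lemma generic_form_diff: "generic_form k (g - h) = generic_form k g - generic_form k h"
  by (simp add: generic_form_def gact_diff x_in yshift_diff sum_subtractf)

lemma generic_form_0: "generic_form k 0 = 0"
  using generic_form_add[of k 0 0] by simp

lemma gact_generic_form: "p \<in> R \<Longrightarrow> gact p (generic_form k g) = generic_form k (gact p g)"
  unfolding generic_form_def
  by (subst gact_sum, simp, rule sum.cong, simp) (simp add: gact_yshift gact_comm x_in)

lemma yshift_generic_form: "yshift \<kappa> (generic_form k g) = generic_form k (yshift \<kappa> g)"
  unfolding generic_form_def
  by (subst yshift_sum, rule sum.cong, simp) (simp add: gact_yshift yshift_comm x_in)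

lemma ydiv_generic_form: "fst \<kappa> \<noteq> k \<Longrightarrow> ydiv \<kappa> (generic_form k g) = generic_form k (ydiv \<kappa> g)"
  unfolding generic_form_def
  by (subst ydiv_sum, rule sum.cong, simp, subst ydiv_yshift_other) (auto simp: gact_ydiv x_in)

lemma GV_0: "0 \<in> GV" by (auto simp: GV_def V_0)

lemma GV_add: assumes "g \<in> GV" "h \<in> GV" shows "g + h \<in> GV"
proof -
  obtain e e' where "\<forall>m. e < size m \<longrightarrow> g m = 0" "\<forall>m. e' < size m \<longrightarrow> h m = 0"
    using assms unfolding GV_def by auto
  then have "\<forall>m. max e e' < size m \<longrightarrow> (g + h) m = 0" by simp
  moreover have "(g + h) m \<in> V" for m using assms by (auto simp: V_add GV_def)
  ultimately show ?thesis unfolding GV_def by blast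
qed

lemma GV_uminus: "g \<in> GV \<Longrightarrow> - g \<in> GV"
  unfolding GV_def using V_diff[OF V_0] by fastforce

lemma GV_diff: "g \<in> GV \<Longrightarrow> h \<in> GV \<Longrightarrow> g - h \<in> GV"
  using GV_add[of g "- h"] GV_uminus[of h] by simp

lemma GV_gact: "p \<in> R \<Longrightarrow> g \<in> GV \<Longrightarrow> gact p g \<in> GV"
  by (auto simp: GV_def gact_def act_in) (metis act_zero)

lemma GV_yshift: assumes "g \<in> GV" shows "yshift \<kappa> g \<in> GV"
proof -
  obtain e where e: "\<And>m. e < size m \<Longrightarrow> g m = 0" using assms by (auto simp: GV_def)
  have "yshift \<kappa> g m = 0" if "Suc e < size m" for m
    using that by (auto simp: yshift_def size_Diff_singleton intro!: e)
  moreover have "yshift \<kappa> g m \<in> V" for m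
    using assms by (auto simp: yshift_def V_0 GV_def)
  ultimately show ?thesis unfolding GV_def by blast
qed

lemma GV_ydiv: assumes "g \<in> GV" shows "ydiv \<kappa> g \<in> GV"
proof -
  obtain e where e: "\<And>m. e < size m \<Longrightarrow> g m = 0" using assms by (auto simp: GV_def)
  have "ydiv \<kappa> g m = 0" if "e < size m" for m
    using that by (auto simp: ydiv_def intro!: e)
  moreover have "ydiv \<kappa> g m \<in> V" for m
    using assms by (auto simp: ydiv_def GV_def)
  ultimately show ?thesis unfolding GV_def by blast
qed

lemma GV_sum: "(\<And>i. i \<in> A \<Longrightarrow> h i \<in> GV) \<Longrightarrow> sum h A \<in> GV"
  by (induction A rule: infinite_finite_induct) (auto simp: GV_0 GV_add)

lemma GV_generic_form: "g \<in> GV \<Longrightarrow> generic_form k g \<in> GV"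
  unfolding generic_form_def by (intro GV_sum GV_yshift GV_gact) (auto simp: x_in)

text \<open>\<open>H\<close> plays the part of an \<open>R[y]\<close>-submodule. Closure under
  \<open>ydiv\<close> for the rows from \<open>k\<close> on means that \<open>H\<close> contains the
  coefficients of its elements with respect to these variables; this is what permits comparing
  coefficients modulo \<open>H\<close>.\<close>

definition stable :: "nat \<Rightarrow> ((nat \<times> nat) multiset \<Rightarrow> 'v) set \<Rightarrow> bool" where
  "stable k H \<longleftrightarrow> 0 \<in> H \<and> (\<forall>g\<in>H. \<forall>h\<in>H. g + h \<in> H) \<and> (\<forall>g\<in>H. \<forall>h\<in>H. g - h \<in> H) \<and>
     (\<forall>p\<in>R. \<forall>g\<in>H. gact p g \<in> H) \<and> (\<forall>\<kappa>. \<forall>g\<in>H. yshift \<kappa> g \<in> H) \<and>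
     (\<forall>\<kappa>. k \<le> fst \<kappa> \<longrightarrow> (\<forall>g\<in>H. ydiv \<kappa> g \<in> H))"

lemma stable_0: "stable k H \<Longrightarrow> 0 \<in> H"
  and stable_diff: "stable k H \<Longrightarrow> g \<in> H \<Longrightarrow> h \<in> H \<Longrightarrow> g - h \<in> H"
  unfolding stable_def by blast+

lemma stable_sum: "stable k H \<Longrightarrow> (\<And>i. i \<in> A \<Longrightarrow> h i \<in> H) \<Longrightarrow> sum h A \<in> H"
  by (induction A rule: infinite_finite_induct) (auto simp: stable_def)

lemma gact_pow_stable: "stable k H \<Longrightarrow> p \<in> R \<Longrightarrow> g \<in> H \<Longrightarrow> (gact p ^^ n) g \<in> H"
  by (induction n) (auto simp: stable_def)

lemma ydiv_pow_stable: "stable k H \<Longrightarrow> k \<le> fst \<kappa> \<Longrightarrow> g \<in> H \<Longrightarrow> (ydiv \<kappa> ^^ n) g \<in> H"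
  by (induction n) (cases \<kappa>, auto simp: stable_def)+

lemma ydiv_pow_apply: "(ydiv \<kappa> ^^ n) g m = g (replicate_mset n \<kappa> + m)"
  by (induction n arbitrary: m) (auto simp: ydiv_def)

lemma ydiv_pow_add: "(ydiv \<kappa> ^^ n) (g + h) = (ydiv \<kappa> ^^ n) g + (ydiv \<kappa> ^^ n) h"
  by (rule ext) (simp add: ydiv_pow_apply)

lemma funpow_comm: "(\<And>g. S (T g) = T (S g)) \<Longrightarrow> (S ^^ n) (T g) = T ((S ^^ n) g)"
  by (induction n) auto

text \<open>Comparing the coefficients of the powers of \<open>y\<^sub>k\<^sub>i\<close> in \<open>\<ell>\<^sub>k w\<close>, starting with the highest,
  yields that \<open>x\<^sub>i\<close> kills the leading one, \<open>x\<^sub>i\<^sup>2\<close> the next one, and so on.\<close>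

lemma power_kills:
  assumes H: "stable k H" and w: "w \<in> GV" and lw: "generic_form k w \<in> H" and i: "i \<in> {1..N}"
  shows "\<exists>n. (gact (x i) ^^ n) w \<in> H"
proof -
  obtain e where e: "\<And>m. e < size m \<Longrightarrow> w m = 0" using w by (auto simp: GV_def)
  define \<kappa> where "\<kappa> = (k, i)"
  define T where "T g = (\<Sum>i'\<in>{1..N} - {i}. yshift (k, i') (gact (x i') g))" for g
  have form: "generic_form k g = yshift \<kappa> (gact (x i) g) + T g" for g
    unfolding generic_form_def T_def \<kappa>_def using i by (simp add: sum.remove)
  have T_act: "gact (x i) (T g) = T (gact (x i) g)" for g
    unfolding T_def using i
    by (subst gact_sum, simp add: x_in, intro sum.cong) (auto simp: gact_yshift gact_comm x_in)
  have T_div: "ydiv \<kappa> (T g) = T (ydiv \<kappa> g)" for g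
    unfolding T_def \<kappa>_def
    by (subst ydiv_sum, intro sum.cong, simp, subst ydiv_yshift_other) (auto simp: gact_ydiv)
  have T_H: "T g \<in> H" if "g \<in> H" for g
    unfolding T_def using that H by (intro stable_sum[OF H]) (auto simp: stable_def x_in)
  \<comment> \<open>Descending induction on the power of \<open>y\<close> by which \<open>w\<close>
    is divided: the quotient by the power \<open>e + 1 - s\<close> is killed by the
    \<open>s\<close>-th power of \<open>x i\<close> modulo \<open>H\<close>. It starts at
    \<open>e + 1\<close>, beyond the \<open>y\<close>-degree of \<open>w\<close>, and reaches
    \<open>w\<close> itself at \<open>s = e + 1\<close>.\<close>
  have "s \<le> Suc e \<Longrightarrow> (gact (x i) ^^ s) ((ydiv \<kappa> ^^ (Suc e - s)) w) \<in> H" for s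
  proof (induction s)
    case 0
    have "(ydiv \<kappa> ^^ Suc e) w = 0"
      by (rule ext) (simp only: ydiv_pow_apply zero_fun_def, rule e, simp)
    moreover have "0 \<in> H" using H unfolding stable_def by blast
    ultimately show ?case by (simp only: funpow_0 diff_zero)
  next
    case (Suc s)
    define n where "n = e - s"
    have n: "Suc e - s = Suc n" "Suc e - Suc s = n" using Suc.prems by (auto simp: n_def)
    \<comment> \<open>\<open>T\<close> is free of the variable \<kappa> and so commutes with the
      division. Dividing the form by the power \<open>n + 1\<close> therefore isolates
      \<open>x i\<close> times the quotient of \<open>w\<close> by the power \<open>n\<close>, up to
      a term covered by the induction hypothesis.\<close>
    have "(ydiv \<kappa> ^^ Suc n) (generic_form k w) =
        (ydiv \<kappa> ^^ Suc n) (yshift \<kappa> (gact (x i) w)) + (ydiv \<kappa> ^^ Suc n) (T w)"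
      unfolding form by (rule ydiv_pow_add)
    also have "(ydiv \<kappa> ^^ Suc n) (yshift \<kappa> (gact (x i) w)) = (ydiv \<kappa> ^^ n) (gact (x i) w)"
      unfolding funpow_Suc_right comp_def ydiv_yshift_same ..
    also have "\<dots> = gact (x i) ((ydiv \<kappa> ^^ n) w)"
      by (rule funpow_comm) (simp add: gact_ydiv)
    also have "(ydiv \<kappa> ^^ Suc n) (T w) = T ((ydiv \<kappa> ^^ Suc n) w)"
      by (rule funpow_comm) (rule T_div)
    finally have eq: "gact (x i) ((ydiv \<kappa> ^^ n) w) =
      (ydiv \<kappa> ^^ Suc n) (generic_form k w) - T ((ydiv \<kappa> ^^ Suc n) w)"
      by (simp only: add_diff_cancel_right')
    have diff: "(gact (x i) ^^ s) (g - h) = (gact (x i) ^^ s) g - (gact (x i) ^^ s) h" for g h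
      by (induction s) (simp_all only: funpow.simps comp_def id_apply gact_diff[OF x_in[OF i]])
    have eq2: "(gact (x i) ^^ Suc s) ((ydiv \<kappa> ^^ n) w) =
      (gact (x i) ^^ s) ((ydiv \<kappa> ^^ Suc n) (generic_form k w)) -
      T ((gact (x i) ^^ s) ((ydiv \<kappa> ^^ Suc n) w))"
      unfolding funpow_Suc_right comp_def eq diff
      by (subst funpow_comm[where T = T]) (auto simp: T_act)
    have "(gact (x i) ^^ s) ((ydiv \<kappa> ^^ Suc n) (generic_form k w)) \<in> H"
      by (intro gact_pow_stable[OF H] ydiv_pow_stable[OF H] lw) (use x_in[OF i] in \<open>auto simp: \<kappa>_def\<close>)
    moreover have "T ((gact (x i) ^^ s) ((ydiv \<kappa> ^^ Suc n) w)) \<in> H"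
      using Suc n by (intro T_H) auto
    ultimately show ?case unfolding n eq2 by (rule stable_diff[OF H])
  qed
  from this[of "Suc e"] have "(gact (x i) ^^ Suc e) w \<in> H" by (simp del: funpow.simps)
  then show ?thesis by blast
qed

text \<open>The killing powers are used up one variable at a time. If \<open>w\<close> were outside
  \<open>H\<close>, its last multiple outside \<open>H\<close> by a power of \<open>x 1\<close>,
  then of \<open>x 2\<close>, and so on, would be killed by every \<open>x i\<close> and hence by
  their combination \<open>p\<close>, which is a nonzerodivisor modulo \<open>H\<close>.\<close>

lemma generic_form_nonzerodivisor:
  assumes H: "stable k H" and w: "w \<in> GV" and lw: "generic_form k w \<in> H"
    and p: "p = (\<Sum>i\<in>{1..N}. q i * x i)" and q: "\<And>i. i \<in> {1..N} \<Longrightarrow> q i \<in> R"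
    and nzd: "\<And>u. u \<in> GV \<Longrightarrow> gact p u \<in> H \<Longrightarrow> u \<in> H"
  shows "w \<in> H"
proof (rule ccontr)
  assume "w \<notin> H"
  have "n \<le> N \<Longrightarrow> \<exists>w'\<in>GV. w' \<notin> H \<and> generic_form k w' \<in> H \<and> (\<forall>i\<in>{1..n}. gact (x i) w' \<in> H)" for n
  proof (induction n)
    case 0
    then show ?case using w lw \<open>w \<notin> H\<close> by auto
  next
    case (Suc n)
    then obtain w' where w': "w' \<in> GV" "w' \<notin> H" "generic_form k w' \<in> H"
      "\<forall>i\<in>{1..n}. gact (x i) w' \<in> H" by auto
    have xn: "x (Suc n) \<in> R" using Suc.prems by (intro x_in) auto
    have ex: "\<exists>a. (gact (x (Suc n)) ^^ a) w' \<in> H"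
      using power_kills[OF H w'(1,3), of "Suc n"] Suc.prems by auto
    define a where "a = (LEAST a. (gact (x (Suc n)) ^^ a) w' \<in> H)"
    have a: "(gact (x (Suc n)) ^^ a) w' \<in> H" unfolding a_def using ex by (rule LeastI_ex)
    with w'(2) obtain b where b: "a = Suc b" by (cases a) auto
    define v where "v = (gact (x (Suc n)) ^^ b) w'"
    have "v \<notin> H" unfolding v_def using b not_less_Least[of b "\<lambda>a. (gact (x (Suc n)) ^^ a) w' \<in> H"]
      by (auto simp: a_def)
    moreover have "v \<in> GV" unfolding v_def using w'(1) xn
      by (induction b) (auto simp: GV_gact)
    moreover have "generic_form k v \<in> H" unfolding v_def
      by (subst funpow_comm[symmetric]) (auto simp: gact_generic_form xn intro!: gact_pow_stable[OF H] w')
    moreover have "gact (x i) v \<in> H" if "i \<in> {1..n}" for i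
      unfolding v_def
      by (subst funpow_comm[symmetric])
         (use that w' Suc.prems in \<open>auto intro!: gact_pow_stable[OF H] xn gact_comm x_in\<close>)
    moreover have "gact (x (Suc n)) v \<in> H" using a unfolding b v_def by simp
    ultimately show ?case by (intro bexI[of _ v]) (auto simp: atLeastAtMostSuc_conv)
  qed
  from this[of N] obtain w' where w': "w' \<in> GV" "w' \<notin> H" "\<And>i. i \<in> {1..N} \<Longrightarrow> gact (x i) w' \<in> H"
    by auto
  have "act (\<Sum>i\<in>A. q i * x i) b = (\<Sum>i\<in>A. act (q i) (act (x i) b)) \<and> (\<Sum>i\<in>A. q i * x i) \<in> R"
    if "A \<subseteq> {1..N}" for A b
    using finite_subset[OF that] that
    by (induction A rule: finite_induct) (auto simp: act_null act_plus act_mult x_in q R_zero R_add R_mult)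
  then have "gact p w' = (\<Sum>i\<in>{1..N}. gact (q i) (gact (x i) w'))"
    unfolding p by (intro ext) (auto simp: gact_def sum_fun_apply)
  also have "\<dots> \<in> H" using H w' q by (intro stable_sum[OF H]) (auto simp: stable_def)
  finally show False using nzd w' by blast
qed

end

section \<open>Submodules of \<open>U[y]\<close> generated by the images of finitely many
  operators\<close>

context operator_module
begin

text \<open>Arbitrary operators are allowed so that the submodules generated by the
  \<open>f s\<close> and by the generic forms share their closure lemmas.\<close>

definition opsum :: "nat \<Rightarrow> (nat \<Rightarrow> ((nat \<times> nat) multiset \<Rightarrow> 'v) \<Rightarrow> (nat \<times> nat) multiset \<Rightarrow> 'v) \<Rightarrow>
    ((nat \<times> nat) multiset \<Rightarrow> 'v) set" where
  "opsum n T = {g. \<exists>a. (\<forall>s. a s \<in> GV) \<and> g = (\<Sum>s<n. T s (a s))}"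

lemma opsumI: "(\<And>s. a s \<in> GV) \<Longrightarrow> (\<Sum>s<n. T s (a s)) \<in> opsum n T"
  unfolding opsum_def by blast

lemma opsum_Suc: "v \<in> opsum (Suc n) T \<longleftrightarrow> (\<exists>h\<in>opsum n T. \<exists>u\<in>GV. v = h + T n u)"
proof
  assume "v \<in> opsum (Suc n) T"
  then obtain a where "\<forall>s. a s \<in> GV" "v = (\<Sum>s<Suc n. T s (a s))" unfolding opsum_def by blast
  then show "\<exists>h\<in>opsum n T. \<exists>u\<in>GV. v = h + T n u"
    using opsumI[of a T n] by (intro bexI[of _ "\<Sum>s<n. T s (a s)"] bexI[of _ "a n"]) simp_all
next
  assume "\<exists>h\<in>opsum n T. \<exists>u\<in>GV. v = h + T n u"
  then obtain a u where a: "\<forall>s. a s \<in> GV" "u \<in> GV" "v = (\<Sum>s<n. T s (a s)) + T n u"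
    unfolding opsum_def by blast
  have "v = (\<Sum>s<Suc n. T s ((a(n := u)) s))" unfolding a(3) sum.lessThan_Suc
    by (rule arg_cong2[where f = "(+)"], rule sum.cong) simp_all
  moreover have "(a(n := u)) s \<in> GV" for s using a by simp
  ultimately show "v \<in> opsum (Suc n) T" unfolding opsum_def by blast
qed

lemma opsum_closed_op:
  assumes "\<And>s g. s < n \<Longrightarrow> g \<in> GV \<Longrightarrow> P (T s g) = T s (P g)" "\<And>g. g \<in> GV \<Longrightarrow> P g \<in> GV"
    and "\<And>g h. P (g + h) = P g + P h" "P 0 = 0" "v \<in> opsum n T"
  shows "P v \<in> opsum n T"
proof -
  obtain a where a: "\<forall>s. a s \<in> GV" "v = (\<Sum>s<n. T s (a s))" using assms(5) unfolding opsum_def by blast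
  have "P v = (\<Sum>s<n. P (T s (a s)))" unfolding a(2)
    using sum_comp_morphism[of P "\<lambda>s. T s (a s)" "{..<n}"] assms(3,4) by (simp add: comp_def)
  also have "\<dots> = (\<Sum>s<n. T s (P (a s)))" using assms(1) a(1) by (intro sum.cong) auto
  finally show ?thesis using opsumI[of "\<lambda>s. P (a s)" T n] assms(2) a(1) by auto
qed

lemma opsum_add:
  assumes "\<And>s g h. s < n \<Longrightarrow> T s (g + h) = T s g + T s h" "v \<in> opsum n T" "w \<in> opsum n T"
  shows "v + w \<in> opsum n T"
proof -
  obtain a b where a: "\<forall>s. a s \<in> GV" "v = (\<Sum>s<n. T s (a s))"
    "\<forall>s. b s \<in> GV" "w = (\<Sum>s<n. T s (b s))" using assms(2,3) unfolding opsum_def by blast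
  have "v + w = (\<Sum>s<n. T s (a s + b s))" unfolding a sum.distrib[symmetric]
    using assms(1) by (intro sum.cong) auto
  then show ?thesis using opsumI[of "\<lambda>s. a s + b s" T n] a GV_add by auto
qed

lemma opsum_diff:
  assumes "\<And>s g h. s < n \<Longrightarrow> T s (g - h) = T s g - T s h" "v \<in> opsum n T" "w \<in> opsum n T"
  shows "v - w \<in> opsum n T"
proof -
  obtain a b where a: "\<forall>s. a s \<in> GV" "v = (\<Sum>s<n. T s (a s))"
    "\<forall>s. b s \<in> GV" "w = (\<Sum>s<n. T s (b s))" using assms(2,3) unfolding opsum_def by blast
  have "v - w = (\<Sum>s<n. T s (a s - b s))" unfolding a sum_subtractf[symmetric]
    using assms(1) by (intro sum.cong) auto
  then show ?thesis using opsumI[of "\<lambda>s. a s - b s" T n] a GV_diff by auto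
qed

lemma opsum_0: "(\<And>s. s < n \<Longrightarrow> T s 0 = 0) \<Longrightarrow> 0 \<in> opsum n T"
  using opsumI[of "\<lambda>_. 0" T n] GV_0 by simp

end

section \<open>Exchange of a regular sequence for generic linear forms\<close>

locale regular_operators = operator_module +
  fixes f :: "nat \<Rightarrow> 'c" and q :: "nat \<Rightarrow> nat \<Rightarrow> 'c" and d :: nat
  assumes q_in: "s < d \<Longrightarrow> i \<in> {1..N} \<Longrightarrow> q s i \<in> R"
    and f_eq: "s < d \<Longrightarrow> f s = (\<Sum>i\<in>{1..N}. q s i * x i)"
    and f_regular: "s < d \<Longrightarrow> u \<in> V \<Longrightarrow> \<exists>a. (\<forall>t. a t \<in> V) \<and> act (f s) u = (\<Sum>t<s. act (f t) (a t)) \<Longrightarrow>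
        \<exists>a. (\<forall>t. a t \<in> V) \<and> u = (\<Sum>t<s. act (f t) (a t))"
begin

lemma f_in: assumes "s < d" shows "f s \<in> R"
proof -
  have "(\<Sum>i\<in>A. q s i * x i) \<in> R" if "A \<subseteq> {1..N}" for A
    using finite_subset[OF that] that
    by (induction A rule: finite_induct) (auto simp: R_zero R_add R_mult q_in[OF assms] x_in)
  then show ?thesis using f_eq[OF assms] by simp
qed

text \<open>\<open>HH i k\<close> is \<open>(f\<^sub>1,\<dots>,f\<^sub>i,\<ell>\<^sub>1,\<dots>,\<ell>\<^sub>k)U[y]\<close> (with indices shifted by one).\<close>

definition HH :: "nat \<Rightarrow> nat \<Rightarrow> ((nat \<times> nat) multiset \<Rightarrow> 'b) set" where
  "HH i k = {g. \<exists>a\<in>opsum i (\<lambda>s. gact (f s)). \<exists>b\<in>opsum k generic_form. g = a + b}"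

lemma HH_Suc_left: "v \<in> HH (Suc i) k \<longleftrightarrow> (\<exists>h\<in>HH i k. \<exists>u\<in>GV. v = h + gact (f i) u)"
proof
  assume "v \<in> HH (Suc i) k"
  then obtain a b where ab: "a \<in> opsum (Suc i) (\<lambda>s. gact (f s))" "b \<in> opsum k generic_form"
    "v = a + b" unfolding HH_def by blast
  obtain h u where hu: "h \<in> opsum i (\<lambda>s. gact (f s))" "u \<in> GV" "a = h + gact (f i) u"
    using ab(1) unfolding opsum_Suc by blast
  have "v = h + gact (f i) u + b" unfolding ab(3) hu(3) ..
  moreover have "h + gact (f i) u + b = (h + b) + gact (f i) u" by (simp only: add_ac)
  ultimately show "\<exists>h\<in>HH i k. \<exists>u\<in>GV. v = h + gact (f i) u"
    unfolding HH_def using ab(2) hu by blast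
next
  assume "\<exists>h\<in>HH i k. \<exists>u\<in>GV. v = h + gact (f i) u"
  then obtain h u b where h: "h \<in> opsum i (\<lambda>s. gact (f s))" "u \<in> GV" "b \<in> opsum k generic_form"
    "v = h + b + gact (f i) u" unfolding HH_def by blast
  then have "h + gact (f i) u \<in> opsum (Suc i) (\<lambda>s. gact (f s))" unfolding opsum_Suc by blast
  moreover have "v = h + gact (f i) u + b" unfolding h(4) by (simp only: add_ac)
  ultimately show "v \<in> HH (Suc i) k" unfolding HH_def using h by blast
qed

lemma HH_Suc_right: "v \<in> HH i (Suc k) \<longleftrightarrow> (\<exists>h\<in>HH i k. \<exists>u\<in>GV. v = h + generic_form k u)"
proof
  assume "v \<in> HH i (Suc k)"
  then obtain h b' where hb: "h \<in> opsum i (\<lambda>s. gact (f s))" "b' \<in> opsum (Suc k) generic_form"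
    "v = h + b'" unfolding HH_def by blast
  obtain b u where bu: "b \<in> opsum k generic_form" "u \<in> GV" "b' = b + generic_form k u"
    using hb(2) unfolding opsum_Suc by blast
  have h: "h \<in> opsum i (\<lambda>s. gact (f s))" "u \<in> GV" "b \<in> opsum k generic_form"
    "v = h + (b + generic_form k u)" using hb bu by blast+
  have "h + b \<in> HH i k" "v = (h + b) + generic_form k u"
    unfolding HH_def h(4) using h(1,3) by (blast, simp only: add.assoc)
  then show "\<exists>h\<in>HH i k. \<exists>u\<in>GV. v = h + generic_form k u" using h(2) by blast
next
  assume "\<exists>h\<in>HH i k. \<exists>u\<in>GV. v = h + generic_form k u"
  then obtain h u b where h: "h \<in> opsum i (\<lambda>s. gact (f s))" "u \<in> GV" "b \<in> opsum k generic_form"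
    "v = (h + b) + generic_form k u" unfolding HH_def by blast
  then have "b + generic_form k u \<in> opsum (Suc k) generic_form" unfolding opsum_Suc by blast
  moreover have "v = h + (b + generic_form k u)" unfolding h(4) by (simp only: add_ac)
  ultimately show "v \<in> HH i (Suc k)" unfolding HH_def using h by blast
qed

lemma HH_closed_op:
  assumes "\<And>s g. s < i \<Longrightarrow> g \<in> GV \<Longrightarrow> P (gact (f s) g) = gact (f s) (P g)"
    and "\<And>s g. s < k \<Longrightarrow> g \<in> GV \<Longrightarrow> P (generic_form s g) = generic_form s (P g)"
    and "\<And>g. g \<in> GV \<Longrightarrow> P g \<in> GV" "\<And>g h. P (g + h) = P g + P h" "P 0 = 0" "v \<in> HH i k"
  shows "P v \<in> HH i k"
proof -
  obtain a b where ab: "a \<in> opsum i (\<lambda>s. gact (f s))" "b \<in> opsum k generic_form" "v = a + b"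
    using assms(6) unfolding HH_def by blast
  have "P a \<in> opsum i (\<lambda>s. gact (f s))" 
    by (rule opsum_closed_op[OF assms(1) assms(3) assms(4) assms(5) ab(1)])
  moreover have "P b \<in> opsum k generic_form" 
    by (rule opsum_closed_op[OF assms(2) assms(3) assms(4) assms(5) ab(2)])
  ultimately show ?thesis unfolding HH_def ab(3) assms(4) by blast
qed

text \<open>Division by a variable of row \<open>k\<close> or later commutes with all generators:
  the \<open>f s\<close> are free of \<open>y\<close>, and form number \<open>s\<close> involves
  only row \<open>s\<close>, where \<open>s < k\<close>.\<close>

lemma HH_stable: assumes "i \<le> d" shows "stable k (HH i k)"
proof -
  have fs: "f s \<in> R" if "s < i" for s using that assms f_in by auto
  have 0: "0 \<in> HH i k"
  proof -
    have "0 \<in> opsum i (\<lambda>s. gact (f s))" by (rule opsum_0) (rule gact_0[OF fs])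
    moreover have "0 \<in> opsum k generic_form" by (rule opsum_0) (rule generic_form_0)
    moreover have "0 = 0 + (0 :: (nat \<times> nat) multiset \<Rightarrow> 'b)" by (simp only: add_0_left)
    ultimately show ?thesis unfolding HH_def by blast
  qed
  have add: "g + h \<in> HH i k" if gh: "g \<in> HH i k" "h \<in> HH i k" for g h
  proof -
    obtain a b a' b' where ab: "a \<in> opsum i (\<lambda>s. gact (f s))" "b \<in> opsum k generic_form" "g = a + b"
      "a' \<in> opsum i (\<lambda>s. gact (f s))" "b' \<in> opsum k generic_form" "h = a' + b'"
      using gh unfolding HH_def by blast
    have "a + a' \<in> opsum i (\<lambda>s. gact (f s))" "b + b' \<in> opsum k generic_form"
      using ab by (auto intro!: opsum_add gact_add fs generic_form_add)
    moreover have "g + h = (a + a') + (b + b')" unfolding ab by (simp only: add_ac)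
    ultimately show ?thesis unfolding HH_def by blast
  qed
  have diff: "g - h \<in> HH i k" if gh: "g \<in> HH i k" "h \<in> HH i k" for g h
  proof -
    obtain a b a' b' where ab: "a \<in> opsum i (\<lambda>s. gact (f s))" "b \<in> opsum k generic_form" "g = a + b"
      "a' \<in> opsum i (\<lambda>s. gact (f s))" "b' \<in> opsum k generic_form" "h = a' + b'"
      using gh unfolding HH_def by blast
    have "a - a' \<in> opsum i (\<lambda>s. gact (f s))" "b - b' \<in> opsum k generic_form"
      using ab by (auto intro!: opsum_diff gact_diff fs generic_form_diff)
    moreover have "g - h = (a - a') + (b - b')" unfolding ab by (simp only: add_diff_add)
    ultimately show ?thesis unfolding HH_def by blast
  qed
  have A: "gact p v \<in> HH i k" if "p \<in> R" "v \<in> HH i k" for p v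
    by (rule HH_closed_op[OF gact_comm gact_generic_form GV_gact gact_add gact_0 that(2)])
      (rule that(1) fs | assumption)+
  have B: "yshift \<kappa> v \<in> HH i k" if "v \<in> HH i k" for \<kappa> v
    by (rule HH_closed_op[OF gact_yshift[symmetric] yshift_generic_form GV_yshift yshift_add yshift_0 that])
      (rule fs, assumption)+
  have C: "ydiv \<kappa> v \<in> HH i k" if "k \<le> fst \<kappa>" "v \<in> HH i k" for \<kappa> v
    by (rule HH_closed_op[OF gact_ydiv[symmetric] ydiv_generic_form GV_ydiv ydiv_add ydiv_0 that(2)])
      (use that(1) in simp_all)
  show ?thesis unfolding stable_def by (intro conjI ballI allI impI 0 add diff A B C)
qed

text \<open>The \<open>f s\<close> do not involve the \<open>y\<close>, so their regularity on
  \<open>U\<close> carries over to \<open>U[y]\<close> coefficient by coefficient.\<close>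

lemma HH_base:
  assumes "i < d" "u \<in> GV" "gact (f i) u \<in> HH i 0"
  shows "u \<in> HH i 0"
proof -
  have HH0: "HH i 0 = opsum i (\<lambda>s. gact (f s))" unfolding HH_def opsum_def by auto
  obtain a where a: "\<And>s. a s \<in> GV" "gact (f i) u = (\<Sum>s<i. gact (f s) (a s))"
    using assms(3) unfolding HH0 opsum_def by blast
  have "\<exists>c. (\<forall>t. c t \<in> V) \<and> u m = (\<Sum>t<i. act (f t) (c t))" for m
  proof (rule f_regular[OF assms(1)])
    show "u m \<in> V" using assms(2) by (auto simp: GV_def)
    have "act (f i) (u m) = (\<Sum>s<i. act (f s) (a s m))"
      using fun_cong[OF a(2), of m] by (simp add: sum_fun_apply gact_def)
    then show "\<exists>a. (\<forall>t. a t \<in> V) \<and> act (f i) (u m) = (\<Sum>t<i. act (f t) (a t))"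
      using a(1) by (intro exI[of _ "\<lambda>s. a s m"]) (auto simp: GV_def)
  qed
  then obtain c where c: "\<And>m t. c m t \<in> V" "\<And>m. u m = (\<Sum>t<i. act (f t) (c m t))" by metis
  \<comment> \<open>The coefficients \<open>c m t\<close> are chosen for each monomial separately.
    Replacing them by 0 where \<open>u\<close> has no term bounds the \<open>y\<close>-degree, as
    \<open>GV\<close> demands.\<close>
  define b where "b t m = (if u m = 0 then 0 else c m t)" for t m
  obtain e where e: "\<And>m. e < size m \<Longrightarrow> u m = 0" using assms(2) by (auto simp: GV_def)
  have bGV: "b t \<in> GV" for t
  proof -
    have "b t m \<in> V" for m using c(1) by (simp add: b_def V_0)
    moreover have "b t m = 0" if "e < size m" for m using e[OF that] by (simp add: b_def)
    ultimately show ?thesis unfolding GV_def by blast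
  qed
  have "u m = (\<Sum>t<i. gact (f t) (b t)) m" for m
  proof (cases "u m = 0")
    case True
    then show ?thesis unfolding sum_fun_apply
      by (subst sum.neutral) (use assms(1) in \<open>auto simp: b_def gact_def act_zero f_in\<close>)
  next
    case False
    then show ?thesis unfolding sum_fun_apply gact_def b_def using c(2) by simp
  qed
  then have "u = (\<Sum>t<i. gact (f t) (b t))" by (rule ext)
  then show ?thesis unfolding HH0 opsum_def using bGV by blast
qed

text \<open>\<open>f i\<close> serves as the element of the maximal ideal that is a
  nonzerodivisor.\<close>

lemma generic_form_regular_if:
  assumes "i + k < d" "\<And>u. u \<in> GV \<Longrightarrow> gact (f i) u \<in> HH i k \<Longrightarrow> u \<in> HH i k"
    and "w \<in> GV" "generic_form k w \<in> HH i k"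
  shows "w \<in> HH i k"
  by (rule generic_form_nonzerodivisor[OF HH_stable assms(3,4) f_eq q_in assms(2)])
     (use assms(1) in auto)

text \<open>Induction on \<open>k\<close> with \<open>i\<close> free. If \<open>f i\<close> times
  \<open>u\<close> is \<open>h\<close> plus \<ell> times \<open>v\<close>, with \<ell> the form
  number \<open>k\<close>, then \<ell> kills \<open>v\<close> modulo \<open>HH (Suc i) k\<close>.
  There \<open>f (Suc i)\<close> is regular by induction, hence so is \<ell>, and \<open>v\<close>
  is \<open>h'\<close> plus \<open>f i\<close> times \<open>w\<close>. So \<open>f i\<close> kills
  \<open>u\<close> minus \<ell> times \<open>w\<close> modulo \<open>HH i k\<close>, and the
  induction hypothesis for \<open>i\<close> itself applies. Trading a form for an element of the
  sequence keeps \<open>i + k\<close> below \<open>d\<close>.\<close>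

lemma f_regular_HH: "i + k < d \<Longrightarrow> u \<in> GV \<Longrightarrow> gact (f i) u \<in> HH i k \<Longrightarrow> u \<in> HH i k"
proof (induction k arbitrary: i u)
  case 0
  then show ?case using HH_base by auto
next
  case (Suc k)
  have fR: "f i \<in> R" using Suc.prems f_in by auto
  have st: "stable k (HH i k)" "stable k (HH (Suc i) k)" using Suc.prems by (auto intro!: HH_stable)
  obtain h v where h: "h \<in> HH i k" "v \<in> GV" "gact (f i) u = h + generic_form k v"
    using Suc.prems(3) unfolding HH_Suc_right by blast
  have eq: "generic_form k v = (0 - h) + gact (f i) u" unfolding h(3) by (simp only: diff_0 minus_add_cancel)
  have "0 - h \<in> HH i k" by (rule stable_diff[OF st(1) stable_0[OF st(1)] h(1)])
  then have form: "generic_form k v \<in> HH (Suc i) k"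
    unfolding HH_Suc_left by (intro bexI[of _ "0 - h"] bexI[of _ u] eq Suc.prems(2))
  have ik: "Suc i + k < d" using Suc.prems(1) by simp
  have "v \<in> HH (Suc i) k"
    by (rule generic_form_regular_if[OF ik Suc.IH[OF ik] h(2) form])
  then obtain h' w where h': "h' \<in> HH i k" "w \<in> GV" "v = h' + gact (f i) w"
    unfolding HH_Suc_left by blast
  have "gact (f i) (u - generic_form k w) = h + generic_form k v - generic_form k (gact (f i) w)"
    unfolding h(3)[symmetric] by (simp only: gact_diff[OF fR] gact_generic_form[OF fR])
  also have "\<dots> = h + generic_form k h'"
    unfolding h'(3) generic_form_add by (simp only: add.assoc[symmetric] add_diff_cancel_right')
  also have "\<dots> \<in> HH i k"
  proof -
    have "generic_form k h' \<in> HH i k" unfolding generic_form_def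
      by (rule stable_sum[OF st(1)]) (use st(1) h' x_in in \<open>auto simp: stable_def\<close>)
    then show ?thesis using h(1) st(1) unfolding stable_def by blast
  qed
  finally have mem: "gact (f i) (u - generic_form k w) \<in> HH i k" .
  have gv: "u - generic_form k w \<in> GV" by (intro GV_diff GV_generic_form Suc.prems(2) h'(2))
  have lt: "i + k < d" using Suc.prems(1) by simp
  have "u - generic_form k w \<in> HH i k" by (rule Suc.IH[OF lt gv mem])
  moreover have "u = (u - generic_form k w) + generic_form k w" by (simp only: diff_add_cancel)
  ultimately show ?case unfolding HH_Suc_right by (intro bexI[of _ "u - generic_form k w"] bexI[of _ w] h'(2))
qed

theorem generic_forms_regular:
  assumes "k < d" "w \<in> GV" "generic_form k w \<in> opsum k generic_form"
  shows "w \<in> opsum k generic_form"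
proof -
  have "HH 0 k = opsum k generic_form" unfolding HH_def opsum_def by auto
  then show ?thesis using generic_form_regular_if[of 0 k w] f_regular_HH[of 0 k] assms by auto
qed

end

section \<open>Dimensions of subspaces: a rank formula relative to a subspace\<close>

definition fin_dim :: "('k::comm_ring_1 \<Rightarrow> 'v::ab_group_add \<Rightarrow> 'v) \<Rightarrow> 'v set \<Rightarrow> bool" where
  "fin_dim scale S \<longleftrightarrow> (\<exists>T. finite T \<and> S \<subseteq> module.span scale T)"

context vector_space
begin

lemma fin_dim_basis:
  assumes "subspace S" "fin_dim scale S"
  obtains B where "finite B" "independent B" "span B = S" "card B = dim S" "B \<subseteq> S"
proof -
  obtain B where B: "B \<subseteq> S" "independent B" "S \<subseteq> span B" "card B = dim S"
    using basis_exists by blast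
  obtain T where T: "finite T" "S \<subseteq> span T" using assms(2) unfolding fin_dim_def by blast
  have "finite B" using independent_span_bound[OF T(1) B(2)] B(1) T(2) by blast
  moreover have "span B = S" using span_minimal[OF B(1) assms(1)] B(3) by blast
  ultimately show ?thesis using that B by blast
qed

lemma fin_dim_mono: "A \<subseteq> B \<Longrightarrow> fin_dim scale B \<Longrightarrow> fin_dim scale A"
  unfolding fin_dim_def by blast

lemma dim_mono_fin: assumes "A \<subseteq> B" "fin_dim scale B" "subspace B" shows "dim A \<le> dim B"
proof -
  obtain B' where B': "finite B'" "span B' = B" "card B' = dim B" using fin_dim_basis[OF assms(3,2)] .
  obtain A' where A': "A' \<subseteq> A" "independent A'" "A \<subseteq> span A'" "card A' = dim A"
    using basis_exists by blast
  have "A' \<subseteq> span B'" using A'(1) assms(1) B'(2) by blast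
  then show ?thesis using independent_span_bound[OF B'(1) A'(2)] A'(4) B'(3) by simp
qed

text \<open>Rank-nullity for the map from \<open>A\<close> to the space modulo \<open>L\<close> that
  \<open>f\<close> induces. Adding \<open>L\<close> to the image avoids the quotient space.\<close>

lemma dim_image_sum:
  assumes f: "Vector_Spaces.linear scale scale f" and A: "subspace A" "fin_dim scale A" and L: "subspace L" "fin_dim scale L"
  shows "dim {l + f a |l a. l \<in> L \<and> a \<in> A} + dim {a \<in> A. f a \<in> L} = dim L + dim A"
proof -
  interpret f: Vector_Spaces.linear scale scale f by (rule f)
  let ?A0 = "{a \<in> A. f a \<in> L}"
  have A0: "subspace ?A0"
    using A(1) L(1) by (auto simp: subspace_def f.add f.scale f.zero)
  have A0f: "fin_dim scale ?A0" using A(2) by (rule fin_dim_mono[rotated]) auto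
  obtain B0 where B0: "finite B0" "independent B0" "span B0 = ?A0" "card B0 = dim ?A0" "B0 \<subseteq> ?A0"
    using fin_dim_basis[OF A0 A0f] .
  obtain C where C: "finite C" "independent C" "span C = L" "card C = dim L"
    using fin_dim_basis[OF L] .
  have "B0 \<subseteq> A" using B0(5) by blast
  from maximal_independent_subset_extend[OF this B0(2)]
  obtain B where B: "B0 \<subseteq> B" "B \<subseteq> A" "independent B" "A \<subseteq> span B" .
  obtain T where T: "finite T" "A \<subseteq> span T" using A(2) unfolding fin_dim_def by blast
  have fB: "finite B" using independent_span_bound[OF T(1) B(3)] B(2) T(2) by blast
  have cB: "card B = dim A" using basis_card_eq_dim[OF B(2,4,3)] .
  have spB: "span B = A" using span_minimal[OF B(2) A(1)] B(4) by blast
  \<comment> \<open>The kernel modulo \<open>L\<close> is spanned by \<open>B0\<close>. If some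
    \<open>f b\<close> depended on \<open>C\<close> and the other images, then \<open>b\<close>
    minus a combination of other elements of \<open>B\<close> would lie in this kernel, against the
    independence of \<open>B\<close>. Thus \<open>C\<close> and the images of \<open>B - B0\<close>
    form a basis of the sum.\<close>
  have ind: "E \<subseteq> B - B0 \<Longrightarrow> independent (C \<union> f ` E) \<and> card (C \<union> f ` E) = card C + card E" if "finite E" for E
    using that
  proof (induction E)
    case empty
    then show ?case using C by simp
  next
    case (insert b E)
    have nspan: "f b \<notin> span (C \<union> f ` E)"
    proof
      assume "f b \<in> span (C \<union> f ` E)"
      then obtain l e where le: "l \<in> span C" "e \<in> span (f ` E)" "f b = l + e"
        unfolding span_Un by blast
      obtain e' where e': "e' \<in> span E" "e = f e'" using le(2) unfolding f.span_image by blast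
      have "e' \<in> A" using e'(1) insert.prems span_mono[of E B] spB by blast
      moreover have "b \<in> A" using insert.prems B(2) by blast
      moreover have "f (b - e') \<in> L" using le C(3) unfolding f.diff e'(2) by simp
      ultimately have "b - e' \<in> span B0" unfolding B0(3) using A(1) by (simp add: subspace_diff)
      then have "b - e' \<in> span (B0 \<union> E)" "e' \<in> span (B0 \<union> E)"
        using e'(1) span_mono[of B0 "B0 \<union> E"] span_mono[of E "B0 \<union> E"] by blast+
      then have "b \<in> span (B0 \<union> E)" using span_add[of "b - e'" "B0 \<union> E" e'] by simp
      moreover have "B0 \<union> E \<subseteq> B - {b}" using insert B(1) by blast
      ultimately have "b \<in> span (B - {b})" using span_mono by blast
      then show False using B(3) insert.prems unfolding dependent_def by blast
    qed
    have "f b \<notin> C \<union> f ` E" using span_superset[of "C \<union> f ` E"] nspan by auto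
    moreover have "independent (C \<union> f ` E)" "card (C \<union> f ` E) = card C + card E"
      using insert by auto
    ultimately show ?case
      using independent_insertI[OF nspan] insert.hyps C(1) by simp
  qed
  let ?S = "{l + f a |l a. l \<in> L \<and> a \<in> A}"
  have ind': "independent (C \<union> f ` (B - B0))" "card (C \<union> f ` (B - B0)) = card C + card (B - B0)"
    using ind[of "B - B0"] fB by auto
  have "span (C \<union> f ` (B - B0)) = ?S"
  proof
    have sub: "span (B - B0) \<subseteq> A" using span_mono[of "B - B0" B] spB by simp
    show "span (C \<union> f ` (B - B0)) \<subseteq> ?S"
    proof
      fix v assume "v \<in> span (C \<union> f ` (B - B0))"
      then obtain l b where "l \<in> L" "b \<in> f ` span (B - B0)" "v = l + b"
        unfolding span_Un f.span_image C(3) by blast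
      then show "v \<in> ?S" using sub by blast
    qed
    show "?S \<subseteq> span (C \<union> f ` (B - B0))"
    proof clarify
      fix l a assume l: "l \<in> L" and a: "a \<in> A"
      have "a \<in> span (B0 \<union> (B - B0))" using a spB B(1) by (simp add: Un_absorb1)
      then obtain a0 a1 where a01: "a0 \<in> span B0" "a1 \<in> span (B - B0)" "a = a0 + a1"
        unfolding span_Un by blast
      have "l + f a0 \<in> span C" using a01(1) l L(1) unfolding B0(3) C(3) by (auto intro: subspace_add)
      moreover have "l + f a = (l + f a0) + f a1" unfolding a01(3) f.add by (simp only: add.assoc)
      ultimately show "l + f a \<in> span (C \<union> f ` (B - B0))"
        unfolding span_Un f.span_image using a01(2) by blast
    qed
  qed
  then have "dim ?S = card C + card (B - B0)"
    using dim_span_eq_card_independent[OF ind'(1)] ind'(2) by simp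
  moreover have "card (B - B0) + card B0 = card B"
    using B(1) B0(1) fB by (simp add: card_Diff_subset card_mono)
  ultimately show ?thesis using B0(4) C(4) cB by simp
qed

end

section \<open>Asymptotics of the number of monomials\<close>

lemma binomial_shift_ratio:
  "(\<lambda>e. real ((M + e) choose e) / real ((M + (e + i)) choose (e + i))) \<longlonglongrightarrow> 1"
proof (induction i)
  case 0
  have "real ((M + e) choose e) \<noteq> 0" for e by (simp add: binomial_eq_0_iff)
  then have "(\<lambda>e. real ((M + e) choose e) / real ((M + (e + 0)) choose (e + 0))) = (\<lambda>_. 1)" by auto
  then show ?case by simp
next
  case (Suc i)
  have "(\<lambda>e. real (e + i + 1) / real (M + (e + i + 1))) \<longlonglongrightarrow> 1"
  proof -
    have "(\<lambda>e. 1 / (1 + real M / real (e + (i + 1)))) \<longlonglongrightarrow> 1 / (1 + 0)"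
      by (intro tendsto_intros LIMSEQ_ignore_initial_segment lim_const_over_n) auto
    moreover have "1 / (1 + real M / real (e + (i + 1))) = real (e + i + 1) / real (M + (e + i + 1))" for e
      by (simp add: field_simps)
    ultimately show ?thesis by simp
  qed
  then have "(\<lambda>e. real ((M + e) choose e) / real ((M + (e + i)) choose (e + i)) *
     (real (e + i + 1) / real (M + (e + i + 1)))) \<longlonglongrightarrow> 1 * 1" by (intro tendsto_mult Suc)
  moreover have "real ((M + e) choose e) / real ((M + (e + i)) choose (e + i)) *
     (real (e + i + 1) / real (M + (e + i + 1))) =
     real ((M + e) choose e) / real ((M + (e + Suc i)) choose (e + Suc i))" for e
  proof -
    have "Suc (e + i) * (Suc (M + (e + i)) choose Suc (e + i)) = Suc (M + (e + i)) * ((M + (e + i)) choose (e + i))"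
      using Suc_times_binomial_eq[of "M + (e + i)" "e + i"] by (simp only: mult.commute)
    then have "real (Suc (e + i)) * real (Suc (M + (e + i)) choose Suc (e + i)) =
       real (Suc (M + (e + i))) * real ((M + (e + i)) choose (e + i))"
      by (simp only: of_nat_mult[symmetric])
    moreover have "real ((M + (e + i)) choose (e + i)) \<noteq> 0"
      "real (Suc (M + (e + i)) choose Suc (e + i)) \<noteq> 0" by (simp_all add: binomial_eq_0_iff del: binomial_Suc_Suc)
    moreover have "a / P * (s / t) = a / Q" if "s * Q = t * P" "P \<noteq> 0" "Q \<noteq> 0" "t \<noteq> 0" for a P Q s t :: real
      using that by (simp add: divide_simps) algebra
    ultimately show ?thesis by (simp del: binomial_Suc_Suc of_nat_Suc)
  qed
  ultimately show ?case by simp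
qed

text \<open>After division by the binomial coefficient for \<open>e\<close>, every binomial factor
  tends to 1, since \<open>M\<close> is fixed; the inequality survives in the limit, where the
  factors are gone.\<close>

lemma nonneg_from_growth:
  fixes a :: "nat \<Rightarrow> int"
  assumes "\<And>e. e \<ge> d \<Longrightarrow> 0 \<le> (\<Sum>i\<le>d. a i * int ((M + (e - i)) choose (e - i)))"
  shows "0 \<le> (\<Sum>i\<le>d. a i)"
proof -
  let ?c = "\<lambda>e. real ((M + e) choose e)"
  \<comment> \<open>The index of the hypothesis is taken as \<open>e + d\<close>. Writing it as
    \<open>e + (d - i) + i\<close> fits the shape of \<open>binomial_shift_ratio\<close>, while all
    denominators are in fact equal.\<close>
  have "(\<lambda>e. \<Sum>i\<le>d. real_of_int (a i) * (?c (e + (d - i)) / ?c (e + (d - i) + i))) \<longlonglongrightarrow>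
    (\<Sum>i\<le>d. real_of_int (a i) * 1)"
    by (intro tendsto_sum tendsto_mult tendsto_const LIMSEQ_ignore_initial_segment[OF binomial_shift_ratio])
  moreover have "0 \<le> (\<Sum>i\<le>d. real_of_int (a i) * (?c (e + (d - i)) / ?c (e + (d - i) + i)))" for e
  proof -
    have "(\<Sum>i\<le>d. real_of_int (a i) * (?c (e + (d - i)) / ?c (e + (d - i) + i))) =
      (\<Sum>i\<le>d. real_of_int (a i) * ?c (e + d - i)) / ?c (e + d)"
      unfolding sum_divide_distrib by (intro sum.cong) auto
    also have "(\<Sum>i\<le>d. real_of_int (a i) * ?c (e + d - i)) =
        real_of_int (\<Sum>i\<le>d. a i * int ((M + (e + d - i)) choose (e + d - i)))" by simp
    finally show ?thesis using assms[of "e + d"] by (simp del: of_int_sum)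
  qed
  ultimately have "0 \<le> (\<Sum>i\<le>d. real_of_int (a i) * 1)" by (intro LIMSEQ_le_const) auto
  then have "0 \<le> real_of_int (\<Sum>i\<le>d. a i)" by simp
  then show ?thesis by (simp only: of_int_0_le_iff)
qed

section \<open>Dimension count in each bidegree\<close>

locale graded_operators = regular_operators +
  fixes Vc :: "int \<Rightarrow> 'b set" and pr :: "int \<Rightarrow> 'b \<Rightarrow> 'b"
  assumes Vc_subspace: "subspace (Vc j)" and Vc_sub: "Vc j \<subseteq> V" and Vc_fin: "fin_dim scale (Vc j)"
    and pr_add: "a \<in> V \<Longrightarrow> b \<in> V \<Longrightarrow> pr j (a + b) = pr j a + pr j b"
    and pr_in: "a \<in> V \<Longrightarrow> pr j a \<in> Vc j" and pr_id: "a \<in> Vc j \<Longrightarrow> pr j a = a"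
    and pr_act: "i \<in> {1..N} \<Longrightarrow> a \<in> V \<Longrightarrow> pr j (act (x i) a) = act (x i) (pr (j - 1) a)"
begin

lemma pr_0: "pr j 0 = 0" using pr_id[OF subspace_0[OF Vc_subspace]] .

lemma pr_sum: "(\<And>i. i \<in> A \<Longrightarrow> h i \<in> V) \<Longrightarrow> pr j (sum h A) = (\<Sum>i\<in>A. pr j (h i))"
proof -
  have "(\<And>i. i \<in> A \<Longrightarrow> h i \<in> V) \<Longrightarrow> sum h A \<in> V \<and> pr j (sum h A) = (\<Sum>i\<in>A. pr j (h i))"
    by (induction A rule: infinite_finite_induct) (auto simp: pr_0 pr_add V_0 V_add)
  then show "(\<And>i. i \<in> A \<Longrightarrow> h i \<in> V) \<Longrightarrow> pr j (sum h A) = (\<Sum>i\<in>A. pr j (h i))" by blast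
qed

text \<open>\<open>GV\<close> admits all pairs of numbers as indices. For finite dimensions only the
  variables of the first \<open>d\<close> forms may occur.\<close>

definition Y :: "(nat \<times> nat) set" where "Y = {..<d} \<times> {1..N}"

definition ymon :: "int \<Rightarrow> (nat \<times> nat) multiset set" where
  "ymon e = {m. set_mset m \<subseteq> Y \<and> int (size m) = e}"

text \<open>\<open>GG j e\<close> is the part of \<open>U[y]\<close> of bidegree \<open>(j, e)\<close>, and \<open>LG k j e\<close> below is the part of
  \<open>(\<ell>\<^sub>1,\<dots>,\<ell>\<^sub>k)U[y]\<close> of that bidegree.\<close>

definition GG :: "int \<Rightarrow> int \<Rightarrow> ((nat \<times> nat) multiset \<Rightarrow> 'b) set" where
  "GG j e = {g. (\<forall>m. g m \<in> Vc j) \<and> (\<forall>m. m \<notin> ymon e \<longrightarrow> g m = 0)}"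

definition gpr :: "int \<Rightarrow> int \<Rightarrow> ((nat \<times> nat) multiset \<Rightarrow> 'b) \<Rightarrow> (nat \<times> nat) multiset \<Rightarrow> 'b" where
  "gpr j e g m = (if m \<in> ymon e then pr j (g m) else 0)"

definition gscale :: "'a \<Rightarrow> ((nat \<times> nat) multiset \<Rightarrow> 'b) \<Rightarrow> (nat \<times> nat) multiset \<Rightarrow> 'b" where
  "gscale c g m = scale c (g m)"

sublocale G: vector_space gscale
  by unfold_locales
    (auto simp: fun_eq_iff gscale_def scale_right_distrib scale_left_distrib)

lemma finite_ymon: "finite (ymon e)"
proof -
  have "ymon e \<subseteq> multisets_of_size Y (nat e)" by (auto simp: ymon_def multisets_of_size_def)
  moreover have "finite Y" by (simp add: Y_def)
  ultimately show ?thesis using finite_multisets_of_size finite_subset by blast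
qed

lemma card_ymon: assumes "1 \<le> d" "1 \<le> N" shows "card (ymon (int n)) = (d * N - 1 + n) choose n"
proof -
  have "ymon (int n) = multisets_of_size Y n" by (auto simp: ymon_def multisets_of_size_def)
  then show ?thesis using card_multisets_of_size[of Y n] assms by (simp add: Y_def card_cartesian_product)
qed

lemma GG_GV: "g \<in> GG j e \<Longrightarrow> g \<in> GV"
proof -
  assume g: "g \<in> GG j e"
  have "g m \<in> V" for m using g Vc_sub by (auto simp: GG_def)
  moreover have "g m = 0" if "nat e < size m" for m
  proof -
    have "m \<notin> ymon e" using that by (auto simp: ymon_def)
    then show ?thesis using g by (simp add: GG_def)
  qed
  ultimately show ?thesis unfolding GV_def by blast
qed

lemma gpr_GG: "g \<in> GV \<Longrightarrow> gpr j e g \<in> GG j e"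
  by (auto simp: GG_def gpr_def GV_def pr_in subspace_0[OF Vc_subspace])

lemma gpr_id: "g \<in> GG j e \<Longrightarrow> gpr j e g = g"
  by (auto simp: fun_eq_iff GG_def gpr_def pr_id)

lemma gpr_add: "g \<in> GV \<Longrightarrow> h \<in> GV \<Longrightarrow> gpr j e (g + h) = gpr j e g + gpr j e h"
  by (auto simp: fun_eq_iff gpr_def GV_def pr_add)

lemma gpr_0: "gpr j e 0 = 0"
  by (auto simp: fun_eq_iff gpr_def pr_0)

lemma gpr_sum: "(\<And>s. h s \<in> GV) \<Longrightarrow> gpr j e (\<Sum>s<(k::nat). h s) = (\<Sum>s<k. gpr j e (h s))"
proof (induction k)
  case 0
  show ?case unfolding lessThan_0 sum.empty by (rule gpr_0)
next
  case (Suc k)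
  show ?case unfolding sum.lessThan_Suc
    by (subst gpr_add) (auto intro!: GV_sum Suc.prems simp only: Suc.IH[OF Suc.prems])
qed

lemma generic_form_apply:
  "generic_form s a m = (\<Sum>i\<in>{1..N}. if (s, i) \<in># m then act (x i) (a (m - {#(s, i)#})) else 0)"
  by (auto simp: generic_form_def sum_fun_apply yshift_def gact_def intro!: sum.cong)

lemma ymon_remove: assumes "\<kappa> \<in># m" "\<kappa> \<in> Y" shows "m - {#\<kappa>#} \<in> ymon (e - 1) \<longleftrightarrow> m \<in> ymon e"
proof -
  obtain m' where m': "m = add_mset \<kappa> m'" using multi_member_split[OF assms(1)] by blast
  show ?thesis unfolding m' using assms(2) by (auto simp: ymon_def)
qed

text \<open>The form has bidegree (1, 1), and \<open>s < d\<close> makes its variables belong to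
  \<open>Y\<close>; removing one of them from a monomial thus changes only the degree. The
  projection \<open>gpr\<close> also drops the monomials with variables outside \<open>Y\<close>, on
  both sides alike.\<close>

lemma gpr_generic_form:
  assumes "s < d" "a \<in> GV"
  shows "gpr j e (generic_form s a) = generic_form s (gpr (j - 1) (e - 1) a)"
proof (rule ext)
  fix m
  have aV: "a m' \<in> V" for m' using assms(2) by (auto simp: GV_def)
  have rem: "m - {#(s, i)#} \<in> ymon (e - 1) \<longleftrightarrow> m \<in> ymon e" if "(s, i) \<in># m" "i \<in> {1..N}" for i
    using that assms(1) by (intro ymon_remove) (auto simp: Y_def)
  show "gpr j e (generic_form s a) m = generic_form s (gpr (j - 1) (e - 1) a) m"
  proof (cases "m \<in> ymon e")
    case True
    have "gpr j e (generic_form s a) m =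
       (\<Sum>i\<in>{1..N}. pr j (if (s, i) \<in># m then act (x i) (a (m - {#(s, i)#})) else 0))"
      unfolding gpr_def generic_form_apply using True
      by (subst pr_sum) (auto simp: act_in x_in V_0)
    also have "\<dots> = generic_form s (gpr (j - 1) (e - 1) a) m"
      unfolding generic_form_apply
      by (intro sum.cong) (auto simp: gpr_def rem True pr_act aV pr_0)
    finally show ?thesis .
  next
    case False
    then have "generic_form s (gpr (j - 1) (e - 1) a) m = 0"
      unfolding generic_form_apply by (intro sum.neutral) (auto simp: gpr_def rem act_zero x_in)
    then show ?thesis using False by (simp add: gpr_def)
  qed
qed

lemma generic_form_GG: "s < d \<Longrightarrow> a \<in> GG (j - 1) (e - 1) \<Longrightarrow> generic_form s a \<in> GG j e"
proof -
  assume s: "s < d" and a: "a \<in> GG (j - 1) (e - 1)"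
  have "generic_form s a = gpr j e (generic_form s a)"
    unfolding gpr_generic_form[OF s GG_GV[OF a]] gpr_id[OF a] ..
  also have "\<dots> \<in> GG j e" by (rule gpr_GG[OF GV_generic_form[OF GG_GV[OF a]]])
  finally show ?thesis .
qed

definition LG :: "nat \<Rightarrow> int \<Rightarrow> int \<Rightarrow> ((nat \<times> nat) multiset \<Rightarrow> 'b) set" where
  "LG k j e = {g. \<exists>a. (\<forall>s. a s \<in> GG (j - 1) (e - 1)) \<and> g = (\<Sum>s<k. generic_form s (a s))}"

lemma LG_opsum: "LG k j e \<subseteq> opsum k generic_form"
proof
  fix g assume "g \<in> LG k j e"
  then obtain a where a: "\<And>s. a s \<in> GG (j - 1) (e - 1)" "g = (\<Sum>s<k. generic_form s (a s))"
    unfolding LG_def by blast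
  show "g \<in> opsum k generic_form" unfolding a(2) by (rule opsumI) (rule GG_GV[OF a(1)])
qed

lemma GG_subspace: "G.subspace (GG j e)"
  unfolding G.subspace_def GG_def gscale_def
  by (auto intro: subspace_0[OF Vc_subspace] subspace_add[OF Vc_subspace] subspace_scale[OF Vc_subspace])

lemma GG_0: "0 \<in> GG j e" using G.subspace_0[OF GG_subspace] .

lemma LG_0: "LG 0 j e = {0}"
proof -
  have "\<exists>a. \<forall>s::nat. a s \<in> GG (j - 1) (e - 1)" using GG_0 by (intro exI[of _ "\<lambda>_. 0"]) blast
  then show ?thesis unfolding LG_def by simp
qed

lemma generic_form_linear: "Vector_Spaces.linear gscale gscale (generic_form k)"
proof (unfold_locales)
  show "generic_form k (b1 + b2) = generic_form k b1 + generic_form k b2" for b1 b2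
    by (rule generic_form_add)
  show "generic_form k (gscale r b) = gscale r (generic_form k b)" for r b
    by (rule ext, unfold generic_form_apply gscale_def scale_sum_right, rule sum.cong)
       (auto simp: act_scale x_in)
qed

lemma LG_Suc: "LG (Suc k) j e = {l + generic_form k b |l b. l \<in> LG k j e \<and> b \<in> GG (j - 1) (e - 1)}"
proof (rule Set.set_eqI, rule iffI)
  fix v assume "v \<in> LG (Suc k) j e"
  then obtain a where a: "\<forall>s. a s \<in> GG (j - 1) (e - 1)" "v = (\<Sum>s<k. generic_form s (a s)) + generic_form k (a k)"
    unfolding LG_def sum.lessThan_Suc by blast
  then show "v \<in> {l + generic_form k b |l b. l \<in> LG k j e \<and> b \<in> GG (j - 1) (e - 1)}"
    unfolding LG_def by blast
next
  fix v assume "v \<in> {l + generic_form k b |l b. l \<in> LG k j e \<and> b \<in> GG (j - 1) (e - 1)}"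
  then obtain a b where a: "\<forall>s. a s \<in> GG (j - 1) (e - 1)" "b \<in> GG (j - 1) (e - 1)"
    "v = (\<Sum>s<k. generic_form s (a s)) + generic_form k b" unfolding LG_def by blast
  have "v = (\<Sum>s<Suc k. generic_form s ((a(k := b)) s))" unfolding a(3) sum.lessThan_Suc
    by (rule arg_cong2[where f = "(+)"], rule sum.cong) simp_all
  moreover have "\<forall>s. (a(k := b)) s \<in> GG (j - 1) (e - 1)" using a by simp
  ultimately show "v \<in> LG (Suc k) j e" unfolding LG_def by blast
qed

lemma LG_subspace: "G.subspace (LG k j e)"
proof (induction k)
  case 0
  show ?case unfolding LG_0 by simp
next
  case (Suc k)
  interpret f: Vector_Spaces.linear gscale gscale "generic_form k" by (rule generic_form_linear)
  have "G.subspace (generic_form k ` GG (j - 1) (e - 1))" using GG_subspace by (rule f.subspace_image)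
  from G.subspace_sums[OF Suc this]
  show ?case unfolding LG_Suc by (rule back_subst[of G.subspace]) blast
qed

lemma LG_GG: "k \<le> d \<Longrightarrow> LG k j e \<subseteq> GG j e"
proof (induction k)
  case 0
  show ?case unfolding LG_0 using GG_0 by blast
next
  case (Suc k)
  then show ?case unfolding LG_Suc using generic_form_GG[of k] G.subspace_add[OF GG_subspace] by fastforce
qed

lemma generic_form_comm: "generic_form k (generic_form s g) = generic_form s (generic_form k g)"
  unfolding generic_form_def[of s] G.scale_zero_right
proof -
  interpret f: Vector_Spaces.linear gscale gscale "generic_form k" by (rule generic_form_linear)
  show "generic_form k (\<Sum>i\<in>{1..N}. yshift (s, i) (gact (x i) g)) =
      (\<Sum>i\<in>{1..N}. yshift (s, i) (gact (x i) (generic_form k g)))"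
    unfolding f.sum by (rule sum.cong) (simp_all only: yshift_generic_form gact_generic_form x_in)
qed

text \<open>The regularity of the generic forms enters here: multiplication by form number
  \<open>k\<close> has no kernel modulo the earlier forms. The representation in \<open>U[y]\<close>
  that regularity provides is made bihomogeneous by \<open>gpr\<close>.\<close>

lemma LG_preimage:
  assumes "k < d"
  shows "{b \<in> GG (j - 1) (e - 1). generic_form k b \<in> LG k j e} = LG k (j - 1) (e - 1)"
proof (rule Set.set_eqI, rule iffI)
  fix b assume "b \<in> {b \<in> GG (j - 1) (e - 1). generic_form k b \<in> LG k j e}"
  then have b: "b \<in> GG (j - 1) (e - 1)" "generic_form k b \<in> opsum k generic_form"
    using LG_opsum by blast+
  from generic_forms_regular[OF assms GG_GV[OF b(1)] b(2)]
  obtain a where a: "\<And>s. a s \<in> GV" "b = (\<Sum>s<k. generic_form s (a s))" unfolding opsum_def by blast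
  have "b = gpr (j - 1) (e - 1) b" using gpr_id[OF b(1)] by simp
  also have "\<dots> = (\<Sum>s<k. gpr (j - 1) (e - 1) (generic_form s (a s)))"
    unfolding a(2) by (rule gpr_sum) (rule GV_generic_form[OF a(1)])
  also have "\<dots> = (\<Sum>s<k. generic_form s (gpr (j - 1 - 1) (e - 1 - 1) (a s)))"
    by (rule sum.cong, rule refl, rule gpr_generic_form) (use assms a(1) in simp_all)
  finally show "b \<in> LG k (j - 1) (e - 1)" 
    unfolding LG_def mem_Collect_eq
    by (intro exI[of _ "\<lambda>s. gpr (j - 1 - 1) (e - 1 - 1) (a s)"] conjI allI gpr_GG a(1))
next
  fix b assume b: "b \<in> LG k (j - 1) (e - 1)"
  then obtain a where a: "\<And>s. a s \<in> GG (j - 1 - 1) (e - 1 - 1)" "b = (\<Sum>s<k. generic_form s (a s))"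
    unfolding LG_def by blast
  interpret f: Vector_Spaces.linear gscale gscale "generic_form k" by (rule generic_form_linear)
  have "generic_form k b = (\<Sum>s<k. generic_form s (generic_form k (a s)))"
    unfolding a(2) f.sum by (rule sum.cong) (simp_all only: generic_form_comm)
  moreover have "\<And>s. generic_form k (a s) \<in> GG (j - 1) (e - 1)" by (rule generic_form_GG[OF assms a(1)])
  ultimately have "generic_form k b \<in> LG k j e" unfolding LG_def mem_Collect_eq
    by (intro exI[of _ "\<lambda>s. generic_form k (a s)"] conjI allI)
  then show "b \<in> {b \<in> GG (j - 1) (e - 1). generic_form k b \<in> LG k j e}"
    using b LG_GG[of k] assms by auto
qed

definition gsingle :: "(nat \<times> nat) multiset \<Rightarrow> 'b \<Rightarrow> (nat \<times> nat) multiset \<Rightarrow> 'b" where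
  "gsingle m v m' = (if m' = m then v else 0)"

text \<open>A basis of \<open>Vc j\<close> is placed at each of the finitely many
  \<open>y\<close>-monomials of degree \<open>e\<close>.\<close>

lemma GG_basis: "fin_dim gscale (GG j e) \<and> G.dim (GG j e) = card (ymon e) * dim (Vc j)"
proof -
  obtain B where B: "finite B" "independent B" "span B = Vc j" "card B = dim (Vc j)" "B \<subseteq> Vc j"
    using fin_dim_basis[OF Vc_subspace Vc_fin] .
  have B0: "0 \<notin> B" using B(2) dependent_zero by blast
  define S where "S = (\<lambda>(m, b). gsingle m b) ` (ymon e \<times> B)"
  have inj: "inj_on (\<lambda>(m, b). gsingle m b) (ymon e \<times> B)"
  proof (rule inj_onI, clarify)
    fix m b m' b' assume *: "b \<in> B" "b' \<in> B" "gsingle m b = gsingle m' b'"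
    then have "gsingle m b m = gsingle m' b' m" "b \<noteq> 0" using B0 by auto
    then show "m = m' \<and> b = b'" by (auto simp: gsingle_def split: if_splits)
  qed
  have fS: "finite S" unfolding S_def using finite_ymon B(1) by blast
  have cS: "card S = card (ymon e) * dim (Vc j)"
    unfolding S_def card_image[OF inj] by (simp add: card_cartesian_product B(4))
  have sub: "S \<subseteq> GG j e"
    unfolding S_def GG_def using B(5) subspace_0[OF Vc_subspace] by (auto simp: gsingle_def)
  have ind: "G.independent S"
  proof (rule G.independent_if_scalars_zero[OF fS])
    fix u g assume sum: "(\<Sum>g\<in>S. gscale (u g) g) = 0" and g: "g \<in> S"
    then obtain m b where mb: "m \<in> ymon e" "b \<in> B" "g = gsingle m b" unfolding S_def by auto
    have "0 = (\<Sum>g\<in>S. gscale (u g) g) m" using sum by simp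
    also have "\<dots> = (\<Sum>p\<in>ymon e \<times> B. scale (u (gsingle (fst p) (snd p))) (gsingle (fst p) (snd p) m))"
      unfolding sum_fun_apply S_def gscale_def by (subst sum.reindex[OF inj]) (simp add: comp_def case_prod_beta)
    also have "\<dots> = (\<Sum>p\<in>{m} \<times> B. scale (u (gsingle (fst p) (snd p))) (gsingle (fst p) (snd p) m))"
      using finite_ymon B(1) mb(1) by (intro sum.mono_neutral_right) (auto simp: gsingle_def)
    also have "\<dots> = (\<Sum>b\<in>B. scale (u (gsingle m b)) b)"
      by (intro sum.reindex_bij_witness[of _ "\<lambda>b. (m, b)" snd]) (auto simp: gsingle_def)
    finally have "(\<Sum>b\<in>B. scale (u (gsingle m b)) b) = 0" by simp
    from independentD[OF B(2,1) order_refl this mb(2)] show "u g = 0" using mb(3) by simp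
  qed
  have span: "GG j e \<subseteq> G.span S"
  proof
    fix g assume g: "g \<in> GG j e"
    have eq: "g = (\<Sum>m\<in>ymon e. gsingle m (g m))"
    proof (rule ext)
      fix m show "g m = (\<Sum>m\<in>ymon e. gsingle m (g m)) m"
        unfolding sum_fun_apply gsingle_def using g finite_ymon
        by (auto simp: GG_def sum.delta)
    qed
    have "gsingle m v \<in> G.span S" if m: "m \<in> ymon e" and v: "v \<in> span B" for m v
      using v
    proof (induction rule: span_induct_alt)
      case base
      have eq0: "gsingle m 0 = 0" by (auto simp: fun_eq_iff gsingle_def)
      show ?case unfolding eq0 by (rule G.span_zero)
    next
      case (step c b y)
      have "gsingle m (scale c b + y) = gscale c (gsingle m b) + gsingle m y"
        by (auto simp: fun_eq_iff gsingle_def gscale_def)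
      moreover have "gsingle m b \<in> S" unfolding S_def using m step(1) by auto
      ultimately show ?case using step by (metis G.span_add G.span_base G.span_scale)
    qed
    then show "g \<in> G.span S" using g B(3)
      by (subst eq, intro G.span_sum) (auto simp: GG_def)
  qed
  show ?thesis using G.basis_card_eq_dim[OF sub span ind] cS fS span unfolding fin_dim_def by auto
qed

lemma dim_LG_Suc:
  assumes "k < d"
  shows "G.dim (LG (Suc k) j e) + G.dim (LG k (j - 1) (e - 1)) = G.dim (LG k j e) + G.dim (GG (j - 1) (e - 1))"
proof -
  have "fin_dim gscale (LG k j e)"
    using LG_GG[of k j e] GG_basis[of j e] assms unfolding fin_dim_def by (meson less_imp_le subset_trans)
  then show ?thesis
    unfolding LG_Suc LG_preimage[OF assms, symmetric]
    using GG_basis by (intro G.dim_image_sum generic_form_linear GG_subspace LG_subspace) auto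
qed

text \<open>A regular element of bidegree (1, 1) multiplies the bigraded Hilbert series by
  \<open>1 - t u\<close>. The sum is the coefficient in \<open>(1 - t u)^k\<close> times the series
  of \<open>U[y]\<close>, and the induction step is Pascal's rule.\<close>

lemma dim_quotient:
  "k \<le> d \<Longrightarrow> int (G.dim (GG j e)) - int (G.dim (LG k j e)) =
     (\<Sum>i\<le>k. (-1) ^ i * int (k choose i) * int (dim (Vc (j - int i))) * int (card (ymon (e - int i))))"
proof (induction k arbitrary: j e)
  case 0
  have "G.dim (LG 0 j e) = 0" unfolding LG_0 using G.dim_unique[of "{}" "{0}" 0] G.independent_empty by simp
  then show ?case using GG_basis[of j e] by simp
next
  case (Suc k)
  define t where "t i = int (dim (Vc (j - int i))) * int (card (ymon (e - int i)))" for i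
  have "int (G.dim (GG j e)) - int (G.dim (LG (Suc k) j e)) =
      (int (G.dim (GG j e)) - int (G.dim (LG k j e))) -
      (int (G.dim (GG (j - 1) (e - 1))) - int (G.dim (LG k (j - 1) (e - 1))))"
    using dim_LG_Suc[of k j e] Suc.prems by linarith
  also have "\<dots> = (\<Sum>i\<le>k. (-1) ^ i * int (k choose i) * t i) - (\<Sum>i\<le>k. (-1) ^ i * int (k choose i) * t (Suc i))"
    using Suc.prems by (subst (1 2) Suc.IH) (simp_all add: t_def algebra_simps)
  also have "(\<Sum>i\<le>k. (-1) ^ i * int (k choose i) * t i) =
      t 0 + (\<Sum>i\<le>k. (-1) ^ Suc i * int (k choose Suc i) * t (Suc i))"
  proof -
    have k0: "k choose Suc k = 0" by simp
    show ?thesis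
      using sum.atMost_Suc_shift[of "\<lambda>i. (-1) ^ i * int (k choose i) * t i" k]
      unfolding sum.atMost_Suc k0 by simp
  qed
  also have "t 0 + (\<Sum>i\<le>k. (-1) ^ Suc i * int (k choose Suc i) * t (Suc i)) -
      (\<Sum>i\<le>k. (-1) ^ i * int (k choose i) * t (Suc i)) =
      t 0 + (\<Sum>i\<le>k. (-1) ^ Suc i * int (Suc k choose Suc i) * t (Suc i))"
    unfolding add_diff_eq[symmetric] sum_subtractf[symmetric]
    by (intro arg_cong2[where f = "(+)"] sum.cong refl) (simp add: algebra_simps)
  also have "\<dots> = (\<Sum>i\<le>Suc k. (-1) ^ i * int (Suc k choose i) * t i)"
    by (subst sum.atMost_Suc_shift) simp
  finally show ?case by (simp add: t_def mult.assoc)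
qed

theorem alternating_sum_nonneg:
  assumes "1 \<le> N"
  shows "0 \<le> (\<Sum>i\<le>d. (-1) ^ i * int (d choose i) * int (dim (Vc (j - int i))))"
proof (cases "d = 0")
  case True
  then show ?thesis by simp
next
  case False
  show ?thesis
  \<comment> \<open>There are \<open>d * N\<close> variables, hence \<open>d * N - 1 + e\<close>
    choose \<open>e\<close> monomials of degree \<open>e\<close>. With \<open>d\<close> nonzero and
    \<open>N\<close> positive the subtraction does not truncate.\<close>
  proof (rule nonneg_from_growth[of d _ "d * N - 1"])
    fix e assume e: "d \<le> e"
    have "0 \<le> int (G.dim (GG j (int e))) - int (G.dim (LG d j (int e)))"
      using G.dim_mono_fin[OF LG_GG[OF order_refl] conjunct1[OF GG_basis] GG_subspace, of j "int e"]
      by (simp only: diff_ge_0_iff_ge of_nat_le_iff)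
    also have "\<dots> = (\<Sum>i\<le>d. (-1) ^ i * int (d choose i) * int (dim (Vc (j - int i))) *
        int ((d * N - 1 + (e - i)) choose (e - i)))"
      unfolding dim_quotient[OF order_refl]
    proof (intro sum.cong refl arg_cong2[where f = "(*)"] arg_cong[where f = int])
      fix i assume "i \<in> {..d}"
      then have eq: "int e - int i = int (e - i)" using e by auto
      show "card (ymon (int e - int i)) = (d * N - 1 + (e - i)) choose (e - i)"
        unfolding eq by (rule card_ymon) (use False assms in simp_all)
    qed
    finally show "0 \<le> (\<Sum>i\<le>d. (-1) ^ i * int (d choose i) * int (dim (Vc (j - int i))) *
        int ((d * N - 1 + (e - i)) choose (e - i)))" .
  qed
qed

end

section \<open>The polynomial ring\<close>

lemma mpoly_ring_simps [simp]:
  "mult (mpoly_ring N) = (*)" "one (mpoly_ring N) = 1" "zero (mpoly_ring N) = 0" "add (mpoly_ring N) = (+)"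
  by (simp_all add: mpoly_ring_def)

lemma mpoly_ring_carrier:
  "p \<in> carrier (mpoly_ring N) \<longleftrightarrow> (\<forall>m\<in>keys p. keys m \<subseteq> {1..N})"
  by (simp add: mpoly_ring_def)

lemma mpoly_carrier_0: "0 \<in> carrier (mpoly_ring N)"
  and mpoly_carrier_1: "1 \<in> carrier (mpoly_ring N)"
  by (auto simp: mpoly_ring_carrier)

lemma mpoly_carrier_add:
  "p \<in> carrier (mpoly_ring N) \<Longrightarrow> q \<in> carrier (mpoly_ring N) \<Longrightarrow> p + q \<in> carrier (mpoly_ring N)"
  using Poly_Mapping.keys_add[of p q] by (auto simp: mpoly_ring_carrier)

lemma mpoly_carrier_mult:
  "p \<in> carrier (mpoly_ring N) \<Longrightarrow> q \<in> carrier (mpoly_ring N) \<Longrightarrow> p * q \<in> carrier (mpoly_ring N)"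
  unfolding mpoly_ring_carrier
proof
  fix m assume p: "\<forall>m\<in>keys p. keys m \<subseteq> {1..N}"
    and q: "\<forall>m\<in>keys q. keys m \<subseteq> {1..N}"
    and "m \<in> keys (p * q)"
  then obtain a b where "m = a + b" "a \<in> keys p" "b \<in> keys q"
    using Poly_Mapping.keys_mult[of p q] by auto
  then show "keys m \<subseteq> {1..N}" using p q Poly_Mapping.keys_add[of a b] by blast
qed

lemma mpoly_carrier_uminus: "p \<in> carrier (mpoly_ring N) \<Longrightarrow> - p \<in> carrier (mpoly_ring N)"
  by (auto simp: mpoly_ring_carrier in_keys_iff)

lemma mpoly_carrier_sum:
  "(\<And>i. i \<in> A \<Longrightarrow> h i \<in> carrier (mpoly_ring N)) \<Longrightarrow> sum h A \<in> carrier (mpoly_ring N)"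
  by (induction A rule: infinite_finite_induct) (auto simp: mpoly_carrier_0 mpoly_carrier_add)

lemma mpoly_carrier_const: "mpoly_const c \<in> carrier (mpoly_ring N)"
  by (auto simp: mpoly_ring_carrier mpoly_const_def)

lemma mpoly_carrier_var: "i \<in> {1..N} \<Longrightarrow> mpoly_var i \<in> carrier (mpoly_ring N)"
  by (auto simp: mpoly_ring_carrier mpoly_var_def)

lemma cring_mpoly_ring: "cring (mpoly_ring N :: 'k::field mpoly ring)"
proof (rule cringI)
  show "abelian_group (mpoly_ring N :: 'k mpoly ring)"
  proof (rule abelian_groupI)
    fix p :: "'k mpoly" assume "p \<in> carrier (mpoly_ring N)"
    then show "\<exists>y\<in>carrier (mpoly_ring N). y \<oplus>\<^bsub>mpoly_ring N\<^esub> p = \<zero>\<^bsub>mpoly_ring N\<^esub>"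
      by (intro bexI[of _ "- p"]) (auto simp: mpoly_carrier_uminus)
  qed (auto simp: mpoly_carrier_add mpoly_carrier_0 add_ac)
  show "comm_monoid (mpoly_ring N :: 'k mpoly ring)"
    by (rule comm_monoidI) (auto simp: mpoly_carrier_mult mpoly_carrier_1 mult_ac)
qed (auto simp: distrib_right)

lemma mpoly_const_mult: "mpoly_const (a * b) = mpoly_const a * mpoly_const b"
  and mpoly_const_add: "mpoly_const (a + b) = mpoly_const a + mpoly_const b"
  and mpoly_const_0: "mpoly_const 0 = 0"
  and mpoly_const_1: "mpoly_const 1 = 1"
  by (simp_all add: mpoly_const_def mult_single single_add)

lemma graded_maximal_ideal_sum:
  assumes "p \<in> (graded_maximal_ideal N :: 'k::field mpoly set)"
  shows "\<exists>q. (\<forall>i\<in>{1..N}. q i \<in> carrier (mpoly_ring N)) \<and> p = (\<Sum>i\<in>{1..N}. q i * mpoly_var i)"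
proof -
  interpret R: cring "mpoly_ring N :: 'k mpoly ring" by (rule cring_mpoly_ring)
  let ?J = "{p :: 'k mpoly. \<exists>q. (\<forall>i\<in>{1..N}. q i \<in> carrier (mpoly_ring N)) \<and> p = (\<Sum>i\<in>{1..N}. q i * mpoly_var i)}"
  have J0: "0 \<in> ?J" unfolding mem_Collect_eq
    by (rule exI[of _ "\<lambda>_. 0"]) (simp add: mpoly_carrier_0)
  have JI: "(\<Sum>i\<in>{1..N}. q i * mpoly_var i) \<in> ?J" if "\<And>i. i \<in> {1..N} \<Longrightarrow> q i \<in> carrier (mpoly_ring N)" for q
    using that by blast
  have Jadd: "a + b \<in> ?J" if ab: "a \<in> ?J" "b \<in> ?J" for a b
  proof -
    obtain q r where qr: "\<forall>i\<in>{1..N}. q i \<in> carrier (mpoly_ring N)" "a = (\<Sum>i\<in>{1..N}. q i * mpoly_var i)"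
     "\<forall>i\<in>{1..N}. r i \<in> carrier (mpoly_ring N)" "b = (\<Sum>i\<in>{1..N}. r i * mpoly_var i)"
      using ab by blast
    show ?thesis
      unfolding qr(2,4) sum.distrib[symmetric] distrib_right[symmetric]
      by (rule JI) (use qr(1,3) in \<open>simp add: mpoly_carrier_add\<close>)
  qed
  have Jmult: "a * b \<in> ?J" if a: "a \<in> carrier (mpoly_ring N)" and b: "b \<in> ?J" for a b
  proof -
    obtain r where r: "\<forall>i\<in>{1..N}. r i \<in> carrier (mpoly_ring N)" "b = (\<Sum>i\<in>{1..N}. r i * mpoly_var i)"
      using b by blast
    show ?thesis
      unfolding r(2) sum_distrib_left mult.assoc[symmetric]
      by (rule JI) (use r(1) a in \<open>simp add: mpoly_carrier_mult\<close>)
  qed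
  have J: "?J \<subseteq> carrier (mpoly_ring N)"
    by (auto intro!: mpoly_carrier_sum mpoly_carrier_mult mpoly_carrier_var)
  have ideal: "ideal ?J (mpoly_ring N)"
  proof (rule idealI)
    show "ring (mpoly_ring N :: 'k mpoly ring)" by (rule R.ring_axioms)
    show "subgroup ?J (add_monoid (mpoly_ring N))"
    proof (rule R.add.subgroupI)
      fix a assume "a \<in> ?J"
      then have "(- 1) * a \<in> ?J"
        by (intro Jmult) (simp_all add: mpoly_carrier_uminus mpoly_carrier_1)
      moreover have "a \<in> carrier (mpoly_ring N)" using \<open>a \<in> ?J\<close> J by blast
      then have "\<ominus>\<^bsub>mpoly_ring N\<^esub> a = (- 1) * a"
        by (intro R.minus_equality) (simp_all add: mpoly_carrier_uminus)
      ultimately show "\<ominus>\<^bsub>mpoly_ring N\<^esub> a \<in> ?J" by simp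
    next
      fix a b assume "a \<in> ?J" "b \<in> ?J"
      from Jadd[OF this] show "a \<oplus>\<^bsub>mpoly_ring N\<^esub> b \<in> ?J" by simp
    qed (use J J0 in auto)
  next
    fix a b :: "'k mpoly" assume "a \<in> ?J" "b \<in> carrier (mpoly_ring N)"
    from Jmult[OF this(2,1)] show "b \<otimes>\<^bsub>mpoly_ring N\<^esub> a \<in> ?J" "a \<otimes>\<^bsub>mpoly_ring N\<^esub> b \<in> ?J"
      by (simp_all only: mpoly_ring_simps mult.commute[of a b])
  qed
  have "mpoly_var ` {1..N} \<subseteq> ?J"
  proof (rule image_subsetI)
    fix i assume i: "i \<in> {1..N}"
    have eq: "mpoly_var i = (\<Sum>i'\<in>{1..N}. (if i' = i then 1 else 0) * mpoly_var i' :: 'k mpoly)"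
      using i by (simp add: if_distrib[of "\<lambda>c. c * _"] cong: if_cong)
    show "mpoly_var i \<in> ?J" unfolding eq by (rule JI) (simp add: mpoly_carrier_0 mpoly_carrier_1)
  qed
  from R.genideal_minimal[OF ideal this] show ?thesis using assms unfolding graded_maximal_ideal_def by blast
qed

section \<open>Linear coordinates on a module\<close>

text \<open>A basis of \<open>Z\<close> is extended to a basis of the entire space; \<open>p\<close>
  kills the former and fixes the added vectors.\<close>

lemma (in vector_space) projection_exists:
  assumes "subspace Z"
  shows "\<exists>p. Vector_Spaces.linear scale scale p \<and> (\<forall>z\<in>Z. p z = 0) \<and> (\<forall>x. x - p x \<in> Z)"
proof -
  interpret vp: vector_space_pair scale scale by unfold_locales
  obtain B where B: "B \<subseteq> Z" "independent B" "Z \<subseteq> span B" using maximal_independent_subset by blast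
  let ?B = "extend_basis B"
  have ind: "independent ?B" using independent_extend_basis[OF B(2)] .
  define p where "p = vp.construct ?B (\<lambda>b. if b \<in> B then 0 else b)"
  have lin: "Vector_Spaces.linear scale scale p" unfolding p_def using vp.linear_construct[OF ind] .
  interpret p: Vector_Spaces.linear scale scale p by (rule lin)
  have pb: "p b = (if b \<in> B then 0 else b)" if "b \<in> ?B" for b
    unfolding p_def using vp.construct_basis[OF ind that] .
  have "p z = 0" if "z \<in> Z" for z
  proof -
    have "z \<in> span B" using that B(3) by blast
    then show ?thesis
    proof (induction rule: span_induct)
      case base show ?case by (simp add: subspace_def p.add p.scale p.zero)
    next
      case (step b)
      then show ?case using pb[of b] extend_basis_superset[OF B(2)] by auto
    qed
  qed
  moreover have "x - p x \<in> Z" for x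
  proof -
    have "x \<in> span ?B" using span_extend_basis[OF B(2)] by simp
    then show ?thesis
    proof (induction rule: span_induct)
      case base
      have add: "(a + b) - p (a + b) = (a - p a) + (b - p b)" for a b by (simp add: p.add)
      have sc: "scale c a - p (scale c a) = scale c (a - p a)" for c a
        by (simp add: p.scale scale_right_diff_distrib)
      show ?case unfolding subspace_def mem_Collect_eq add sc
        using assms by (auto simp: subspace_def p.zero)
    next
      case (step b)
      then show ?case using pb[of b] B(1) subspace_0[OF assms] by auto
    qed
  qed
  ultimately show ?thesis using lin by blast
qed

definition pscale :: "'k::field \<Rightarrow> ('b \<Rightarrow>\<^sub>0 'k) \<Rightarrow> 'b \<Rightarrow>\<^sub>0 'k" where
  "pscale c g = Poly_Mapping.map ((*) c) g"

lemma lookup_pscale [simp]: "lookup (pscale c g) b = c * lookup g b"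
  by (simp add: pscale_def Poly_Mapping.map.rep_eq when_def)

lemma vector_space_pscale: "vector_space (pscale :: 'k::field \<Rightarrow> ('b \<Rightarrow>\<^sub>0 'k) \<Rightarrow> _)"
  by unfold_locales (auto intro!: poly_mapping_eqI simp: lookup_add algebra_simps)

lemma (in module) finsum_superset:
  assumes "finite F" "E \<subseteq> F" "\<And>i. i \<in> F - E \<Longrightarrow> h i = \<zero>\<^bsub>M\<^esub>" "h \<in> F \<rightarrow> carrier M"
  shows "finsum M h F = finsum M h E"
  using assms by (intro M.add.finprod_mono_neutral_cong_right) auto

locale mpoly_module = module "mpoly_ring N :: 'k::field mpoly ring" M
  for N :: nat and M :: "('k::field mpoly, 'b) module"
begin

text \<open>Evaluation of a formal linear combination in \<open>M\<close>. Keys outside the carrier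
  are dropped, so that this is a linear map on a whole type, and it is onto
  \<open>M\<close>.\<close>

definition \<Phi> :: "('b \<Rightarrow>\<^sub>0 'k) \<Rightarrow> 'b" where
  "\<Phi> g = (\<Oplus>\<^bsub>M\<^esub>b\<in>keys g \<inter> carrier M. mpoly_const (lookup g b) \<odot>\<^bsub>M\<^esub> b)"

lemma \<Phi>_eq: "finite F \<Longrightarrow> F \<subseteq> carrier M \<Longrightarrow> keys g \<inter> carrier M \<subseteq> F \<Longrightarrow>
    \<Phi> g = (\<Oplus>\<^bsub>M\<^esub>b\<in>F. mpoly_const (lookup g b) \<odot>\<^bsub>M\<^esub> b)"
  unfolding \<Phi>_def
  by (rule finsum_superset[symmetric])
     (auto simp: in_keys_iff mpoly_const_0 mpoly_carrier_const smult_l_null[simplified])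

lemma \<Phi>_closed: "\<Phi> g \<in> carrier M"
  unfolding \<Phi>_def by (rule M.finsum_closed) (auto simp: mpoly_carrier_const)

lemma \<Phi>_add: "\<Phi> (g + h) = \<Phi> g \<oplus>\<^bsub>M\<^esub> \<Phi> h"
proof -
  let ?F = "(keys g \<union> keys h) \<inter> carrier M"
  have "\<Phi> (g + h) = (\<Oplus>\<^bsub>M\<^esub>b\<in>?F. mpoly_const (lookup (g + h) b) \<odot>\<^bsub>M\<^esub> b)"
    using Poly_Mapping.keys_add[of g h] by (intro \<Phi>_eq) auto
  also have "\<dots> = (\<Oplus>\<^bsub>M\<^esub>b\<in>?F. mpoly_const (lookup g b) \<odot>\<^bsub>M\<^esub> b \<oplus>\<^bsub>M\<^esub>
      mpoly_const (lookup h b) \<odot>\<^bsub>M\<^esub> b)"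
    using smult_l_distr[simplified]
    by (intro M.finsum_cong') (auto simp: lookup_add mpoly_const_add mpoly_carrier_const)
  also have "\<dots> = (\<Oplus>\<^bsub>M\<^esub>b\<in>?F. mpoly_const (lookup g b) \<odot>\<^bsub>M\<^esub> b) \<oplus>\<^bsub>M\<^esub>
      (\<Oplus>\<^bsub>M\<^esub>b\<in>?F. mpoly_const (lookup h b) \<odot>\<^bsub>M\<^esub> b)"
    by (intro M.finsum_addf) (auto simp: mpoly_carrier_const)
  also have "\<dots> = \<Phi> g \<oplus>\<^bsub>M\<^esub> \<Phi> h"
    by (subst (1 2) \<Phi>_eq[of ?F]) auto
  finally show ?thesis .
qed

lemma \<Phi>_scale: "\<Phi> (pscale c g) = mpoly_const c \<odot>\<^bsub>M\<^esub> \<Phi> g"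
proof -
  let ?F = "keys g \<inter> carrier M"
  have "\<Phi> (pscale c g) = (\<Oplus>\<^bsub>M\<^esub>b\<in>?F. mpoly_const (lookup (pscale c g) b) \<odot>\<^bsub>M\<^esub> b)"
    by (intro \<Phi>_eq) (auto simp: in_keys_iff)
  also have "\<dots> = (\<Oplus>\<^bsub>M\<^esub>b\<in>?F. mpoly_const c \<odot>\<^bsub>M\<^esub> (mpoly_const (lookup g b) \<odot>\<^bsub>M\<^esub> b))"
    using smult_assoc1[simplified]
    by (intro M.finsum_cong') (auto simp: mpoly_const_mult mpoly_carrier_const)
  also have "\<dots> = mpoly_const c \<odot>\<^bsub>M\<^esub> \<Phi> g"
    unfolding \<Phi>_def by (rule finsum_smult_ldistr[symmetric]) (auto simp: mpoly_carrier_const)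
  finally show ?thesis .
qed

lemma \<Phi>_single: "u \<in> carrier M \<Longrightarrow> \<Phi> (single u 1) = u"
  by (subst \<Phi>_eq[of "{u}"]) (auto simp: mpoly_const_1 smult_one[simplified])

lemma \<Phi>_0: "\<Phi> 0 = \<zero>\<^bsub>M\<^esub>"
  by (simp add: \<Phi>_def)

sublocale W: vector_space "pscale :: 'k \<Rightarrow> ('b \<Rightarrow>\<^sub>0 'k) \<Rightarrow> _"
  by (rule vector_space_pscale)

text \<open>The linear algebra library works with vector spaces that are types. As \<open>\<pi>\<close> projects along the
  kernel of \<open>\<Phi>\<close>, it induces a linear embedding \<open>\<theta>\<close> of \<open>M\<close> into such a space.\<close>

definition \<pi> :: "('b \<Rightarrow>\<^sub>0 'k) \<Rightarrow> 'b \<Rightarrow>\<^sub>0 'k" where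
  "\<pi> = (SOME p. Vector_Spaces.linear pscale pscale p \<and> (\<forall>z. \<Phi> z = \<zero>\<^bsub>M\<^esub> \<longrightarrow> p z = 0) \<and> (\<forall>x. \<Phi> (x - p x) = \<zero>\<^bsub>M\<^esub>))"

lemma \<pi>: "Vector_Spaces.linear pscale pscale \<pi>" "\<Phi> z = \<zero>\<^bsub>M\<^esub> \<Longrightarrow> \<pi> z = 0" "\<Phi> (x - \<pi> x) = \<zero>\<^bsub>M\<^esub>"
proof -
  have "W.subspace {z. \<Phi> z = \<zero>\<^bsub>M\<^esub>}"
    using smult_r_null[simplified]
    by (auto simp: W.subspace_def \<Phi>_0 \<Phi>_add \<Phi>_scale mpoly_carrier_const)
  from W.projection_exists[OF this]
  have "\<exists>p. Vector_Spaces.linear pscale pscale p \<and> (\<forall>z. \<Phi> z = \<zero>\<^bsub>M\<^esub> \<longrightarrow> p z = 0) \<and> (\<forall>x. \<Phi> (x - p x) = \<zero>\<^bsub>M\<^esub>)"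
    by simp
  from someI_ex[OF this] show "Vector_Spaces.linear pscale pscale \<pi>"
    "\<Phi> z = \<zero>\<^bsub>M\<^esub> \<Longrightarrow> \<pi> z = 0" "\<Phi> (x - \<pi> x) = \<zero>\<^bsub>M\<^esub>" unfolding \<pi>_def[symmetric] by blast+
qed

definition \<theta> :: "'b \<Rightarrow> 'b \<Rightarrow>\<^sub>0 'k" where "\<theta> u = \<pi> (single u 1)"

sublocale \<pi>: Vector_Spaces.linear pscale pscale \<pi> by (rule \<pi>(1))

lemma \<Phi>_\<pi>: "\<Phi> (\<pi> x) = \<Phi> x"
proof -
  have "\<Phi> x = \<Phi> (x - \<pi> x) \<oplus>\<^bsub>M\<^esub> \<Phi> (\<pi> x)" unfolding \<Phi>_add[symmetric] by simp
  then show ?thesis by (simp add: \<pi>(3) \<Phi>_closed)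
qed

lemma \<Phi>_\<theta>: "u \<in> carrier M \<Longrightarrow> \<Phi> (\<theta> u) = u"
  by (simp add: \<theta>_def \<Phi>_\<pi> \<Phi>_single)

lemma \<pi>_cong: assumes "\<Phi> x = \<Phi> y" shows "\<pi> x = \<pi> y"
proof -
  have "\<Phi> (x - y) \<oplus>\<^bsub>M\<^esub> \<Phi> y = \<Phi> y" unfolding \<Phi>_add[symmetric] using assms by simp
  then have "\<Phi> (x - y) = \<zero>\<^bsub>M\<^esub>" using \<Phi>_closed by (metis M.add.r_cancel_one')
  then have "\<pi> (x - y) = 0" by (rule \<pi>(2))
  then show ?thesis by (simp add: \<pi>.diff)
qed

lemma \<theta>_\<Phi>: "\<theta> (\<Phi> x) = \<pi> x"
  unfolding \<theta>_def by (rule \<pi>_cong) (simp add: \<Phi>_single \<Phi>_closed)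

lemma \<theta>_add: assumes "u \<in> carrier M" "v \<in> carrier M" shows "\<theta> (u \<oplus>\<^bsub>M\<^esub> v) = \<theta> u + \<theta> v"
  using \<theta>_\<Phi>[of "\<theta> u + \<theta> v"] assms
  by (simp add: \<Phi>_add \<Phi>_\<theta> \<pi>.add) (simp add: \<theta>_\<Phi>[symmetric] \<Phi>_\<theta>)

lemma \<theta>_scale: assumes "u \<in> carrier M" shows "\<theta> (mpoly_const c \<odot>\<^bsub>M\<^esub> u) = pscale c (\<theta> u)"
  using \<theta>_\<Phi>[of "pscale c (\<theta> u)"] assms
  by (simp add: \<Phi>_scale \<Phi>_\<theta> \<pi>.scale) (simp add: \<theta>_\<Phi>[symmetric] \<Phi>_\<theta>)

lemma \<theta>_0: "\<theta> \<zero>\<^bsub>M\<^esub> = 0"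
  using \<theta>_\<Phi>[of 0] by (simp add: \<Phi>_0 \<pi>.zero)

lemma \<theta>_inj: "u \<in> carrier M \<Longrightarrow> v \<in> carrier M \<Longrightarrow> \<theta> u = \<theta> v \<longleftrightarrow> u = v"
  by (metis \<Phi>_\<theta>)

lemma \<theta>_finsum: "(\<And>i. i \<in> A \<Longrightarrow> h i \<in> carrier M) \<Longrightarrow> finite A \<Longrightarrow>
   \<theta> (\<Oplus>\<^bsub>M\<^esub>i\<in>A. h i) = (\<Sum>i\<in>A. \<theta> (h i))"
proof (induction A rule: infinite_finite_induct)
  case (insert i A)
  then show ?case by (subst M.finsum_insert) (auto simp: \<theta>_add M.finsum_closed Pi_iff)
qed (simp_all add: \<theta>_0)

end

section \<open>Graded modules\<close>

lemma mpoly_sum_monomials: "p = (\<Sum>m\<in>keys p. single m (lookup p m))"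
  by (rule poly_mapping_eqI)
     (auto simp: lookup_sum lookup_single when_def in_keys_iff sum.delta)

lemma mpoly_var_mult_single:
  "mpoly_var i * single m c = single (single i 1 + m) c"
  by (simp add: mpoly_var_def mult_single)

lemma monomial_cases:
  fixes m :: "nat \<Rightarrow>\<^sub>0 nat"
  assumes "i \<in> keys m"
  obtains m' where "m = single i 1 + m'" "keys m' \<subseteq> keys m"
proof
  show "m = single i 1 + (m - single i 1)"
    using assms by (auto intro!: poly_mapping_eqI simp: lookup_add lookup_minus lookup_single when_def in_keys_iff)
  show "keys (m - single i 1) \<subseteq> keys m"
    by (auto simp: in_keys_iff lookup_minus)
qed

lemma mono_degree_eq: "finite A \<Longrightarrow> keys m \<subseteq> A \<Longrightarrow> mono_degree m = (\<Sum>i\<in>A. lookup m i)"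
  unfolding mono_degree_def by (rule sum.mono_neutral_left) (auto simp: in_keys_iff)

lemma mono_degree_add: "mono_degree (m + m') = mono_degree m + mono_degree m'"
proof -
  let ?A = "keys m \<union> keys m'"
  show ?thesis using Poly_Mapping.keys_add[of m m']
    by (subst (1 2 3) mono_degree_eq[of ?A]) (auto simp: lookup_add sum.distrib)
qed

lemma mono_degree_single: "mono_degree (single i n) = n"
  by (simp add: mono_degree_def)

lemma mono_degree_0 [simp]: "mono_degree 0 = 0"
  by (simp add: mono_degree_def)

text \<open>Reduces a claim about the action of all polynomials to constants and variables, which
  are homogeneous of degree 0 and 1.\<close>

lemma mpoly_induct [consumes 1, case_names zero const add var]:
  assumes p: "p \<in> carrier (mpoly_ring N)"
    and "P 0" and const: "\<And>c. P (mpoly_const c)" and add: "\<And>p q. P p \<Longrightarrow> P q \<Longrightarrow> P (p + q)"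
    and var: "\<And>i p. i \<in> {1..N} \<Longrightarrow> p \<in> carrier (mpoly_ring N) \<Longrightarrow> P p \<Longrightarrow> P (mpoly_var i * p)"
  shows "P p"
proof -
  have mono: "P (single m c)" if "keys m \<subseteq> {1..N}" for m c
    using that
  proof (induction "mono_degree m" arbitrary: m)
    case 0
    then have "m = 0" by (auto simp: mono_degree_def in_keys_iff intro!: poly_mapping_eqI)
    then show ?case using const by (simp add: mpoly_const_def)
  next
    case (Suc n)
    then have "m \<noteq> 0" by auto
    then obtain i where i: "i \<in> keys m" by (metis ex_in_conv lookup_zero not_in_keys_iff_lookup_eq_zero poly_mapping_eqI)
    then obtain m' where m': "m = single i 1 + m'" "keys m' \<subseteq> keys m"
      by (rule monomial_cases)
    have "n = mono_degree m'" using Suc(2) unfolding m'(1) by (simp add: mono_degree_add mono_degree_single)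
    then have "P (single m' c)" using Suc(1,3) m'(2) by blast
    moreover have "single m' c \<in> carrier (mpoly_ring N)"
      using m'(2) Suc(3) by (auto simp: mpoly_ring_carrier)
    ultimately show ?case unfolding m'(1) mpoly_var_mult_single[symmetric] using i Suc(3) by (intro var) auto
  qed
  have "P (\<Sum>m\<in>A. single m (lookup p m))" if "finite A" "A \<subseteq> keys p" for A
    using that
  proof (induction A rule: finite_induct)
    case empty
    then show ?case using \<open>P 0\<close> by simp
  next
    case (insert m A)
    then have "keys m \<subseteq> {1..N}" using p by (auto simp only: mpoly_ring_carrier)
    then show ?case using insert by (simp add: add mono)
  qed
  from this[of "keys p"] show ?thesis using mpoly_sum_monomials[of p] by simp
qed

lemma mpoly_const_component: "mpoly_const c \<in> mpoly_component N 0"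
  by (auto simp: mpoly_component_def mpoly_const_def mpoly_ring_carrier)

lemma mpoly_var_component: "i \<in> {1..N} \<Longrightarrow> mpoly_var i \<in> mpoly_component N 1"
  by (auto simp: mpoly_component_def mpoly_var_def mpoly_ring_carrier mono_degree_single)

lemma mpoly_component_carrier: "p \<in> mpoly_component N j \<Longrightarrow> p \<in> carrier (mpoly_ring N)"
  by (simp add: mpoly_component_def)

context mpoly_module
begin

text \<open>\<open>K_dim\<close> is a definite description, so all bases must be shown to have the
  same size. \<theta> carries them to bases in the sense of linear algebra, where the dimension is
  unique.\<close>

lemma K_basis_dim:
  assumes basis: "is_K_basis M V B" and V: "V \<subseteq> carrier M" "\<zero>\<^bsub>M\<^esub> \<in> V"
  shows "W.dim (\<theta> ` V) = card B \<and> fin_dim pscale (\<theta> ` V)"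
proof -
  have fB: "finite B" and BD: "B \<subseteq> V" and uniq: "\<And>v. v \<in> V \<Longrightarrow>
      \<exists>!a. a \<in> B \<rightarrow>\<^sub>E UNIV \<and> v = (\<Oplus>\<^bsub>M\<^esub>b\<in>B. mpoly_const (a b) \<odot>\<^bsub>M\<^esub> b)"
    using basis unfolding is_K_basis_def by auto
  have Bc: "b \<in> carrier M" if "b \<in> B" for b using that BD V(1) by blast
  have inj: "inj_on \<theta> B" using Bc \<theta>_inj by (auto simp: inj_on_def)
  have \<theta>sum: "\<theta> (\<Oplus>\<^bsub>M\<^esub>b\<in>B. mpoly_const (a b) \<odot>\<^bsub>M\<^esub> b) = (\<Sum>b\<in>B. pscale (a b) (\<theta> b))" for a
    using Bc fB by (subst \<theta>_finsum) (auto simp: \<theta>_scale mpoly_carrier_const)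
  have sumc: "(\<Oplus>\<^bsub>M\<^esub>b\<in>B. mpoly_const (a b) \<odot>\<^bsub>M\<^esub> b) \<in> carrier M" for a
    using Bc by (auto intro!: M.finsum_closed simp: mpoly_carrier_const)
  have span: "\<theta> ` V \<subseteq> W.span (\<theta> ` B)"
  proof clarify
    fix v assume "v \<in> V"
    obtain a where "v = (\<Oplus>\<^bsub>M\<^esub>b\<in>B. mpoly_const (a b) \<odot>\<^bsub>M\<^esub> b)" using ex1_implies_ex[OF uniq[OF \<open>v \<in> V\<close>]] by (elim exE conjE)
    then have eq: "\<theta> v = (\<Sum>b\<in>B. pscale (a b) (\<theta> b))" using \<theta>sum by simp
    show "\<theta> v \<in> W.span (\<theta> ` B)"
      unfolding eq by (rule W.span_sum, rule W.span_scale, rule W.span_base, rule imageI)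
  qed
  have ind: "W.independent (\<theta> ` B)"
  proof (rule W.independent_if_scalars_zero)
    fix f x assume sum: "(\<Sum>x\<in>\<theta> ` B. pscale (f x) x) = 0" and x: "x \<in> \<theta> ` B"
    define a where "a = restrict (\<lambda>b. f (\<theta> b)) B"
    have "\<theta> (\<Oplus>\<^bsub>M\<^esub>b\<in>B. mpoly_const (a b) \<odot>\<^bsub>M\<^esub> b) = 0"
      unfolding \<theta>sum using sum by (simp add: sum.reindex[OF inj] a_def)
    then have s1: "(\<Oplus>\<^bsub>M\<^esub>b\<in>B. mpoly_const (a b) \<odot>\<^bsub>M\<^esub> b) = \<zero>\<^bsub>M\<^esub>"
      using \<theta>_inj[OF sumc M.zero_closed, of a] by (simp add: \<theta>_0)
    \<comment> \<open>Independence is the uniqueness of the coefficients of the zero vector, which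
      also has the trivial ones.\<close>
    have s2: "(\<Oplus>\<^bsub>M\<^esub>b\<in>B. mpoly_const (restrict (\<lambda>_. 0) B b) \<odot>\<^bsub>M\<^esub> b) = \<zero>\<^bsub>M\<^esub>"
      using Bc smult_l_null by (intro M.add.finprod_one_eqI) (auto simp: mpoly_const_0)
    have "a \<in> B \<rightarrow>\<^sub>E UNIV \<and> \<zero>\<^bsub>M\<^esub> = (\<Oplus>\<^bsub>M\<^esub>b\<in>B. mpoly_const (a b) \<odot>\<^bsub>M\<^esub> b)"
      using s1 by (simp add: a_def)
    moreover have "restrict (\<lambda>_. 0) B \<in> B \<rightarrow>\<^sub>E UNIV \<and>
        \<zero>\<^bsub>M\<^esub> = (\<Oplus>\<^bsub>M\<^esub>b\<in>B. mpoly_const (restrict (\<lambda>_. 0) B b) \<odot>\<^bsub>M\<^esub> b)"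
      unfolding s2 by simp
    ultimately have "a = restrict (\<lambda>_. 0) B"
      by (rule trans[OF the1_equality[OF uniq[OF V(2)], symmetric] the1_equality[OF uniq[OF V(2)]]])
    moreover obtain b where "b \<in> B" "x = \<theta> b" using x by auto
    ultimately show "f x = 0" unfolding a_def by (metis restrict_apply')
  qed (use fB in auto)
  have "W.dim (\<theta> ` V) = card (\<theta> ` B)"
    using BD by (intro W.basis_card_eq_dim[symmetric] span ind) auto
  then show ?thesis using card_image[OF inj] span fB unfolding fin_dim_def by auto
qed

lemma K_dim_eq_card:
  "is_K_basis M V B \<Longrightarrow> V \<subseteq> carrier M \<Longrightarrow> \<zero>\<^bsub>M\<^esub> \<in> V \<Longrightarrow> K_dim M V = card B"
  unfolding K_dim_def using K_basis_dim by (intro the_equality) metis+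

end

locale graded_mpoly_module = mpoly_module N M
  for N :: nat and M :: "('k::field mpoly, 'b) module" +
  fixes D :: "int \<Rightarrow> 'b set"
  assumes grading: "is_grading N M D"
begin

lemma D_subgroup: "additive_subgroup (D j) M"
  using grading by (simp add: is_grading_def)

lemma D_carrier: "u \<in> D j \<Longrightarrow> u \<in> carrier M"
  using additive_subgroup.a_subset[OF D_subgroup] by blast

lemma D_add: "u \<in> D j \<Longrightarrow> v \<in> D j \<Longrightarrow> u \<oplus>\<^bsub>M\<^esub> v \<in> D j"
  and D_0: "\<zero>\<^bsub>M\<^esub> \<in> D j"
  using additive_subgroup.a_closed[OF D_subgroup] additive_subgroup.zero_closed[OF D_subgroup] by blast+

lemma D_smult: "p \<in> mpoly_component N i \<Longrightarrow> u \<in> D j \<Longrightarrow> p \<odot>\<^bsub>M\<^esub> u \<in> D (i + j)"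
  using grading unfolding is_grading_def by blast

lemma D_const: "u \<in> D j \<Longrightarrow> mpoly_const c \<odot>\<^bsub>M\<^esub> u \<in> D j"
  using D_smult[OF mpoly_const_component] by fastforce

definition dec :: "'b \<Rightarrow> (int \<Rightarrow> 'b) \<Rightarrow> bool" where
  "dec u c \<longleftrightarrow> (\<forall>j. c j \<in> D j) \<and> finite {j. c j \<noteq> \<zero>\<^bsub>M\<^esub>} \<and> u = (\<Oplus>\<^bsub>M\<^esub>j\<in>{j. c j \<noteq> \<zero>\<^bsub>M\<^esub>}. c j)"

definition comp :: "'b \<Rightarrow> int \<Rightarrow> 'b" where "comp u = (THE c. dec u c)"

lemma ex1_dec: "u \<in> carrier M \<Longrightarrow> \<exists>!c. dec u c"
  using grading unfolding is_grading_def dec_def by blast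

lemma dec_comp: "u \<in> carrier M \<Longrightarrow> dec u (comp u)"
  unfolding comp_def using theI'[OF ex1_dec] .

lemma dec_eq: assumes "dec u c" shows "comp u = c"
proof -
  have "u \<in> carrier M" using assms unfolding dec_def using M.finsum_closed[of c] D_carrier by (metis Pi_I)
  then show ?thesis using ex1_dec dec_comp assms by blast
qed

lemma decI:
  assumes "finite F" "\<And>j. c j \<in> D j" "\<And>j. j \<notin> F \<Longrightarrow> c j = \<zero>\<^bsub>M\<^esub>" "u = (\<Oplus>\<^bsub>M\<^esub>j\<in>F. c j)"
  shows "dec u c"
proof -
  have sub: "{j. c j \<noteq> \<zero>\<^bsub>M\<^esub>} \<subseteq> F" using assms(3) by auto
  have "(\<Oplus>\<^bsub>M\<^esub>j\<in>F. c j) = (\<Oplus>\<^bsub>M\<^esub>j\<in>{j. c j \<noteq> \<zero>\<^bsub>M\<^esub>}. c j)"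
    using assms(2) D_carrier by (intro finsum_superset[OF assms(1) sub]) auto
  then show ?thesis unfolding dec_def using assms finite_subset[OF sub] by auto
qed

lemma decD:
  assumes "dec u c" "finite F" "{j. c j \<noteq> \<zero>\<^bsub>M\<^esub>} \<subseteq> F"
  shows "u = (\<Oplus>\<^bsub>M\<^esub>j\<in>F. c j)"
proof -
  have "(\<Oplus>\<^bsub>M\<^esub>j\<in>F. c j) = (\<Oplus>\<^bsub>M\<^esub>j\<in>{j. c j \<noteq> \<zero>\<^bsub>M\<^esub>}. c j)"
    using assms(1) D_carrier by (intro finsum_superset[OF assms(2,3)]) (auto simp: dec_def)
  then show ?thesis using assms(1) by (simp add: dec_def)
qed

lemma comp_D: "u \<in> carrier M \<Longrightarrow> comp u j \<in> D j"
  and comp_finite: "u \<in> carrier M \<Longrightarrow> finite {j. comp u j \<noteq> \<zero>\<^bsub>M\<^esub>}"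
  using dec_comp[of u] by (auto simp: dec_def)

lemma comp_add:
  assumes u: "u \<in> carrier M" and v: "v \<in> carrier M"
  shows "comp (u \<oplus>\<^bsub>M\<^esub> v) j = comp u j \<oplus>\<^bsub>M\<^esub> comp v j"
proof -
  let ?F = "{j. comp u j \<noteq> \<zero>\<^bsub>M\<^esub>} \<union> {j. comp v j \<noteq> \<zero>\<^bsub>M\<^esub>}"
  have fin: "finite ?F" using comp_finite u v by auto
  have uv: "u \<oplus>\<^bsub>M\<^esub> v = (\<Oplus>\<^bsub>M\<^esub>j\<in>?F. comp u j) \<oplus>\<^bsub>M\<^esub> (\<Oplus>\<^bsub>M\<^esub>j\<in>?F. comp v j)"
    using decD[OF dec_comp[OF u] fin] decD[OF dec_comp[OF v] fin] by auto
  have "dec (u \<oplus>\<^bsub>M\<^esub> v) (\<lambda>j. comp u j \<oplus>\<^bsub>M\<^esub> comp v j)"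
  proof (rule decI[OF fin])
    show "u \<oplus>\<^bsub>M\<^esub> v = (\<Oplus>\<^bsub>M\<^esub>j\<in>?F. comp u j \<oplus>\<^bsub>M\<^esub> comp v j)"
      unfolding uv using comp_D u v D_carrier by (intro M.finsum_addf[symmetric]) auto
  qed (auto simp: u v intro!: D_add comp_D)
  then show ?thesis using dec_eq by metis
qed

lemma comp_smult:
  assumes p: "p \<in> mpoly_component N i" and u: "u \<in> carrier M"
  shows "comp (p \<odot>\<^bsub>M\<^esub> u) j = p \<odot>\<^bsub>M\<^esub> comp u (j - i)"
proof -
  let ?F = "{j. comp u j \<noteq> \<zero>\<^bsub>M\<^esub>}"
  have pc: "p \<in> carrier (mpoly_ring N)" using p by (rule mpoly_component_carrier)
  have fin: "finite ?F" using comp_finite u by auto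
  have cc: "comp u j \<in> carrier M" for j using comp_D[OF u] D_carrier by blast
  have inj: "inj_on (\<lambda>j. i + j) ?F" by (auto simp: inj_on_def)
  have "p \<odot>\<^bsub>M\<^esub> u = (\<Oplus>\<^bsub>M\<^esub>j\<in>?F. p \<odot>\<^bsub>M\<^esub> comp u j)"
    using decD[OF dec_comp[OF u] fin order_refl] finsum_smult_ldistr[OF fin pc, of "comp u"] cc by auto
  also have "\<dots> = (\<Oplus>\<^bsub>M\<^esub>j\<in>(\<lambda>j. i + j) ` ?F. p \<odot>\<^bsub>M\<^esub> comp u (j - i))"
    using cc pc by (subst M.finsum_reindex[OF _ inj]) auto
  finally have eq: "p \<odot>\<^bsub>M\<^esub> u = (\<Oplus>\<^bsub>M\<^esub>j\<in>(\<lambda>j. i + j) ` ?F. p \<odot>\<^bsub>M\<^esub> comp u (j - i))" .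
  have "dec (p \<odot>\<^bsub>M\<^esub> u) (\<lambda>j. p \<odot>\<^bsub>M\<^esub> comp u (j - i))"
  proof (rule decI[OF _ _ _ eq])
    show "p \<odot>\<^bsub>M\<^esub> comp u (j - i) \<in> D j" for j using D_smult[OF p comp_D[OF u, of "j - i"]] by simp
    show "p \<odot>\<^bsub>M\<^esub> comp u (j - i) = \<zero>\<^bsub>M\<^esub>" if "j \<notin> (\<lambda>j. i + j) ` ?F" for j
    proof -
      have "j = i + (j - i)" by simp
      then have "comp u (j - i) = \<zero>\<^bsub>M\<^esub>" using that by blast
      then show ?thesis using smult_r_null[OF pc] by simp
    qed
  qed (use fin in auto)
  then show ?thesis using dec_eq by metis
qed

lemma comp_of_D: assumes "u \<in> D j" shows "comp u j = u"
proof -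
  have "dec u (\<lambda>j'. if j' = j then u else \<zero>\<^bsub>M\<^esub>)"
    using assms D_carrier[OF assms] by (intro decI[of "{j}"]) (auto simp: D_0)
  from dec_eq[OF this] show ?thesis by simp
qed

definition act :: "'k mpoly \<Rightarrow> ('b \<Rightarrow>\<^sub>0 'k) \<Rightarrow> 'b \<Rightarrow>\<^sub>0 'k" where "act p g = \<theta> (p \<odot>\<^bsub>M\<^esub> \<Phi> g)"

lemma act_\<theta>: "u \<in> carrier M \<Longrightarrow> act p (\<theta> u) = \<theta> (p \<odot>\<^bsub>M\<^esub> u)"
  by (simp add: act_def \<Phi>_\<theta>)

sublocale op: operator_module pscale "carrier (mpoly_ring N)" act "\<theta> ` carrier M" mpoly_var N
proof
  fix p q :: "'k mpoly" and a b :: "'b \<Rightarrow>\<^sub>0 'k" and c :: 'k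
  assume p: "p \<in> carrier (mpoly_ring N)"
  show "act p (a + b) = act p a + act p b"
    using p by (simp add: act_def \<Phi>_add \<Phi>_closed smult_r_distr \<theta>_add)
  have "p \<odot>\<^bsub>M\<^esub> (mpoly_const c \<odot>\<^bsub>M\<^esub> \<Phi> a) = mpoly_const c \<odot>\<^bsub>M\<^esub> (p \<odot>\<^bsub>M\<^esub> \<Phi> a)"
    using p smult_assoc1[simplified] by (metis \<Phi>_closed mpoly_carrier_const mult.commute)
  then show "act p (pscale c a) = pscale c (act p a)"
    using p by (simp add: act_def \<Phi>_scale \<Phi>_closed \<theta>_scale)
  show "act p a \<in> \<theta> ` carrier M" using p \<Phi>_closed by (auto simp: act_def)
  assume q: "q \<in> carrier (mpoly_ring N)"
  show "act (p * q) a = act p (act q a)"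
    using p q smult_assoc1[simplified] by (simp add: act_def \<Phi>_\<theta> \<Phi>_closed)
  show "act (p + q) a = act p a + act q a"
    using p q smult_l_distr[simplified] by (simp add: act_def \<theta>_add \<Phi>_closed)
  show "p + q \<in> carrier (mpoly_ring N)" "p * q \<in> carrier (mpoly_ring N)"
    using p q by (rule mpoly_carrier_add, rule mpoly_carrier_mult)
next
  show "W.subspace (\<theta> ` carrier M)"
    unfolding W.subspace_def
  proof (intro conjI ballI allI)
    show "0 \<in> \<theta> ` carrier M" using \<theta>_0 by (metis M.zero_closed imageI)
  next
    fix x y assume "x \<in> \<theta> ` carrier M" "y \<in> \<theta> ` carrier M"
    then show "x + y \<in> \<theta> ` carrier M" by (auto simp: \<theta>_add[symmetric])
  next
    fix c x assume "x \<in> \<theta> ` carrier M"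
    then show "pscale c x \<in> \<theta> ` carrier M" by (auto simp: \<theta>_scale[symmetric] mpoly_carrier_const)
  qed
qed (auto simp: mpoly_carrier_0 mpoly_carrier_var)

lemma \<theta>D_subspace: "W.subspace (\<theta> ` D j)"
  unfolding W.subspace_def
proof (intro conjI ballI allI)
  show "0 \<in> \<theta> ` D j" using \<theta>_0 D_0 by (metis imageI)
next
  fix x y assume "x \<in> \<theta> ` D j" "y \<in> \<theta> ` D j"
  then show "x + y \<in> \<theta> ` D j" using D_add D_carrier by (auto simp: \<theta>_add[symmetric])
next
  fix c x assume "x \<in> \<theta> ` D j"
  then show "pscale c x \<in> \<theta> ` D j" using D_const D_carrier by (auto simp: \<theta>_scale[symmetric])
qed

text \<open>\<Phi> inverts \<theta> on the carrier, so a linear basis of the image can be pulled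
  back. Existence of a basis gives the description \<open>K_dim\<close> its value.\<close>

lemma K_basis_exists:
  assumes "fin_dim pscale (\<theta> ` D j)"
  shows "\<exists>B. is_K_basis M (D j) B"
proof -
  obtain C where C: "finite C" "W.independent C" "W.span C = \<theta> ` D j" "C \<subseteq> \<theta> ` D j"
    using W.fin_dim_basis[OF \<theta>D_subspace assms] by metis
  define B where "B = \<Phi> ` C"
  have \<Phi>C: "\<Phi> c \<in> D j \<and> \<theta> (\<Phi> c) = c" if "c \<in> C" for c
  proof -
    from subsetD[OF C(4) that] obtain u where "u \<in> D j" "c = \<theta> u" by (rule imageE)
    then show ?thesis by (simp add: \<Phi>_\<theta> D_carrier)
  qed
  have BD: "B \<subseteq> D j" unfolding B_def using \<Phi>C by blast
  have inj: "inj_on \<Phi> C" using \<Phi>C by (metis inj_onI)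
  have fB: "finite B" unfolding B_def using C(1) by simp
  have Bc: "b \<in> carrier M" if "b \<in> B" for b using that BD D_carrier by blast
  have \<theta>sum: "\<theta> (\<Oplus>\<^bsub>M\<^esub>b\<in>B. mpoly_const (a b) \<odot>\<^bsub>M\<^esub> b) = (\<Sum>c\<in>C. pscale (a (\<Phi> c)) c)" for a
  proof -
    have "\<theta> (\<Oplus>\<^bsub>M\<^esub>b\<in>B. mpoly_const (a b) \<odot>\<^bsub>M\<^esub> b) = (\<Sum>b\<in>B. pscale (a b) (\<theta> b))"
      using Bc fB by (subst \<theta>_finsum) (auto simp: \<theta>_scale mpoly_carrier_const)
    also have "\<dots> = (\<Sum>c\<in>C. pscale (a (\<Phi> c)) c)"
      unfolding B_def by (subst sum.reindex[OF inj]) (auto intro!: sum.cong simp: \<Phi>C)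
    finally show ?thesis .
  qed
  have sumc: "(\<Oplus>\<^bsub>M\<^esub>b\<in>B. mpoly_const (a b) \<odot>\<^bsub>M\<^esub> b) \<in> carrier M" for a
    using Bc by (auto intro!: M.finsum_closed simp: mpoly_carrier_const)
  have "\<exists>!a. a \<in> B \<rightarrow>\<^sub>E UNIV \<and> v = (\<Oplus>\<^bsub>M\<^esub>b\<in>B. mpoly_const (a b) \<odot>\<^bsub>M\<^esub> b)" if v: "v \<in> D j" for v
  proof -
    have "\<theta> v \<in> W.span C" using v C(3) by blast
    then obtain f where f: "\<theta> v = (\<Sum>c\<in>C. pscale (f c) c)" unfolding W.span_finite[OF C(1)] by blast
    define a where "a = restrict (\<lambda>b. f (\<theta> b)) B"
    have eq: "\<theta> (\<Oplus>\<^bsub>M\<^esub>b\<in>B. mpoly_const (a b) \<odot>\<^bsub>M\<^esub> b) = \<theta> v"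
      unfolding \<theta>sum f by (intro sum.cong) (auto simp: a_def B_def \<Phi>C)
    have a: "v = (\<Oplus>\<^bsub>M\<^esub>b\<in>B. mpoly_const (a b) \<odot>\<^bsub>M\<^esub> b)"
      by (rule sym, rule iffD1[OF \<theta>_inj[OF sumc D_carrier[OF v]] eq])
    show ?thesis
    proof (rule ex1I[of _ a])
      show "a \<in> B \<rightarrow>\<^sub>E UNIV \<and> v = (\<Oplus>\<^bsub>M\<^esub>b\<in>B. mpoly_const (a b) \<odot>\<^bsub>M\<^esub> b)" using a by (auto simp: a_def)
      fix a' assume a': "a' \<in> B \<rightarrow>\<^sub>E UNIV \<and> v = (\<Oplus>\<^bsub>M\<^esub>b\<in>B. mpoly_const (a' b) \<odot>\<^bsub>M\<^esub> b)"
      have "(\<Sum>c\<in>C. pscale (a (\<Phi> c)) c) = (\<Sum>c\<in>C. pscale (a' (\<Phi> c)) c)"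
        unfolding \<theta>sum[symmetric] using arg_cong[where f = \<theta>, OF trans[OF a[symmetric] conjunct2[OF a']]] .
      then have "(\<Sum>c\<in>C. pscale (a (\<Phi> c) - a' (\<Phi> c)) c) = 0"
        by (simp add: W.scale_left_diff_distrib sum_subtractf)
      then have "a (\<Phi> c) - a' (\<Phi> c) = 0" if "c \<in> C" for c
        using W.independentD[OF C(2,1) order_refl _ that, of "\<lambda>c. a (\<Phi> c) - a' (\<Phi> c)"] by simp
      then have "a b = a' b" if "b \<in> B" for b using that unfolding B_def by auto
      moreover have "a b = a' b" if "b \<notin> B" for b using that a' unfolding a_def by (auto simp: PiE_def extensional_def)
      ultimately show "a' = a" by (intro ext) metis
    qed
  qed
  then show ?thesis unfolding is_K_basis_def using fB BD by (intro exI[of _ B] conjI ballI)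
qed

lemma K_dim_eq_dim: "fin_dim pscale (\<theta> ` D j) \<Longrightarrow> K_dim M (D j) = W.dim (\<theta> ` D j)"
proof -
  assume "fin_dim pscale (\<theta> ` D j)"
  then obtain B where B: "is_K_basis M (D j) B" using K_basis_exists by blast
  have "D j \<subseteq> carrier M" using D_carrier by blast
  then show ?thesis using K_dim_eq_card[OF B] K_basis_dim[OF B] D_0 by simp
qed

end

section \<open>Hilbert function and regular sequences\<close>

locale fg_graded = graded_mpoly_module N M D
  for N :: nat and M :: "('k::field mpoly, 'b) module" and D :: "int \<Rightarrow> 'b set" +
  assumes fg: "fin_gen_module (mpoly_ring N) M"
begin

lemma submodule_finsum:
  assumes "submodule H (mpoly_ring N) M" "finite F" "\<And>i. i \<in> F \<Longrightarrow> h i \<in> H"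
  shows "(\<Oplus>\<^bsub>M\<^esub>i\<in>F. h i) \<in> H"
proof -
  note H = submoduleE[OF assms(1)]
  have 0: "\<zero>\<^bsub>M\<^esub> \<in> H" using H(1,2,3,5) M.r_neg by (metis all_not_in_conv subsetD)
  show ?thesis using assms(2,3)
  proof (induction F rule: finite_induct)
    case empty
    then show ?case using 0 by simp
  next
    case (insert i F)
    have "(\<Oplus>\<^bsub>M\<^esub>i\<in>insert i F. h i) = h i \<oplus>\<^bsub>M\<^esub> (\<Oplus>\<^bsub>M\<^esub>i\<in>F. h i)"
      using insert H(1) by (intro M.finsum_insert) auto
    then show ?case using insert H(5) by simp
  qed
qed

text \<open>The homogeneous components of finitely many generators generate as well. Each is stored
  with its degree.\<close>

lemma homogeneous_generators:
  "\<exists>E :: (int \<times> 'b) set. finite E \<and> (\<forall>(i, b)\<in>E. b \<in> D i) \<and>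
     (\<forall>H. submodule H (mpoly_ring N) M \<and> snd ` E \<subseteq> H \<longrightarrow> H = carrier M)"
proof -
  obtain A where A: "finite A" "A \<subseteq> carrier M"
    "\<And>H. submodule H (mpoly_ring N) M \<Longrightarrow> A \<subseteq> H \<Longrightarrow> H = carrier M"
    using fg unfolding fin_gen_module_def by blast
  let ?E = "\<Union>a\<in>A. (\<lambda>j. (j, comp a j)) ` {j. comp a j \<noteq> \<zero>\<^bsub>M\<^esub>}"
  have "finite ?E" using A(1,2) comp_finite by auto
  moreover have "\<forall>(i, b)\<in>?E. b \<in> D i" using A(2) comp_D by auto
  moreover have "H = carrier M" if H: "submodule H (mpoly_ring N) M" "snd ` ?E \<subseteq> H" for H
  proof (rule A(3)[OF H(1)])
    show "A \<subseteq> H"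
    proof
      fix a assume a: "a \<in> A"
      have ac: "a \<in> carrier M" using A(2) a by blast
      have "a = (\<Oplus>\<^bsub>M\<^esub>j\<in>{j. comp a j \<noteq> \<zero>\<^bsub>M\<^esub>}. comp a j)"
        by (rule decD[OF dec_comp[OF ac] comp_finite[OF ac] order_refl])
      also have "\<dots> \<in> H"
      proof (rule submodule_finsum[OF H(1) comp_finite[OF ac]])
        fix j assume "j \<in> {j. comp a j \<noteq> \<zero>\<^bsub>M\<^esub>}"
        then have "(j, comp a j) \<in> ?E" using a by blast
        from subsetD[OF H(2) imageI[OF this]] show "comp a j \<in> H" by simp
      qed
      finally show "a \<in> H" .
    qed
  qed
  ultimately show ?thesis by (intro exI[of _ ?E]) simp
qed

definition E :: "(int \<times> 'b) set" where
  "E = (SOME E. finite E \<and> (\<forall>(i, b)\<in>E. b \<in> D i) \<and>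
     (\<forall>H. submodule H (mpoly_ring N) M \<and> snd ` E \<subseteq> H \<longrightarrow> H = carrier M))"

lemma E: "finite E" "(i, b) \<in> E \<Longrightarrow> b \<in> D i"
  "submodule H (mpoly_ring N) M \<Longrightarrow> snd ` E \<subseteq> H \<Longrightarrow> H = carrier M"
proof -
  note P = someI_ex[OF homogeneous_generators, folded E_def]
  show "finite E" using conjunct1[OF P] .
  show "(i, b) \<in> E \<Longrightarrow> b \<in> D i" using conjunct1[OF conjunct2[OF P]] by auto
  show "submodule H (mpoly_ring N) M \<Longrightarrow> snd ` E \<subseteq> H \<Longrightarrow> H = carrier M"
    using spec[OF conjunct2[OF conjunct2[OF P]], of H] by simp
qed

text \<open>The inserted 0 keeps \<open>Min\<close> defined when the zero module is given without
  generators.\<close>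

definition j0 :: int where "j0 = Min (insert 0 (fst ` E))"

lemma j0_le: "(i, b) \<in> E \<Longrightarrow> j0 \<le> i"
  unfolding j0_def using E(1) by (intro Min_le) force+

primrec T :: "nat \<Rightarrow> 'b set" where
  "T 0 = {b. (j0, b) \<in> E}"
| "T (Suc n) = {b. (j0 + int (Suc n), b) \<in> E} \<union> (\<Union>i\<in>{1..N}. (\<lambda>u. mpoly_var i \<odot>\<^bsub>M\<^esub> u) ` T n)"

lemma T_carrier: "u \<in> T n \<Longrightarrow> u \<in> carrier M"
  by (induction n arbitrary: u) (auto simp: mpoly_carrier_var dest: E(2) D_carrier)

lemma T_finite: "finite (T n)"
proof -
  have "finite {b. (i, b) \<in> E}" for i
    using finite_vimageI[OF E(1), of "Pair i"] by (simp add: vimage_def inj_on_def)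
  then show ?thesis by (induction n) auto
qed

text \<open>\<open>T n\<close> spans the component of degree \<open>j0 + n\<close>, where \<open>j0\<close> bounds the degrees of the generators
  from below.\<close>

definition Q :: "int \<Rightarrow> ('b \<Rightarrow>\<^sub>0 'k) set" where
  "Q j = (if j < j0 then {0} else W.span (\<theta> ` T (nat (j - j0))))"

lemma Q_subspace: "W.subspace (Q j)"
  by (simp add: Q_def)

lemma act_Q: assumes i: "i \<in> {1..N}" and v: "v \<in> Q (j - 1)" shows "act (mpoly_var i) v \<in> Q j"
proof (cases "j - 1 < j0")
  case True
  then have "v = 0" using v by (simp add: Q_def)
  then have "act (mpoly_var i) v = 0" using op.act_zero[OF op.x_in[OF i]] by simp
  then show ?thesis using W.subspace_0[OF Q_subspace] by simp
next
  case False
  define n where "n = nat (j - 1 - j0)"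
  have j: "nat (j - j0) = Suc n" "\<not> j < j0" using False by (auto simp: n_def)
  interpret f: Vector_Spaces.linear pscale pscale "act (mpoly_var i)"
    by unfold_locales (simp_all add: op.act_add op.act_scale op.x_in[OF i])
  have "v \<in> W.span (\<theta> ` T n)" using v False by (simp add: Q_def n_def)
  then have mem: "act (mpoly_var i) v \<in> W.span (act (mpoly_var i) ` \<theta> ` T n)"
    unfolding f.span_image by blast
  have sub: "act (mpoly_var i) ` \<theta> ` T n \<subseteq> \<theta> ` T (Suc n)"
  proof clarify
    fix u assume u: "u \<in> T n"
    then have "mpoly_var i \<odot>\<^bsub>M\<^esub> u \<in> T (Suc n)" using i by auto
    then show "act (mpoly_var i) (\<theta> u) \<in> \<theta> ` T (Suc n)"
      unfolding act_\<theta>[OF T_carrier[OF u]] by (rule imageI)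
  qed
  show ?thesis using subsetD[OF W.span_mono[OF sub] mem] j by (simp only: Q_def if_False)
qed

text \<open>The elements all of whose components lie in the spaces \<open>Q j\<close> form a
  submodule that contains the generators, so it is everything. Hence the components are
  finite-dimensional and vanish below \<open>j0\<close>.\<close>

lemma D_Q: assumes "u \<in> carrier M" shows "\<theta> (comp u j) \<in> Q j"
proof -
  let ?H = "{u \<in> carrier M. \<forall>j. \<theta> (comp u j) \<in> Q j}"
  have cc: "comp u j \<in> carrier M" if "u \<in> carrier M" for u j using comp_D[OF that] D_carrier by blast
  have H_add: "u \<oplus>\<^bsub>M\<^esub> v \<in> ?H" if "u \<in> ?H" "v \<in> ?H" for u v
    using that W.subspace_add[OF Q_subspace] by (auto simp: comp_add \<theta>_add cc)
  have H_const: "mpoly_const c \<odot>\<^bsub>M\<^esub> u \<in> ?H" if "u \<in> ?H" for u c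
    using that W.subspace_scale[OF Q_subspace]
    by (auto simp: comp_smult[OF mpoly_const_component] \<theta>_scale cc mpoly_carrier_const)
  have H_var: "mpoly_var i \<odot>\<^bsub>M\<^esub> u \<in> ?H" if "i \<in> {1..N}" "u \<in> ?H" for i u
    using that act_Q[OF that(1)]
    by (auto simp: comp_smult[OF mpoly_var_component[OF that(1)]] act_\<theta>[symmetric] cc mpoly_carrier_var)
  have comp0: "comp \<zero>\<^bsub>M\<^esub> j = \<zero>\<^bsub>M\<^esub>" for j using comp_of_D[OF D_0] .
  have H_zero: "\<zero>\<^bsub>M\<^esub> \<in> ?H" using W.subspace_0[OF Q_subspace] by (auto simp: comp0 \<theta>_0)
  have smult: "p \<odot>\<^bsub>M\<^esub> u \<in> ?H" if p: "p \<in> carrier (mpoly_ring N)" and u: "u \<in> ?H" for p u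
  proof -
    have "p \<in> carrier (mpoly_ring N) \<and> p \<odot>\<^bsub>M\<^esub> u \<in> ?H" using p
    proof (induction rule: mpoly_induct)
      case zero
      have "0 \<odot>\<^bsub>M\<^esub> u = \<zero>\<^bsub>M\<^esub>" using smult_l_null u by simp
      then show ?case using H_zero mpoly_carrier_0[of N] by (intro conjI) (simp_all only:)
    next
      case (const c)
      show ?case by (rule conjI[OF mpoly_carrier_const H_const[OF u]])
    next
      case (add p q)
      then have eq: "(p + q) \<odot>\<^bsub>M\<^esub> u = p \<odot>\<^bsub>M\<^esub> u \<oplus>\<^bsub>M\<^esub> q \<odot>\<^bsub>M\<^esub> u" using smult_l_distr u by simp
      show ?case unfolding eq
        by (rule conjI[OF mpoly_carrier_add[OF conjunct1[OF add(1)] conjunct1[OF add(2)]]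
              H_add[OF conjunct2[OF add(1)] conjunct2[OF add(2)]]])
    next
      case (var i p)
      then have eq: "(mpoly_var i * p) \<odot>\<^bsub>M\<^esub> u = mpoly_var i \<odot>\<^bsub>M\<^esub> (p \<odot>\<^bsub>M\<^esub> u)"
        using smult_assoc1[OF mpoly_carrier_var[OF var(1)] var(2), of u] u by simp
      show ?case unfolding eq
        by (rule conjI[OF mpoly_carrier_mult[OF mpoly_carrier_var[OF var(1)] var(2)]
              H_var[OF var(1) conjunct2[OF var(3)]]])
    qed
    then show ?thesis by (rule conjunct2)
  qed
  have sub: "submodule ?H (mpoly_ring N) M"
  proof (rule submoduleI)
    fix u assume u: "u \<in> ?H"
    have "\<ominus>\<^bsub>M\<^esub> u = (- 1) \<odot>\<^bsub>M\<^esub> u"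
    proof (rule M.minus_equality)
      have "(- 1) \<odot>\<^bsub>M\<^esub> u \<oplus>\<^bsub>M\<^esub> 1 \<odot>\<^bsub>M\<^esub> u = (- 1 + 1) \<odot>\<^bsub>M\<^esub> u"
        using u smult_l_distr[of "-1" 1 u] by (simp add: mpoly_carrier_uminus mpoly_carrier_1)
      then show "(- 1) \<odot>\<^bsub>M\<^esub> u \<oplus>\<^bsub>M\<^esub> u = \<zero>\<^bsub>M\<^esub>" using u smult_one smult_l_null by simp
    qed (use u in \<open>auto simp: mpoly_carrier_uminus mpoly_carrier_1\<close>)
    then show "\<ominus>\<^bsub>M\<^esub> u \<in> ?H" using smult[OF _ u, of "-1"] by (simp only: mpoly_carrier_uminus mpoly_carrier_1)
  qed (fact H_zero H_add smult | blast)+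
  have "snd ` E \<subseteq> ?H"
  proof clarify
    fix i b assume ib: "(i, b) \<in> E"
    have bD: "b \<in> D i" using E(2)[OF ib] .
    have cb: "dec b (\<lambda>j. if j = i then b else \<zero>\<^bsub>M\<^esub>)"
      using bD D_carrier[OF bD] by (intro decI[of "{i}"]) (auto simp: D_0)
    have "b \<in> T n" if "i = j0 + int n" for n
      using ib that by (cases n) simp_all
    then have "b \<in> T (nat (i - j0))" using j0_le[OF ib] by simp
    then have "\<theta> b \<in> Q i" using j0_le[OF ib] by (auto simp: Q_def intro: W.span_base)
    then show "snd (i, b) \<in> carrier M \<and> (\<forall>j. \<theta> (comp (snd (i, b)) j) \<in> Q j)"
      using D_carrier[OF bD] W.subspace_0[OF Q_subspace] by (simp add: dec_eq[OF cb] \<theta>_0)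
  qed
  from E(3)[OF sub this] assms show ?thesis by blast
qed

lemma \<theta>D_Q: "\<theta> ` D j \<subseteq> Q j"
  using D_Q D_carrier comp_of_D by (metis image_subsetI)

lemma D_fin_dim: "fin_dim pscale (\<theta> ` D j)"
proof -
  have "\<theta> ` D j \<subseteq> W.span (if j < j0 then {} else \<theta> ` T (nat (j - j0)))"
    using \<theta>D_Q[of j] by (auto simp: Q_def split: if_splits)
  moreover have "finite (if j < j0 then {} else \<theta> ` T (nat (j - j0)))" using T_finite by simp
  ultimately show ?thesis unfolding fin_dim_def by blast
qed

text \<open>\<open>Abs_fls\<close> gives back the coefficients only of a function that vanishes in
  sufficiently negative degrees; \<open>j0\<close> is a witness.\<close>

lemma hilbert_series_nth: "fls_nth (hilbert_series M D) j = int (W.dim (\<theta> ` D j))"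
proof -
  have "int (K_dim M (D j)) = int (W.dim (\<theta> ` D j))" for j using K_dim_eq_dim[OF D_fin_dim] by simp
  moreover have "W.dim (\<theta> ` D j) = 0" if "j < j0" for j
  proof -
    have "\<theta> ` D j = {0}" using \<theta>D_Q[of j] that W.subspace_0[OF \<theta>D_subspace, of j] by (auto simp: Q_def)
    then show ?thesis using W.dim_unique[of "{}" "{0}" 0] W.independent_empty by simp
  qed
  ultimately show ?thesis unfolding hilbert_series_def by (simp add: nth_Abs_fls_lower_bound[of j0])
qed

lemma seq_submodule_take:
  assumes fs: "set fs \<subseteq> carrier (mpoly_ring N)" and s: "s \<le> length fs"
  shows "seq_submodule (mpoly_ring N) M (take s fs) =
    {u. \<exists>a. (\<forall>t. a t \<in> carrier M) \<and> u = (\<Oplus>\<^bsub>M\<^esub>t\<in>{..<s}. fs ! t \<odot>\<^bsub>M\<^esub> a t)}" (is "_ = ?R")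
proof
  have fst: "fs ! t \<in> carrier (mpoly_ring N)" if "t < s" for t using that fs s nth_mem by fastforce
  have RI: "(\<Oplus>\<^bsub>M\<^esub>t\<in>{..<s}. fs ! t \<odot>\<^bsub>M\<^esub> a t) \<in> ?R" if "\<And>t. a t \<in> carrier M" for a using that by blast
  have sub: "submodule ?R (mpoly_ring N) M"
  proof (rule submoduleI)
    show "?R \<subseteq> carrier M" using fst by (auto intro!: M.finsum_closed)
    have "(\<Oplus>\<^bsub>M\<^esub>t\<in>{..<s}. fs ! t \<odot>\<^bsub>M\<^esub> \<zero>\<^bsub>M\<^esub>) = \<zero>\<^bsub>M\<^esub>"
      using fst by (intro M.add.finprod_one_eqI) auto
    then show "\<zero>\<^bsub>M\<^esub> \<in> ?R" using RI[of "\<lambda>_. \<zero>\<^bsub>M\<^esub>"] by simp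
  next
    fix u v assume "u \<in> ?R" "v \<in> ?R"
    then obtain a b where ab: "\<And>t. a t \<in> carrier M" "u = (\<Oplus>\<^bsub>M\<^esub>t\<in>{..<s}. fs ! t \<odot>\<^bsub>M\<^esub> a t)"
      "\<And>t. b t \<in> carrier M" "v = (\<Oplus>\<^bsub>M\<^esub>t\<in>{..<s}. fs ! t \<odot>\<^bsub>M\<^esub> b t)" by blast
    have "u \<oplus>\<^bsub>M\<^esub> v = (\<Oplus>\<^bsub>M\<^esub>t\<in>{..<s}. fs ! t \<odot>\<^bsub>M\<^esub> a t \<oplus>\<^bsub>M\<^esub> fs ! t \<odot>\<^bsub>M\<^esub> b t)"
      unfolding ab(2,4) using fst ab by (intro M.finsum_addf[symmetric]) auto
    also have "\<dots> = (\<Oplus>\<^bsub>M\<^esub>t\<in>{..<s}. fs ! t \<odot>\<^bsub>M\<^esub> (a t \<oplus>\<^bsub>M\<^esub> b t))"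
      using fst ab by (intro M.finsum_cong') (auto simp: smult_r_distr)
    finally show "u \<oplus>\<^bsub>M\<^esub> v \<in> ?R" using RI[of "\<lambda>t. a t \<oplus>\<^bsub>M\<^esub> b t"] ab by simp
  next
    fix p :: "'k mpoly" and u assume p: "p \<in> carrier (mpoly_ring N)" and "u \<in> ?R"
    then obtain a where a: "\<And>t. a t \<in> carrier M" "u = (\<Oplus>\<^bsub>M\<^esub>t\<in>{..<s}. fs ! t \<odot>\<^bsub>M\<^esub> a t)" by blast
    have "p \<odot>\<^bsub>M\<^esub> u = (\<Oplus>\<^bsub>M\<^esub>t\<in>{..<s}. p \<odot>\<^bsub>M\<^esub> (fs ! t \<odot>\<^bsub>M\<^esub> a t))"
      unfolding a(2) using p fst a(1) by (intro finsum_smult_ldistr) auto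
    also have "\<dots> = (\<Oplus>\<^bsub>M\<^esub>t\<in>{..<s}. fs ! t \<odot>\<^bsub>M\<^esub> (p \<odot>\<^bsub>M\<^esub> a t))"
      using p fst a(1) smult_assoc1[symmetric]
      by (intro M.finsum_cong') (auto simp: mult.commute)
    finally show "p \<odot>\<^bsub>M\<^esub> u \<in> ?R" using RI[of "\<lambda>t. p \<odot>\<^bsub>M\<^esub> a t"] a p by simp
  next
    fix u assume "u \<in> ?R"
    then obtain a where a: "\<And>t. a t \<in> carrier M" "u = (\<Oplus>\<^bsub>M\<^esub>t\<in>{..<s}. fs ! t \<odot>\<^bsub>M\<^esub> a t)" by blast
    have "\<ominus>\<^bsub>M\<^esub> u = (\<Oplus>\<^bsub>M\<^esub>t\<in>{..<s}. fs ! t \<odot>\<^bsub>M\<^esub> (\<ominus>\<^bsub>M\<^esub> a t))"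
    proof (rule M.minus_equality)
      have "(\<Oplus>\<^bsub>M\<^esub>t\<in>{..<s}. fs ! t \<odot>\<^bsub>M\<^esub> (\<ominus>\<^bsub>M\<^esub> a t)) \<oplus>\<^bsub>M\<^esub> u =
         (\<Oplus>\<^bsub>M\<^esub>t\<in>{..<s}. fs ! t \<odot>\<^bsub>M\<^esub> (\<ominus>\<^bsub>M\<^esub> a t) \<oplus>\<^bsub>M\<^esub> fs ! t \<odot>\<^bsub>M\<^esub> a t)"
        unfolding a(2) using fst a(1) by (intro M.finsum_addf[symmetric]) auto
      also have "\<dots> = \<zero>\<^bsub>M\<^esub>"
        using fst a(1) by (intro M.add.finprod_one_eqI) (auto simp: smult_r_distr[symmetric] M.l_neg)
      finally show "(\<Oplus>\<^bsub>M\<^esub>t\<in>{..<s}. fs ! t \<odot>\<^bsub>M\<^esub> (\<ominus>\<^bsub>M\<^esub> a t)) \<oplus>\<^bsub>M\<^esub> u = \<zero>\<^bsub>M\<^esub>" .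
    qed (use fst a in \<open>auto intro!: M.finsum_closed\<close>)
    then show "\<ominus>\<^bsub>M\<^esub> u \<in> ?R" using RI[of "\<lambda>t. \<ominus>\<^bsub>M\<^esub> a t"] a by simp
  qed
  have mem: "f \<odot>\<^bsub>M\<^esub> u \<in> ?R" if f: "f \<in> set (take s fs)" and u: "u \<in> carrier M" for f u
  proof -
    obtain t where t: "t < s" "f = fs ! t" using f s by (auto simp: in_set_conv_nth)
    have "(\<Oplus>\<^bsub>M\<^esub>t'\<in>{..<s}. fs ! t' \<odot>\<^bsub>M\<^esub> (if t' = t then u else \<zero>\<^bsub>M\<^esub>)) =
       (\<Oplus>\<^bsub>M\<^esub>t'\<in>{t}. fs ! t' \<odot>\<^bsub>M\<^esub> (if t' = t then u else \<zero>\<^bsub>M\<^esub>))"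
      using t fst u by (intro finsum_superset) auto
    also have "\<dots> = f \<odot>\<^bsub>M\<^esub> u" using t fst u by simp
    finally show ?thesis using RI[of "\<lambda>t'. if t' = t then u else \<zero>\<^bsub>M\<^esub>"] u by simp
  qed
  show "seq_submodule (mpoly_ring N) M (take s fs) \<subseteq> ?R"
    unfolding seq_submodule_def using sub mem by blast
  show "?R \<subseteq> seq_submodule (mpoly_ring N) M (take s fs)"
    unfolding seq_submodule_def
  proof (intro Inter_greatest subsetI)
    fix H u assume H: "H \<in> {H. submodule H (mpoly_ring N) M \<and> (\<forall>f\<in>set (take s fs). \<forall>u\<in>carrier M. f \<odot>\<^bsub>M\<^esub> u \<in> H)}"
      and "u \<in> ?R"
    then obtain a where a: "\<And>t. a t \<in> carrier M" "u = (\<Oplus>\<^bsub>M\<^esub>t\<in>{..<s}. fs ! t \<odot>\<^bsub>M\<^esub> a t)" by blast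
    have "fs ! t \<in> set (take s fs)" if "t < s" for t using that s by (auto simp: in_set_conv_nth)
    then show "u \<in> H" unfolding a(2) using H a(1) by (intro submodule_finsum) auto
  qed
qed

text \<open>The sum is the coefficient of \<open>t^j\<close> in \<open>(1 - t)^d\<close> times the
  Hilbert series, for a sequence of length \<open>d\<close> whose elements may be
  inhomogeneous.\<close>

theorem hilbert_series_difference_nonneg:
  assumes N: "1 \<le> N" and fs: "set fs \<subseteq> graded_maximal_ideal N" and reg: "regular_sequence (mpoly_ring N) M fs"
  shows "0 \<le> (\<Sum>i\<le>length fs. (-1) ^ i * int (length fs choose i) * fls_nth (hilbert_series M D) (j - int i))"
proof -
  have "\<forall>s. \<exists>q. s < length fs \<longrightarrow> (\<forall>i\<in>{1..N}. q i \<in> carrier (mpoly_ring N)) \<and>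
      fs ! s = (\<Sum>i\<in>{1..N}. q i * mpoly_var i)"
  proof
    fix s
    show "\<exists>q. s < length fs \<longrightarrow> (\<forall>i\<in>{1..N}. q i \<in> carrier (mpoly_ring N)) \<and>
      fs ! s = (\<Sum>i\<in>{1..N}. q i * mpoly_var i)"
    proof (cases "s < length fs")
      case True
      then have "fs ! s \<in> graded_maximal_ideal N" using fs nth_mem by blast
      from graded_maximal_ideal_sum[OF this] show ?thesis by blast
    qed simp
  qed
  then obtain q where q: "\<And>s. s < length fs \<Longrightarrow> (\<forall>i\<in>{1..N}. q s i \<in> carrier (mpoly_ring N)) \<and>
      fs ! s = (\<Sum>i\<in>{1..N}. q s i * mpoly_var i)" by metis
  have fsc: "set fs \<subseteq> carrier (mpoly_ring N)" using reg by (simp add: regular_sequence_def)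
  have fst: "fs ! t \<in> carrier (mpoly_ring N)" if "t < length fs" for t using that fsc nth_mem by blast
  have cc: "comp u j \<in> carrier M" if "u \<in> carrier M" for u j using comp_D[OF that] D_carrier by blast
  \<comment> \<open>All spaces are images under \<theta>; the action and the projections to the
    components pass through \<Phi>, the inverse of \<theta> on the carrier. The coefficients
    \<open>q\<close> come from the membership of the sequence in the maximal ideal.\<close>
  interpret go: graded_operators pscale "carrier (mpoly_ring N)" act "\<theta> ` carrier M" mpoly_var N
    "\<lambda>s. fs ! s" q "length fs" "\<lambda>j. \<theta> ` D j" "\<lambda>j v. \<theta> (comp (\<Phi> v) j)"
  proof
    fix s u assume s: "s < length fs" and u: "u \<in> \<theta> ` carrier M"
      and ex: "\<exists>a. (\<forall>t. a t \<in> \<theta> ` carrier M) \<and> act (fs ! s) u = (\<Sum>t<s. act (fs ! t) (a t))"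
    obtain u' where u': "u' \<in> carrier M" "u = \<theta> u'" using u by blast
    obtain a where a: "\<And>t. a t \<in> \<theta> ` carrier M" "act (fs ! s) u = (\<Sum>t<s. act (fs ! t) (a t))"
      using ex by blast
    have "\<forall>t. \<exists>a'. a' \<in> carrier M \<and> a t = \<theta> a'" using a(1) by blast
    then obtain a' where a': "\<And>t. a' t \<in> carrier M" "\<And>t. a t = \<theta> (a' t)" by metis
    have \<theta>sum: "\<theta> (\<Oplus>\<^bsub>M\<^esub>t\<in>{..<s}. fs ! t \<odot>\<^bsub>M\<^esub> b t) = (\<Sum>t<s. act (fs ! t) (\<theta> (b t)))"
      if "\<And>t. b t \<in> carrier M" for b
      using that s fst by (subst \<theta>_finsum) (auto simp: act_\<theta>)
    have "\<theta> (fs ! s \<odot>\<^bsub>M\<^esub> u') = \<theta> (\<Oplus>\<^bsub>M\<^esub>t\<in>{..<s}. fs ! t \<odot>\<^bsub>M\<^esub> a' t)"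
      unfolding \<theta>sum[OF a'(1)] using a(2) u' a'(2) by (simp add: act_\<theta>)
    moreover have "(\<Oplus>\<^bsub>M\<^esub>t\<in>{..<s}. fs ! t \<odot>\<^bsub>M\<^esub> a' t) \<in> carrier M"
      using a'(1) s fst by (intro M.finsum_closed) auto
    ultimately have "fs ! s \<odot>\<^bsub>M\<^esub> u' = (\<Oplus>\<^bsub>M\<^esub>t\<in>{..<s}. fs ! t \<odot>\<^bsub>M\<^esub> a' t)"
      using \<theta>_inj[of "fs ! s \<odot>\<^bsub>M\<^esub> u'"] fst[OF s] u'(1) by simp
    then have "fs ! s \<odot>\<^bsub>M\<^esub> u' \<in> seq_submodule (mpoly_ring N) M (take s fs)"
      unfolding seq_submodule_take[OF fsc less_imp_le[OF s]] using a'(1) by blast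
    then have "u' \<in> seq_submodule (mpoly_ring N) M (take s fs)"
      using reg s u'(1) by (simp add: regular_sequence_def)
    then obtain b where b: "\<And>t. b t \<in> carrier M" "u' = (\<Oplus>\<^bsub>M\<^esub>t\<in>{..<s}. fs ! t \<odot>\<^bsub>M\<^esub> b t)"
      unfolding seq_submodule_take[OF fsc less_imp_le[OF s]] by blast
    have "u = (\<Sum>t<s. act (fs ! t) (\<theta> (b t)))" unfolding u'(2) b(2) by (rule \<theta>sum[OF b(1)])
    then show "\<exists>a. (\<forall>t. a t \<in> \<theta> ` carrier M) \<and> u = (\<Sum>t<s. act (fs ! t) (a t))"
      using b(1) by (intro exI[of _ "\<lambda>t. \<theta> (b t)"]) simp
  next
    show "\<theta> ` D j \<subseteq> \<theta> ` carrier M" for j using D_carrier by blast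
  next
    fix a b j assume "a \<in> \<theta> ` carrier M" "b \<in> \<theta> ` carrier M"
    then show "\<theta> (comp (\<Phi> (a + b)) j) = \<theta> (comp (\<Phi> a) j) + \<theta> (comp (\<Phi> b) j)"
      by (simp add: \<Phi>_add comp_add \<Phi>_closed \<theta>_add cc)
  next
    fix a j assume "a \<in> \<theta> ` D j"
    then show "\<theta> (comp (\<Phi> a) j) = a" using D_carrier by (auto simp: \<Phi>_\<theta> comp_of_D)
  next
    fix i a j assume "i \<in> {1..N}"
    then show "\<theta> (comp (\<Phi> (act (mpoly_var i) a)) j) = act (mpoly_var i) (\<theta> (comp (\<Phi> a) (j - 1)))"
      by (simp add: act_def \<Phi>_\<theta> \<Phi>_closed cc mpoly_carrier_var comp_smult[OF mpoly_var_component])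
  qed (use q \<theta>D_subspace D_fin_dim comp_D \<Phi>_closed in auto)
  show ?thesis using go.alternating_sum_nonneg[OF N] unfolding hilbert_series_nth .
qed

end

section \<open>Counting monomials\<close>

definition mrestrict :: "((nat \<Rightarrow>\<^sub>0 nat) \<Rightarrow> bool) \<Rightarrow> 'k::field mpoly \<Rightarrow> 'k mpoly" where
  "mrestrict P p = (\<Sum>m\<in>{m \<in> keys p. P m}. single m (lookup p m))"

lemma lookup_mrestrict [simp]:
  "lookup (mrestrict P p) m = (if P m then lookup p m else 0)"
  unfolding mrestrict_def lookup_sum lookup_single when_def
  by (auto simp: sum.delta in_keys_iff)

lemma mrestrict_add: "mrestrict P (p + q) = mrestrict P p + mrestrict P q"
  by (rule poly_mapping_eqI) (simp add: lookup_add)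

lemma mrestrict_0 [simp]: "mrestrict P 0 = 0"
  by (rule poly_mapping_eqI) simp

lemma keys_mrestrict: "keys (mrestrict P p) = {m \<in> keys p. P m}"
  by (auto simp: in_keys_iff split: if_splits)

lemma mrestrict_id: "(\<And>m. m \<in> keys p \<Longrightarrow> P m) \<Longrightarrow> mrestrict P p = p"
  by (rule poly_mapping_eqI) (auto simp: in_keys_iff)

lemma mrestrict_zero: "(\<And>m. m \<in> keys p \<Longrightarrow> \<not> P m) \<Longrightarrow> mrestrict P p = 0"
  by (rule poly_mapping_eqI) (auto simp: in_keys_iff)

lemma keys_add_nat: "keys (a + b :: nat \<Rightarrow>\<^sub>0 nat) = keys a \<union> keys b"
  by (auto simp: in_keys_iff lookup_add)

definition mons :: "nat \<Rightarrow> nat \<Rightarrow> (nat \<Rightarrow>\<^sub>0 nat) set" where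
  "mons w k = {m. keys m \<subseteq> {1..w} \<and> mono_degree m = k}"

lemma mono_degree_eq_0: "mono_degree m = 0 \<longleftrightarrow> m = 0"
proof
  assume "mono_degree m = 0"
  then show "m = 0" by (auto simp: mono_degree_def in_keys_iff intro!: poly_mapping_eqI)
qed simp

lemma mons_0_right: "mons w 0 = {0}"
  by (auto simp: mons_def mono_degree_eq_0)

lemma mons_0_left: "mons 0 (Suc k) = {}"
  by (auto simp: mons_def)

lemma mons_Suc:
  "mons (Suc w) (Suc k) = mons w (Suc k) \<union> (\<lambda>m. single (Suc w) 1 + m) ` mons (Suc w) k"
proof (rule Set.set_eqI, rule iffI)
  fix m assume m: "m \<in> mons (Suc w) (Suc k)"
  show "m \<in> mons w (Suc k) \<union> (\<lambda>m. single (Suc w) 1 + m) ` mons (Suc w) k"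
  proof (cases "Suc w \<in> keys m")
    case True
    then obtain m' where m': "m = single (Suc w) 1 + m'" "keys m' \<subseteq> keys m"
      by (rule monomial_cases)
    have "m' \<in> mons (Suc w) k"
      using m m'(2) unfolding mons_def m'(1) by (auto simp: mono_degree_add mono_degree_single)
    then show ?thesis using m'(1) by blast
  next
    case False
    have "i \<le> w" if "i \<in> keys m" for i
    proof -
      have "i \<le> Suc w" using m that by (auto simp: mons_def)
      moreover have "i \<noteq> Suc w" using that False by auto
      ultimately show ?thesis by simp
    qed
    then have "m \<in> mons w (Suc k)" using m by (fastforce simp: mons_def)
    then show ?thesis by blast
  qed
next
  fix m assume "m \<in> mons w (Suc k) \<union> (\<lambda>m. single (Suc w) 1 + m) ` mons (Suc w) k"
  then show "m \<in> mons (Suc w) (Suc k)"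
    by (fastforce simp: mons_def keys_add_nat mono_degree_add mono_degree_single)
qed

lemma finite_mons: "finite (mons w k)"
proof (induction w arbitrary: k)
  case 0
  then show ?case by (cases k) (auto simp: mons_0_left mons_0_right)
next
  case (Suc w)
  note IH = Suc
  show ?case by (induction k) (auto simp: mons_Suc mons_0_right IH)
qed

definition cn :: "nat \<Rightarrow> nat \<Rightarrow> nat" where "cn w k = card (mons w k)"

lemma cn_0_right: "cn w 0 = 1" and cn_0_left: "cn 0 (Suc k) = 0"
  by (simp_all add: cn_def mons_0_left mons_0_right)

lemma cn_Suc: "cn (Suc w) (Suc k) = cn w (Suc k) + cn (Suc w) k"
proof -
  have "mons w (Suc k) \<inter> (\<lambda>m. single (Suc w) 1 + m) ` mons (Suc w) k = {}"
    by (auto simp: mons_def keys_add_nat)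
  then have "card (mons (Suc w) (Suc k)) = card (mons w (Suc k)) +
      card ((\<lambda>m. single (Suc w) 1 + m) ` mons (Suc w) k)"
    unfolding mons_Suc by (intro card_Un_disjoint) (auto simp: finite_mons)
  also have "card ((\<lambda>m. single (Suc w) 1 + m) ` mons (Suc w) k) = card (mons (Suc w) k)"
    by (rule card_image) (auto simp: inj_on_def)
  finally show ?thesis by (simp add: cn_def)
qed

text \<open>The Hilbert series \<open>1 / (1 - t)\<^sup>w\<close> of the polynomial ring in \<open>w\<close> variables.\<close>

definition HS :: "nat \<Rightarrow> int fps" where "HS w = Abs_fps (\<lambda>k. int (cn w k))"

lemma HS_nth: "fps_nth (HS w) k = int (cn w k)" by (simp add: HS_def)

lemma HS_0: "HS 0 = 1"
proof (rule fps_ext)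
  fix k show "fps_nth (HS 0) k = fps_nth 1 k" by (cases k) (simp_all add: HS_nth cn_0_right cn_0_left)
qed

text \<open>With integer coefficients, \<open>1 / (1 - t)^w\<close> is handled by cancelling factors
  \<open>1 - t\<close> instead of dividing; this relation is the source of the later
  identities.\<close>

lemma HS_Suc: "HS (Suc w) * (1 - fps_X) = HS w"
proof (rule fps_ext)
  fix k show "fps_nth (HS (Suc w) * (1 - fps_X)) k = fps_nth (HS w) k"
    by (cases k) (simp_all add: HS_nth cn_0_right cn_Suc right_diff_distrib fps_mult_fps_X_commute)
qed

lemma HS_add: "HS (w + e) * (1 - fps_X) ^ e = HS w"
proof (induction e)
  case (Suc e)
  have "HS (w + Suc e) * (1 - fps_X) ^ Suc e = HS (Suc (w + e)) * (1 - fps_X) * (1 - fps_X) ^ e"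
    by (simp add: mult.assoc)
  then show ?case unfolding HS_Suc Suc .
qed simp

lemma HS_inverse: "HS w * (1 - fps_X) ^ w = 1"
  using HS_add[of 0 w] by (simp add: HS_0)

lemma HS_mult: "HS v * HS w = HS (v + w)"
proof -
  have "HS v * HS w = HS v * (HS (v + w) * (1 - fps_X) ^ v)"
    using HS_add[of w v] by (simp add: add.commute)
  also have "\<dots> = (HS v * (1 - fps_X) ^ v) * HS (v + w)" by (simp add: mult_ac)
  finally show ?thesis by (simp add: HS_inverse)
qed

lemma cn_binomial: "cn (Suc w) k = (w + k) choose k"
proof (induction "w + k" arbitrary: w k rule: less_induct)
  case less
  show ?case
  proof (cases k)
    case 0
    then show ?thesis by (simp add: cn_0_right)
  next
    case (Suc j)
    show ?thesis
    proof (cases w)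
      case 0
      then show ?thesis using less[of 0 j] Suc by (simp add: cn_Suc cn_0_left)
    next
      case (Suc v)
      then show ?thesis using less[of v k] less[of w j] \<open>k = Suc j\<close> by (simp add: cn_Suc)
    qed
  qed
qed

lemma one_minus_X_power_nth:
  "fps_nth ((1 - fps_X :: int fps) ^ d) k = (-1) ^ k * int (d choose k)"
proof -
  have "(1 - fps_X :: int fps) ^ d = (\<Sum>i\<le>d. of_nat (d choose i) * (- fps_X) ^ i * 1 ^ (d - i))"
    unfolding binomial_ring[symmetric] by simp
  also have "\<dots> = (\<Sum>i\<le>d. fps_const ((-1) ^ i * int (d choose i)) * fps_X ^ i)"
    by (intro sum.cong refl) (simp add: power_minus[of fps_X] fps_of_nat[symmetric] mult_ac fps_const_mult[symmetric]
        fps_const_power[symmetric] del: fps_const_mult fps_const_power)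
  also have "fps_nth \<dots> k = (\<Sum>i\<le>d. if k = i then (-1) ^ i * int (d choose i) else 0)"
    unfolding fps_sum_nth by (intro sum.cong refl) simp
  also have "\<dots> = (-1) ^ k * int (d choose k)" by (simp add: sum.delta)
  finally show ?thesis .
qed

section \<open>Direct sums of shifted polynomial rings in fewer variables\<close>

lemma lookup_var_mult:
  "lookup (mpoly_var i * p) (single i 1 + m) = lookup p m"
proof -
  have "mpoly_var i * p = (\<Sum>m\<in>keys p. single (single i 1 + m) (lookup p m))"
    by (subst mpoly_sum_monomials[of p]) (simp only: sum_distrib_left mpoly_var_mult_single)
  then show ?thesis
    by (auto simp: lookup_sum lookup_single when_def in_keys_iff sum.delta)
qed

lemma var_divides:
  assumes "\<And>m. m \<in> keys p \<Longrightarrow> i \<in> keys m" "p \<in> carrier (mpoly_ring w)"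
  obtains q where "p = mpoly_var i * q" "q \<in> carrier (mpoly_ring w)"
proof
  define q where "q = (\<Sum>m\<in>keys p. single (m - single i 1) (lookup p m))"
  have eq: "single i 1 + (m - single i 1) = m" if "m \<in> keys p" for m
    using assms(1)[OF that]
    by (auto intro!: poly_mapping_eqI simp: lookup_add lookup_minus lookup_single when_def in_keys_iff)
  show "p = mpoly_var i * q"
    unfolding q_def sum_distrib_left mpoly_var_mult_single
    by (subst mpoly_sum_monomials) (rule sum.cong, simp_all only: eq)
  have "keys (m - single i 1) \<subseteq> keys m" for m :: "nat \<Rightarrow>\<^sub>0 nat"
    by (auto simp: in_keys_iff lookup_minus)
  then show "q \<in> carrier (mpoly_ring w)"
    unfolding q_def using assms(2) by (intro mpoly_carrier_sum) (fastforce simp: mpoly_ring_carrier)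
qed

locale stanley =
  fixes N L :: nat and a w :: "nat \<Rightarrow> nat"
  assumes w_le: "l < L \<Longrightarrow> w l \<le> N"
begin

definition inside :: "nat \<Rightarrow> (nat \<Rightarrow>\<^sub>0 nat) \<Rightarrow> bool" where
  "inside l m \<longleftrightarrow> keys m \<subseteq> {1..w l}"

definition valid :: "(nat \<Rightarrow> 'k::field mpoly) set" where
  "valid = {g. \<forall>l. (l < L \<longrightarrow> g l \<in> carrier (mpoly_ring (w l))) \<and> (L \<le> l \<longrightarrow> g l = 0)}"

definition times :: "'k::field mpoly \<Rightarrow> (nat \<Rightarrow> 'k mpoly) \<Rightarrow> nat \<Rightarrow> 'k mpoly" where
  "times p g = (\<lambda>l. mrestrict (inside l) (p * g l))"

text \<open>The summand with index \<open>l\<close> is \<open>K[x\<^sub>1,\<dots>,x\<^bsub>w l\<^esub>](-a l)\<close>, on which the other variables act as zero.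
  Its elements are wrapped into singletons, so that the carrier has the type that \<open>hdepth\<close>
  asks for.\<close>

definition U :: "('k::field mpoly, (nat \<Rightarrow> 'k mpoly) set) module" where
  "U = \<lparr>carrier = (\<lambda>g. {g}) ` valid, mult = (\<lambda>A B. A), one = {\<lambda>_. 0}, zero = {\<lambda>_. 0},
     add = (\<lambda>A B. {\<lambda>l. the_elem A l + the_elem B l}), smult = (\<lambda>p A. {times p (the_elem A)})\<rparr>"

lemma U_simps [simp]:
  "zero U = {\<lambda>_. 0}" "add U {g} {h} = {\<lambda>l. g l + h l}" "smult U p {g} = {times p g}"
  "{g} \<in> carrier U \<longleftrightarrow> g \<in> valid"
  by (auto simp: U_def)

lemma U_carrierE: "u \<in> carrier U \<Longrightarrow> (\<And>g. u = {g} \<Longrightarrow> g \<in> valid \<Longrightarrow> thesis) \<Longrightarrow> thesis"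
  by (auto simp: U_def)

lemma validI: "(\<And>l. l < L \<Longrightarrow> g l \<in> carrier (mpoly_ring (w l))) \<Longrightarrow> (\<And>l. L \<le> l \<Longrightarrow> g l = 0) \<Longrightarrow> g \<in> valid"
  by (simp add: valid_def)

lemma validD: "g \<in> valid \<Longrightarrow> l < L \<Longrightarrow> g l \<in> carrier (mpoly_ring (w l))" "g \<in> valid \<Longrightarrow> L \<le> l \<Longrightarrow> g l = 0"
  by (simp_all add: valid_def)

lemma mrestrict_inside_carrier: "mrestrict (inside l) p \<in> carrier (mpoly_ring (w l))"
  by (simp add: mpoly_ring_carrier keys_mrestrict inside_def)

lemma mrestrict_inside_id: "p \<in> carrier (mpoly_ring (w l)) \<Longrightarrow> mrestrict (inside l) p = p"
  by (intro mrestrict_id) (simp add: mpoly_ring_carrier inside_def)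

text \<open>The monomials with a variable beyond \<open>w l\<close> span an ideal, and restriction
  picks the representative modulo this ideal. That makes the action on a summand
  associative.\<close>

lemma mrestrict_inside_mult: "mrestrict (inside l) (p * mrestrict (inside l) q) = mrestrict (inside l) (p * q)"
proof -
  define r where "r = q - mrestrict (inside l) q"
  have r: "\<not> inside l m" if "m \<in> keys r" for m
    using that unfolding r_def by (auto simp: in_keys_iff lookup_minus split: if_splits)
  have "mrestrict (inside l) (p * r) = 0"
  proof (rule mrestrict_zero)
    fix m assume "m \<in> keys (p * r)"
    then obtain b c where "m = b + c" "c \<in> keys r"
      using Poly_Mapping.keys_mult[of p r] by blast
    then show "\<not> inside l m" using r[of c] by (auto simp: keys_add_nat inside_def)
  qed
  moreover have "p * q = p * mrestrict (inside l) q + p * r" by (simp add: r_def algebra_simps)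
  ultimately show ?thesis by (simp add: mrestrict_add)
qed

lemma valid_0: "(\<lambda>_. 0) \<in> valid"
  by (auto intro: validI mpoly_carrier_0)

lemma valid_add: "g \<in> valid \<Longrightarrow> h \<in> valid \<Longrightarrow> (\<lambda>l. g l + h l) \<in> valid"
  by (rule validI) (simp_all add: validD mpoly_carrier_add)

lemma valid_uminus: "g \<in> valid \<Longrightarrow> (\<lambda>l. - g l) \<in> valid"
  by (rule validI) (simp_all add: validD mpoly_carrier_uminus)

lemma valid_times: "g \<in> valid \<Longrightarrow> times p g \<in> valid"
  by (rule validI) (simp_all add: times_def mrestrict_inside_carrier validD)

lemma abelian_group_U: "abelian_group (U :: ('k::field mpoly, (nat \<Rightarrow> 'k mpoly) set) module)"
proof (rule abelian_groupI)
  fix u :: "(nat \<Rightarrow> 'k mpoly) set" assume "u \<in> carrier U"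
  then obtain g where g: "u = {g}" "g \<in> valid" by (rule U_carrierE)
  have "{\<lambda>l. - g l} \<in> carrier U" using valid_uminus[OF g(2)] by simp
  moreover have "{\<lambda>l. - g l} \<oplus>\<^bsub>U\<^esub> u = \<zero>\<^bsub>U\<^esub>" unfolding g(1) by simp
  ultimately show "\<exists>v\<in>carrier U. v \<oplus>\<^bsub>U\<^esub> u = \<zero>\<^bsub>U\<^esub>" by blast
qed (auto elim!: U_carrierE simp: valid_0 valid_add add_ac)

lemma module_U: "module (mpoly_ring N) (U :: ('k::field mpoly, (nat \<Rightarrow> 'k mpoly) set) module)"
proof (rule moduleI[OF cring_mpoly_ring abelian_group_U])
  fix p q :: "'k mpoly" and u :: "(nat \<Rightarrow> 'k mpoly) set"
  assume "u \<in> carrier U"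
  then obtain g where g: "u = {g}" "g \<in> valid" by (rule U_carrierE)
  show "p \<odot>\<^bsub>U\<^esub> u \<in> carrier U" using g by (simp add: valid_times)
  show "(p \<oplus>\<^bsub>mpoly_ring N\<^esub> q) \<odot>\<^bsub>U\<^esub> u = p \<odot>\<^bsub>U\<^esub> u \<oplus>\<^bsub>U\<^esub> q \<odot>\<^bsub>U\<^esub> u"
    unfolding g(1) by (simp add: times_def distrib_right mrestrict_add)
  show "(p \<otimes>\<^bsub>mpoly_ring N\<^esub> q) \<odot>\<^bsub>U\<^esub> u = p \<odot>\<^bsub>U\<^esub> (q \<odot>\<^bsub>U\<^esub> u)"
    unfolding g(1) by (simp add: times_def mrestrict_inside_mult mult.assoc)
  have "mrestrict (inside l) (g l) = g l" for l
    using validD[OF g(2), of l] by (cases "l < L") (auto simp: mrestrict_inside_id)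
  then show "\<one>\<^bsub>mpoly_ring N\<^esub> \<odot>\<^bsub>U\<^esub> u = u" unfolding g(1) by (simp add: times_def)
next
  fix p :: "'k mpoly" and u v :: "(nat \<Rightarrow> 'k mpoly) set"
  assume "u \<in> carrier U" "v \<in> carrier U"
  then show "p \<odot>\<^bsub>U\<^esub> (u \<oplus>\<^bsub>U\<^esub> v) = p \<odot>\<^bsub>U\<^esub> u \<oplus>\<^bsub>U\<^esub> p \<odot>\<^bsub>U\<^esub> v"
    by (auto elim!: U_carrierE simp: times_def distrib_left mrestrict_add)
qed

lemma finsum_U:
  fixes h :: "'i \<Rightarrow> nat \<Rightarrow> 'k::field mpoly"
  assumes "finite A" "\<And>i. i \<in> A \<Longrightarrow> h i \<in> valid"
  shows "(\<Oplus>\<^bsub>U\<^esub>i\<in>A. {h i}) = {\<lambda>l. \<Sum>i\<in>A. h i l}"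
proof -
  interpret U: abelian_group "U :: ('k mpoly, (nat \<Rightarrow> 'k mpoly) set) module" by (rule abelian_group_U)
  show ?thesis using assms
    by (induction A rule: finite_induct) (simp_all add: U.finsum_insert Pi_def)
qed

definition unit_vec :: "nat \<Rightarrow> 'k::field mpoly \<Rightarrow> nat \<Rightarrow> 'k mpoly" where
  "unit_vec l p = (\<lambda>l'. if l' = l then p else 0)"

lemma valid_unit_vec: "l < L \<Longrightarrow> p \<in> carrier (mpoly_ring (w l)) \<Longrightarrow> unit_vec l p \<in> valid"
  by (rule validI) (auto simp: unit_vec_def mpoly_carrier_0)

lemma times_unit_vec: "times p (unit_vec l q) = unit_vec l (mrestrict (inside l) (p * q))"
  by (auto simp: times_def unit_vec_def)

lemma carrier_mono: "v \<le> v' \<Longrightarrow> p \<in> carrier (mpoly_ring v) \<Longrightarrow> p \<in> carrier (mpoly_ring v')"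
  by (fastforce simp: mpoly_ring_carrier)

lemma fin_gen_U: "fin_gen_module (mpoly_ring N) (U :: ('k::field mpoly, (nat \<Rightarrow> 'k mpoly) set) module)"
proof -
  interpret U: module "mpoly_ring N" "U :: ('k mpoly, (nat \<Rightarrow> 'k mpoly) set) module" by (rule module_U)
  define A :: "(nat \<Rightarrow> 'k mpoly) set set" where "A = (\<lambda>l. {unit_vec l 1}) ` {..<L}"
  have "A \<subseteq> carrier U" unfolding A_def by (auto simp: mpoly_carrier_1 intro!: valid_unit_vec)
  moreover have "H = carrier U" if H: "submodule H (mpoly_ring N) U" "A \<subseteq> H" for H
  proof
    note HE = U.submoduleE[OF H(1)]
    show "H \<subseteq> carrier U" using HE(1) .
    show "carrier U \<subseteq> H"
    proof
      fix u :: "(nat \<Rightarrow> 'k mpoly) set" assume "u \<in> carrier U"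
      then obtain g where g: "u = {g}" "g \<in> valid" by (rule U_carrierE)
      have "n \<le> L \<Longrightarrow> {\<lambda>l. if l < n then g l else 0} \<in> H" for n
      proof (induction n)
        case 0
        obtain x where "x \<in> H" using HE(2) by blast
        from U_carrierE[OF subsetD[OF HE(1) this]] obtain h where "x = {h}" by blast
        with \<open>x \<in> H\<close> have h: "{h} \<in> H" by simp
        have "0 \<odot>\<^bsub>U\<^esub> {h} \<in> H" using HE(4)[OF mpoly_carrier_0 h] .
        then show ?case by (simp add: times_def)
      next
        case (Suc n)
        have gn: "g n \<in> carrier (mpoly_ring (w n))" using validD(1)[OF g(2)] Suc.prems by simp
        then have gN: "g n \<in> carrier (mpoly_ring N)" using carrier_mono w_le Suc.prems by (metis Suc_le_lessD)
        have "{unit_vec n 1} \<in> H" using H(2) Suc.prems by (auto simp: A_def)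
        from HE(4)[OF gN this] have "{unit_vec n (g n)} \<in> H"
          by (simp add: times_unit_vec mrestrict_inside_id[OF gn])
        with Suc have "{\<lambda>l. if l < n then g l else 0} \<oplus>\<^bsub>U\<^esub> {unit_vec n (g n)} \<in> H" by (intro HE(5)) auto
        moreover have "(\<lambda>l. (if l < n then g l else 0) + unit_vec n (g n) l) = (\<lambda>l. if l < Suc n then g l else 0)"
          by (auto simp: unit_vec_def fun_eq_iff less_Suc_eq)
        ultimately show ?case by simp
      qed
      from this[of L] have "{\<lambda>l. if l < L then g l else 0} \<in> H" by simp
      moreover have "(\<lambda>l. if l < L then g l else 0) = g" using validD(2)[OF g(2)] by (auto simp: fun_eq_iff)
      ultimately show "u \<in> H" unfolding g(1) by simp
    qed
  qed
  moreover have "finite A" by (simp add: A_def)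
  ultimately show ?thesis unfolding fin_gen_module_def using module_U by (intro conjI exI[of _ A]) simp_all
qed

definition hom :: "int \<Rightarrow> (nat \<Rightarrow> 'k::field mpoly) \<Rightarrow> bool" where
  "hom j g \<longleftrightarrow> (\<forall>l. \<forall>m\<in>keys (g l). int (mono_degree m + a l) = j)"

definition E :: "int \<Rightarrow> (nat \<Rightarrow> 'k::field mpoly) set set" where
  "E j = (\<lambda>g. {g}) ` {g \<in> valid. hom j g}"

lemma E_iff: "{g} \<in> E j \<longleftrightarrow> g \<in> valid \<and> hom j g"
  by (auto simp: E_def)

lemma E_elim: "u \<in> E j \<Longrightarrow> (\<And>g. u = {g} \<Longrightarrow> g \<in> valid \<Longrightarrow> hom j g \<Longrightarrow> thesis) \<Longrightarrow> thesis"
  by (auto simp: E_def)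

lemma hom_add: "hom j g \<Longrightarrow> hom j h \<Longrightarrow> hom j (\<lambda>l. g l + h l)"
  unfolding hom_def using subsetD[OF Poly_Mapping.keys_add] by (metis UnE)

definition part :: "int \<Rightarrow> (nat \<Rightarrow> 'k::field mpoly) \<Rightarrow> nat \<Rightarrow> 'k mpoly" where
  "part j g = (\<lambda>l. mrestrict (\<lambda>m. int (mono_degree m + a l) = j) (g l))"

lemma part_E: "g \<in> valid \<Longrightarrow> {part j g} \<in> E j"
  unfolding E_iff by (auto simp: part_def hom_def keys_mrestrict valid_def mpoly_ring_carrier)

lemma subgroup_E: "additive_subgroup (E j) (U :: ('k::field mpoly, (nat \<Rightarrow> 'k mpoly) set) module)"
proof -
  interpret U: abelian_group "U :: ('k mpoly, (nat \<Rightarrow> 'k mpoly) set) module" by (rule abelian_group_U)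
  show ?thesis
  proof (rule additive_subgroupI, rule U.add.subgroupI)
    show "E j \<subseteq> carrier U" by (auto simp: E_def)
    have "{\<lambda>_. 0} \<in> E j" by (simp add: E_iff valid_0 hom_def)
    then show "E j \<noteq> {}" by blast
  next
    fix u :: "(nat \<Rightarrow> 'k mpoly) set" assume "u \<in> E j"
    then obtain g where g: "u = {g}" "g \<in> valid" "hom j g" by (rule E_elim)
    have "\<ominus>\<^bsub>U\<^esub> u = {\<lambda>l. - g l}"
      using g valid_uminus[OF g(2)] by (intro U.minus_equality) simp_all
    moreover have "hom j (\<lambda>l. - g l)" using g(3) by (simp add: hom_def in_keys_iff)
    ultimately show "\<ominus>\<^bsub>U\<^esub> u \<in> E j" using valid_uminus[OF g(2)] by (simp add: E_iff)
  next
    fix u v :: "(nat \<Rightarrow> 'k mpoly) set" assume "u \<in> E j" "v \<in> E j"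
    then show "u \<oplus>\<^bsub>U\<^esub> v \<in> E j" by (auto elim!: E_elim simp: E_iff valid_add hom_add)
  qed
qed

lemma grading_U: "is_grading N (U :: ('k::field mpoly, (nat \<Rightarrow> 'k mpoly) set) module) E"
  unfolding is_grading_def
proof (intro conjI allI ballI)
  show "additive_subgroup (E j) (U :: ('k mpoly, (nat \<Rightarrow> 'k mpoly) set) module)" for j by (rule subgroup_E)
next
  fix i j and p :: "'k mpoly" and u :: "(nat \<Rightarrow> 'k mpoly) set" assume p: "p \<in> mpoly_component N i" and "u \<in> E j"
  then obtain g where g: "u = {g}" "g \<in> valid" "hom j g" by (elim E_elim)
  have "hom (i + j) (times p g)"
    unfolding hom_def
  proof (intro allI ballI)
    fix l m assume "m \<in> keys (times p g l)"
    then obtain b c where bc: "m = b + c" "b \<in> keys p" "c \<in> keys (g l)"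
      using Poly_Mapping.keys_mult[of p "g l"] by (auto simp: times_def keys_mrestrict)
    have "int (mono_degree b) = i" "int (mono_degree c + a l) = j"
      using bc p g(3) by (auto simp: mpoly_component_def hom_def)
    then show "int (mono_degree m + a l) = i + j" unfolding bc(1) by (simp add: mono_degree_add)
  qed
  then show "p \<odot>\<^bsub>U\<^esub> u \<in> E (i + j)" using g by (simp add: E_iff valid_times)
next
  fix u :: "(nat \<Rightarrow> 'k mpoly) set" assume "u \<in> carrier U"
  then obtain g where g: "u = {g}" "g \<in> valid" by (rule U_carrierE)
  define F where "F = {j. {part j g} \<noteq> \<zero>\<^bsub>U\<^esub>}"
  have "F \<subseteq> (\<Union>l\<in>{..<L}. (\<lambda>m. int (mono_degree m + a l)) ` keys (g l))"
  proof
    fix j assume "j \<in> F"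
    then obtain l where l: "part j g l \<noteq> 0" unfolding F_def by (auto simp: fun_eq_iff)
    then have "l < L" using validD(2)[OF g(2), of l] by (cases "l < L") (auto simp: part_def)
    moreover obtain m where "m \<in> keys (part j g l)" using l by (metis keys_eq_empty ex_in_conv poly_mapping_eqI lookup_zero not_in_keys_iff_lookup_eq_zero)
    ultimately show "j \<in> (\<Union>l\<in>{..<L}. (\<lambda>m. int (mono_degree m + a l)) ` keys (g l))"
      by (auto simp: part_def keys_mrestrict)
  qed
  then have finF: "finite F" by (rule finite_subset) auto
  have pv: "part j g \<in> valid" for j using part_E[OF g(2)] by (simp add: E_iff)
  have "(\<lambda>l. \<Sum>j\<in>F. part j g l) = g"
  proof (rule ext, rule poly_mapping_eqI)
    fix l m
    have "lookup (\<Sum>j\<in>F. part j g l) m = (\<Sum>j\<in>F. if int (mono_degree m + a l) = j then lookup (g l) m else 0)"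
      by (simp add: lookup_sum part_def)
    also have "\<dots> = lookup (g l) m"
    proof (cases "lookup (g l) m = 0")
      case False
      have "lookup (part (int (mono_degree m + a l)) g l) m \<noteq> 0" using False by (simp add: part_def)
      then have "part (int (mono_degree m + a l)) g \<noteq> (\<lambda>_. 0)" by (metis lookup_zero)
      then have "int (mono_degree m + a l) \<in> F" unfolding F_def by simp
      then show ?thesis using finF by (simp add: sum.delta)
    next
      case True
      then show ?thesis by (auto intro: sum.neutral)
    qed
    finally show "lookup (\<Sum>j\<in>F. part j g l) m = lookup (g l) m" .
  qed
  then have sum: "u = (\<Oplus>\<^bsub>U\<^esub>j\<in>F. {part j g})" unfolding g(1) by (subst finsum_U[OF finF pv]) simp
  show "\<exists>!c. (\<forall>j. c j \<in> E j) \<and> finite {j. c j \<noteq> \<zero>\<^bsub>U\<^esub>} \<and> u = (\<Oplus>\<^bsub>U\<^esub>j\<in>{j. c j \<noteq> \<zero>\<^bsub>U\<^esub>}. c j)"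
  proof (rule ex1I[of _ "\<lambda>j. {part j g}"])
    show "(\<forall>j. {part j g} \<in> E j) \<and> finite {j. {part j g} \<noteq> \<zero>\<^bsub>U\<^esub>} \<and>
      u = (\<Oplus>\<^bsub>U\<^esub>j\<in>{j. {part j g} \<noteq> \<zero>\<^bsub>U\<^esub>}. {part j g})"
      by (intro conjI allI part_E[OF g(2)] finF[unfolded F_def] sum[unfolded F_def])
    fix c assume c: "(\<forall>j. c j \<in> E j) \<and> finite {j. c j \<noteq> \<zero>\<^bsub>U\<^esub>} \<and> u = (\<Oplus>\<^bsub>U\<^esub>j\<in>{j. c j \<noteq> \<zero>\<^bsub>U\<^esub>}. c j)"
    define h where "h j = the_elem (c j)" for j
    have ch: "c j = {h j}" "h j \<in> valid" "hom j (h j)" for j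
    proof -
      have "c j \<in> E j" using spec[OF conjunct1[OF c]] .
      then obtain g' where "c j = {g'}" "g' \<in> valid" "hom j g'" by (rule E_elim)
      then show "c j = {h j}" "h j \<in> valid" "hom j (h j)" by (simp_all add: h_def)
    qed
    let ?G = "{j. {h j} \<noteq> \<zero>\<^bsub>U\<^esub>}"
    have finG: "finite ?G" and "{g} = (\<Oplus>\<^bsub>U\<^esub>j\<in>?G. {h j})" using c unfolding g(1) ch(1) by auto
    then have gsum: "g = (\<lambda>l. \<Sum>j\<in>?G. h j l)" by (subst (asm) finsum_U[OF finG ch(2)]) simp
    \<comment> \<open>Uniqueness of the decomposition: a monomial \<open>m\<close> of
      \<open>g l\<close> can come only from the component whose degree is that of \<open>m\<close>,
      shifted by \<open>a l\<close>.\<close>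
    have "h j = part j g" for j
    proof (rule ext, rule poly_mapping_eqI)
      fix l m
      have zero: "lookup (h j' l) m = 0" if "int (mono_degree m + a l) \<noteq> j'" for j'
        using ch(3)[of j'] that unfolding hom_def by (metis not_in_keys_iff_lookup_eq_zero)
      show "lookup (h j l) m = lookup (part j g l) m"
      proof (cases "int (mono_degree m + a l) = j")
        case True
        have "lookup (g l) m = (\<Sum>j'\<in>?G. lookup (h j' l) m)"
          by (subst gsum) (simp add: lookup_sum)
        also have "\<dots> = (\<Sum>j'\<in>?G. if j' = j then lookup (h j' l) m else 0)"
          using zero True by (intro sum.cong) auto
        also have "\<dots> = lookup (h j l) m"
          using finG by (auto simp: sum.delta)
        finally show ?thesis using True by (simp add: part_def)
      next
        case False
        then show ?thesis using zero[OF False] by (simp add: part_def)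
      qed
    qed
    then show "c = (\<lambda>j. {part j g})" using ch(1) by (intro ext) simp
  qed
qed

lemma fg_graded_U: "fg_graded_module N (U :: ('k::field mpoly, (nat \<Rightarrow> 'k mpoly) set) module) E"
  unfolding fg_graded_module_def using fin_gen_U grading_U by blast

end

lemma sum_singles_lookup:
  assumes "finite A"
  shows "lookup (\<Sum>m\<in>A. single m (c m)) m = (if m \<in> A then c m else 0)"
  using assms by (simp add: lookup_sum lookup_single when_def sum.delta)

text \<open>The common last step of the three proofs that a family of monomials is a
  \<open>K\<close>-basis, where the equation for the coefficients amounts to one prescribed value
  per basis element.\<close>

lemma ex1_coefficients:
  assumes inj: "inj_on b X" and iff: "\<And>\<alpha>. P \<alpha> \<longleftrightarrow> (\<forall>x\<in>X. \<alpha> (b x) = coef x)"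
  shows "\<exists>!\<alpha>. \<alpha> \<in> b ` X \<rightarrow>\<^sub>E UNIV \<and> P \<alpha>"
proof -
  define \<alpha> where "\<alpha> = restrict (\<lambda>y. coef (the_inv_into X b y)) (b ` X)"
  have \<alpha>: "\<alpha> (b x) = coef x" if "x \<in> X" for x
    unfolding \<alpha>_def using that the_inv_into_f_f[OF inj that] by simp
  show ?thesis
  proof (rule ex1I[of _ \<alpha>])
    show "\<alpha> \<in> b ` X \<rightarrow>\<^sub>E UNIV \<and> P \<alpha>" unfolding iff using \<alpha> by (simp add: \<alpha>_def)
    fix \<beta> assume \<beta>: "\<beta> \<in> b ` X \<rightarrow>\<^sub>E UNIV \<and> P \<beta>"
    show "\<beta> = \<alpha>"
    proof (rule extensionalityI[of _ "b ` X"])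
      show "\<beta> \<in> extensional (b ` X)" using \<beta> by (simp add: PiE_def)
      show "\<alpha> \<in> extensional (b ` X)" by (simp add: \<alpha>_def)
      fix y assume "y \<in> b ` X"
      then obtain x where "x \<in> X" "y = b x" by blast
      then show "\<beta> y = \<alpha> y" using \<alpha> \<beta> unfolding iff by simp
    qed
  qed
qed

section \<open>Hilbert series and regular sequences of the direct sums\<close>

context stanley
begin

text \<open>The indices of the monomial basis in degree \<open>j\<close>. Without the condition on
  \<open>a l\<close>, truncation by \<open>nat\<close> would count a constant in degrees below the
  shift.\<close>

definition Idx :: "int \<Rightarrow> (nat \<times> (nat \<Rightarrow>\<^sub>0 nat)) set" where
  "Idx j = (SIGMA l:{l. l < L \<and> int (a l) \<le> j}. mons (w l) (nat (j - int (a l))))"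

lemma Idx_iff: "(l, m) \<in> Idx j \<longleftrightarrow> l < L \<and> inside l m \<and> int (mono_degree m + a l) = j"
  by (auto simp: Idx_def mons_def inside_def)

lemma finite_Idx: "finite (Idx j)"
  unfolding Idx_def by (intro finite_SigmaI) (auto simp: finite_mons)

definition bvec :: "nat \<times> (nat \<Rightarrow>\<^sub>0 nat) \<Rightarrow> nat \<Rightarrow> 'k::field mpoly" where
  "bvec x = unit_vec (fst x) (single (snd x) 1)"

lemma bvec_inj: "bvec x = (bvec y :: nat \<Rightarrow> 'k::field mpoly) \<Longrightarrow> x = y"
proof -
  assume eq: "bvec x = (bvec y :: nat \<Rightarrow> 'k mpoly)"
  have "lookup ((bvec y :: nat \<Rightarrow> 'k mpoly) (fst x)) (snd x) = 1"
    unfolding eq[symmetric] by (simp add: bvec_def unit_vec_def)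
  then show "x = y" by (auto simp: bvec_def unit_vec_def lookup_single when_def prod_eq_iff split: if_splits)
qed

lemma single_carrier: "keys m \<subseteq> {1..v} \<Longrightarrow> single m c \<in> carrier (mpoly_ring v)"
  by (auto simp: mpoly_ring_carrier)

lemma bvec_E: assumes "x \<in> Idx j" shows "{bvec x} \<in> E j"
proof -
  obtain l m where x: "x = (l, m)" by (cases x)
  have lm: "l < L" "inside l m" "int (mono_degree m + a l) = j" using assms unfolding x Idx_iff by auto
  have "bvec x \<in> valid" unfolding bvec_def x fst_conv snd_conv
    using lm by (intro valid_unit_vec single_carrier) (auto simp: inside_def)
  moreover have "hom j (bvec x)"
    using lm(3) by (auto simp: hom_def bvec_def x unit_vec_def in_keys_iff lookup_single when_def split: if_splits)
  ultimately show ?thesis by (simp add: E_iff)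
qed

lemma times_bvec: assumes "x \<in> Idx j"
  shows "times (mpoly_const c) (bvec x) = unit_vec (fst x) (single (snd x) c)"
proof -
  obtain l m where x: "x = (l, m)" by (cases x)
  have lm: "inside l m" using assms unfolding x Idx_iff by auto
  have "mrestrict (inside l) (single m c) = single m c"
    using lm by (intro mrestrict_id) (auto simp: in_keys_iff lookup_single when_def split: if_splits)
  then show ?thesis unfolding bvec_def times_unit_vec x by (simp add: mpoly_const_def mult_single)
qed

lemma basis_U: "is_K_basis (U :: ('k::field mpoly, (nat \<Rightarrow> 'k mpoly) set) module) (E j) ((\<lambda>x. {bvec x}) ` Idx j)"
proof -
  let ?b = "\<lambda>x. {bvec x :: nat \<Rightarrow> 'k mpoly}"
  let ?B = "?b ` Idx j"
  have inj: "inj_on ?b (Idx j)" by (auto simp: inj_on_def dest: bvec_inj)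
  have uv: "unit_vec (fst x) (single (snd x) c) \<in> valid" if "x \<in> Idx j" for x and c :: 'k
    using that by (cases x) (auto simp: Idx_iff inside_def intro!: valid_unit_vec single_carrier)
  have uv': "unit_vec l (single m c) \<in> valid" if "(l, m) \<in> Idx j" for l m and c :: 'k
    using uv[OF that] by simp
  interpret U: abelian_group "U :: ('k mpoly, (nat \<Rightarrow> 'k mpoly) set) module" by (rule abelian_group_U)
  have sum: "(\<Oplus>\<^bsub>U\<^esub>b\<in>?B. mpoly_const (\<alpha> b) \<odot>\<^bsub>U\<^esub> b) =
      {\<lambda>l. \<Sum>x\<in>Idx j. unit_vec (fst x) (single (snd x) (\<alpha> (?b x))) l}" for \<alpha> :: "(nat \<Rightarrow> 'k mpoly) set \<Rightarrow> 'k"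
  proof -
    have "(\<Oplus>\<^bsub>U\<^esub>b\<in>?B. mpoly_const (\<alpha> b) \<odot>\<^bsub>U\<^esub> b) = (\<Oplus>\<^bsub>U\<^esub>x\<in>Idx j. mpoly_const (\<alpha> (?b x)) \<odot>\<^bsub>U\<^esub> ?b x)"
      by (subst U.finsum_reindex[OF _ inj]) (auto simp: times_bvec uv')
    also have "\<dots> = (\<Oplus>\<^bsub>U\<^esub>x\<in>Idx j. {unit_vec (fst x) (single (snd x) (\<alpha> (?b x)))})"
      by (intro U.finsum_cong') (auto simp: times_bvec uv')
    also have "\<dots> = {\<lambda>l. \<Sum>x\<in>Idx j. unit_vec (fst x) (single (snd x) (\<alpha> (?b x))) l}"
      by (rule finsum_U[OF finite_Idx uv])
    finally show ?thesis .
  qed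
  have lookup: "lookup (\<Sum>x\<in>Idx j. unit_vec (fst x) (single (snd x) (c x)) l) m =
      (if (l, m) \<in> Idx j then c (l, m) else 0)" for c l m
  proof -
    have "lookup (\<Sum>x\<in>Idx j. unit_vec (fst x) (single (snd x) (c x)) l) m =
      (\<Sum>x\<in>Idx j. if x = (l, m) then c x else 0)"
      unfolding lookup_sum by (intro sum.cong refl) (auto simp: unit_vec_def lookup_single when_def)
    then show ?thesis using finite_Idx by (simp add: sum.delta)
  qed
  have "\<exists>!\<alpha>. \<alpha> \<in> ?B \<rightarrow>\<^sub>E UNIV \<and> v = (\<Oplus>\<^bsub>U\<^esub>b\<in>?B. mpoly_const (\<alpha> b) \<odot>\<^bsub>U\<^esub> b)" if v: "v \<in> E j" for v
  proof -
    obtain g where g: "v = {g}" "g \<in> valid" "hom j g" using v by (rule E_elim)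
    define coef where "coef x = lookup (g (fst x)) (snd x)" for x
    have supp: "lookup (g l) m = (if (l, m) \<in> Idx j then coef (l, m) else 0)" for l m
    proof (cases "lookup (g l) m = 0")
      case False
      then have m: "m \<in> keys (g l)" by (simp add: in_keys_iff)
      have "l < L" using False validD(2)[OF g(2), of l] by (cases "l < L") auto
      moreover have "inside l m" using m validD(1)[OF g(2) \<open>l < L\<close>] by (simp add: mpoly_ring_carrier inside_def)
      ultimately have "(l, m) \<in> Idx j" using g(3) m by (simp add: Idx_iff hom_def)
      then show ?thesis by (simp add: coef_def)
    qed (simp add: coef_def)
    have eq_iff: "v = (\<Oplus>\<^bsub>U\<^esub>b\<in>?B. mpoly_const (\<alpha> b) \<odot>\<^bsub>U\<^esub> b) \<longleftrightarrow> (\<forall>x\<in>Idx j. \<alpha> (?b x) = coef x)" for \<alpha>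
    proof -
      have "v = (\<Oplus>\<^bsub>U\<^esub>b\<in>?B. mpoly_const (\<alpha> b) \<odot>\<^bsub>U\<^esub> b) \<longleftrightarrow>
        (\<forall>l m. lookup (g l) m = (if (l, m) \<in> Idx j then \<alpha> (?b (l, m)) else 0))"
        unfolding sum g(1) by (simp add: fun_eq_iff poly_mapping_eq_iff lookup)
      also have "\<dots> \<longleftrightarrow> (\<forall>x\<in>Idx j. \<alpha> (?b x) = coef x)"
        unfolding supp by auto
      finally show ?thesis .
    qed
    from inj eq_iff show ?thesis by (rule ex1_coefficients)
  qed
  then show ?thesis
    unfolding is_K_basis_def using finite_Idx bvec_E by (intro conjI ballI) auto
qed

lemma K_dim_U: "K_dim (U :: ('k::field mpoly, (nat \<Rightarrow> 'k mpoly) set) module) (E j) = card (Idx j)"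
proof -
  interpret mpoly_module N "U :: ('k mpoly, (nat \<Rightarrow> 'k mpoly) set) module"
    unfolding mpoly_module_def by (rule module_U)
  have "inj_on (\<lambda>x. {bvec x :: nat \<Rightarrow> 'k mpoly}) (Idx j)" by (auto simp: inj_on_def dest: bvec_inj)
  moreover have "E j \<subseteq> carrier U" "\<zero>\<^bsub>U\<^esub> \<in> E j" by (auto simp: E_def valid_0 hom_def)
  ultimately show ?thesis using K_dim_eq_card[OF basis_U[of j]] by (simp add: card_image)
qed

lemma card_Idx: "int (card (Idx j)) =
    (if j < 0 then 0 else fps_nth (\<Sum>l<L. fps_X ^ a l * HS (w l)) (nat j))"
proof -
  have "card (Idx j) = (\<Sum>l\<in>{l. l < L \<and> int (a l) \<le> j}. cn (w l) (nat (j - int (a l))))"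
    unfolding Idx_def cn_def by (intro card_SigmaI) (auto simp: finite_mons)
  also have "\<dots> = (\<Sum>l<L. if int (a l) \<le> j then cn (w l) (nat (j - int (a l))) else 0)"
    by (intro sum.mono_neutral_cong_left) auto
  finally have eq: "int (card (Idx j)) = (\<Sum>l<L. if int (a l) \<le> j then int (cn (w l) (nat (j - int (a l)))) else 0)"
    by (simp add: if_distrib cong: if_cong)
  show ?thesis
  proof (cases "j < 0")
    case True
    then show ?thesis unfolding eq by (intro trans[OF sum.neutral]) auto
  next
    case False
    have "fps_nth (fps_X ^ a l * HS (w l)) (nat j) = (if int (a l) \<le> j then int (cn (w l) (nat (j - int (a l)))) else 0)" for l
    proof (cases "int (a l) \<le> j")
      case True
      then have "nat (j - int (a l)) = nat j - a l" "\<not> nat j < a l" by auto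
      then show ?thesis using True by (simp add: fps_X_power_mult_nth HS_nth)
    next
      case l: False
      then have "nat j < a l" using False by auto
      then show ?thesis using l by (simp add: fps_X_power_mult_nth)
    qed
    then show ?thesis using False unfolding eq by (simp add: fps_sum_nth)
  qed
qed

lemma hilbert_series_U:
  "hilbert_series (U :: ('k::field mpoly, (nat \<Rightarrow> 'k mpoly) set) module) E = fps_to_fls (\<Sum>l<L. fps_X ^ a l * HS (w l))"
proof (rule fls_eqI)
  fix j
  have "int (K_dim (U :: ('k mpoly, (nat \<Rightarrow> 'k mpoly) set) module) (E j)) = 0" if "j < 0" for j
    using that by (simp add: K_dim_U card_Idx)
  then have "fls_nth (hilbert_series (U :: ('k mpoly, (nat \<Rightarrow> 'k mpoly) set) module) E) j = int (card (Idx j))"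
    unfolding hilbert_series_def by (subst nth_Abs_fls_lower_bound[of 0]) (auto simp: K_dim_U)
  then show "fls_nth (hilbert_series (U :: ('k mpoly, (nat \<Rightarrow> 'k mpoly) set) module) E) j =
      fls_nth (fps_to_fls (\<Sum>l<L. fps_X ^ a l * HS (w l))) j"
    by (simp add: card_Idx)
qed

text \<open>\<open>TT i\<close> turns out to be \<open>(x\<^sub>1,\<dots>,x\<^sub>i)U\<close>.\<close>

definition TT :: "nat \<Rightarrow> (nat \<Rightarrow> 'k::field mpoly) set set" where
  "TT i = (\<lambda>g. {g}) ` {g \<in> valid. \<forall>l. \<forall>m\<in>keys (g l). keys m \<inter> {1..i} \<noteq> {}}"

lemma TT_iff: "{g} \<in> TT i \<longleftrightarrow> g \<in> valid \<and> (\<forall>l. \<forall>m\<in>keys (g l). keys m \<inter> {1..i} \<noteq> {})"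
  by (auto simp: TT_def)

lemma times_keys:
  assumes "m \<in> keys (times p g l)"
  obtains b c where "m = b + c" "b \<in> keys p" "c \<in> keys (g l)"
  using assms Poly_Mapping.keys_mult[of p "g l"] by (auto simp: times_def keys_mrestrict)

lemma submodule_TT: "submodule (TT i) (mpoly_ring N) (U :: ('k::field mpoly, (nat \<Rightarrow> 'k mpoly) set) module)"
proof -
  interpret U: module "mpoly_ring N" "U :: ('k mpoly, (nat \<Rightarrow> 'k mpoly) set) module" by (rule module_U)
  show ?thesis
  proof (rule U.submoduleI)
    show "TT i \<subseteq> carrier U" by (auto simp: TT_def)
    show "\<zero>\<^bsub>U\<^esub> \<in> TT i" by (simp add: TT_iff valid_0)
  next
    fix u :: "(nat \<Rightarrow> 'k mpoly) set" assume "u \<in> TT i"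
    then obtain g where g: "u = {g}" "{g} \<in> TT i" by (auto simp: TT_def)
    have gv: "g \<in> valid" using g by (simp add: TT_iff)
    have "\<ominus>\<^bsub>U\<^esub> u = {\<lambda>l. - g l}"
      using g gv valid_uminus[OF gv] by (intro U.minus_equality) simp_all
    then show "\<ominus>\<^bsub>U\<^esub> u \<in> TT i" using g(2) valid_uminus[OF gv] by (simp add: TT_iff in_keys_iff)
  next
    fix u v :: "(nat \<Rightarrow> 'k mpoly) set" assume "u \<in> TT i" "v \<in> TT i"
    then obtain g h where gh: "u = {g}" "v = {h}" "{g} \<in> TT i" "{h} \<in> TT i" by (auto simp: TT_def)
    have "keys m \<inter> {1..i} \<noteq> {}" if "m \<in> keys (g l + h l)" for l m
      using subsetD[OF Poly_Mapping.keys_add that] gh(3,4) unfolding TT_iff by blast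
    then show "u \<oplus>\<^bsub>U\<^esub> v \<in> TT i" using gh(3,4) unfolding gh(1,2) U_simps TT_iff by (simp add: valid_add)
  next
    fix p :: "'k mpoly" and u :: "(nat \<Rightarrow> 'k mpoly) set" assume "u \<in> TT i"
    then obtain g where g: "u = {g}" "{g} \<in> TT i" by (auto simp: TT_def)
    have "keys m \<inter> {1..i} \<noteq> {}" if m: "m \<in> keys (times p g l)" for l m
    proof -
      obtain b c where "m = b + c" "c \<in> keys (g l)" using m by (rule times_keys)
      then show ?thesis using g(2) unfolding TT_iff by (auto simp: keys_add_nat)
    qed
    then show "p \<odot>\<^bsub>U\<^esub> u \<in> TT i" using g(2) unfolding g(1) U_simps TT_iff by (simp add: valid_times)
  qed
qed

text \<open>Induction on \<open>i\<close>: the terms that contain none of the first \<open>i\<close>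
  variables must contain the next one and can be divided by it; the remaining terms are covered by
  the induction hypothesis.\<close>

lemma TT_subset:
  assumes H: "submodule H (mpoly_ring N) (U :: ('k::field mpoly, (nat \<Rightarrow> 'k mpoly) set) module)"
    and mem: "\<And>s u. s \<in> {1..i} \<Longrightarrow> u \<in> carrier U \<Longrightarrow> mpoly_var s \<odot>\<^bsub>U\<^esub> u \<in> H"
  shows "TT i \<subseteq> H"
proof -
  interpret U: module "mpoly_ring N" "U :: ('k mpoly, (nat \<Rightarrow> 'k mpoly) set) module" by (rule module_U)
  note HE = U.submoduleE[OF H]
  show ?thesis using mem
  proof (induction i)
    case 0
    have "u = {\<lambda>_. 0}" if "u \<in> TT 0" for u :: "(nat \<Rightarrow> 'k mpoly) set"
    proof -
      from that obtain g where g: "u = {g}" "\<forall>l. keys (g l) = {}" by (auto simp: TT_def)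
      then show ?thesis by (auto simp: fun_eq_iff)
    qed
    moreover obtain x where "x \<in> H" using HE(2) by blast
    from U_carrierE[OF subsetD[OF HE(1) this]] obtain h where "x = {h}" by blast
    from HE(4)[OF mpoly_carrier_0 \<open>x \<in> H\<close>] have "{\<lambda>_. 0} \<in> H" unfolding \<open>x = {h}\<close> by (simp add: times_def)
    ultimately show ?case by blast
  next
    case (Suc i)
    have IH: "TT i \<subseteq> H" using Suc by auto
    show ?case
    proof
      fix u :: "(nat \<Rightarrow> 'k mpoly) set" assume "u \<in> TT (Suc i)"
      then obtain g where g: "u = {g}" "g \<in> valid" "\<And>l m. m \<in> keys (g l) \<Longrightarrow> keys m \<inter> {1..Suc i} \<noteq> {}"
        by (auto simp: TT_def)
      let ?P = "\<lambda>m. keys m \<inter> {1..i} \<noteq> {}"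
      define g1 where "g1 l = mrestrict ?P (g l)" for l
      define g2 where "g2 l = mrestrict (\<lambda>m. \<not> ?P m) (g l)" for l
      have sum: "g1 l + g2 l = g l" for l
        by (rule poly_mapping_eqI) (simp add: lookup_add g1_def g2_def)
      have v1: "g1 \<in> valid" and v2: "g2 \<in> valid"
        using g(2) by (auto simp: valid_def g1_def g2_def mpoly_ring_carrier keys_mrestrict)
      have "{g1} \<in> H" using IH v1 by (auto simp: TT_iff g1_def keys_mrestrict)
      moreover have "{g2} \<in> H"
      proof -
        have "\<exists>q. q \<in> carrier (mpoly_ring (w l)) \<and> g2 l = mpoly_var (Suc i) * q" if "l < L" for l
        proof (rule var_divides)
          show "g2 l \<in> carrier (mpoly_ring (w l))" using validD(1)[OF v2 that] .
          fix m assume "m \<in> keys (g2 l)"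
          then have m: "m \<in> keys (g l)" "\<not> ?P m" by (auto simp: g2_def keys_mrestrict)
          from g(3)[OF m(1)] obtain s where "s \<in> keys m" "s \<in> {1..Suc i}" by blast
          moreover have "s \<notin> {1..i}" using m(2) calculation(1) by blast
          ultimately have "s = Suc i" by auto
          then show "Suc i \<in> keys m" using \<open>s \<in> keys m\<close> by simp
        qed blast
        then have "\<forall>l. \<exists>q. l < L \<longrightarrow> q \<in> carrier (mpoly_ring (w l)) \<and> g2 l = mpoly_var (Suc i) * q" by blast
        then obtain q where q: "\<And>l. l < L \<Longrightarrow> q l \<in> carrier (mpoly_ring (w l)) \<and> g2 l = mpoly_var (Suc i) * q l"
          by metis
        define h where "h l = (if l < L then q l else 0)" for l
        have hv: "h \<in> valid" using q by (simp add: valid_def h_def)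
        have "times (mpoly_var (Suc i)) h = g2"
        proof
          fix l show "times (mpoly_var (Suc i)) h l = g2 l"
            using q[of l] mrestrict_inside_id[OF validD(1)[OF v2], of l] validD(2)[OF v2, of l]
            by (cases "l < L") (auto simp: times_def h_def)
        qed
        moreover have "mpoly_var (Suc i) \<odot>\<^bsub>U\<^esub> {h} \<in> H" using hv by (intro Suc.prems) simp_all
        ultimately show ?thesis by simp
      qed
      ultimately have "{g1} \<oplus>\<^bsub>U\<^esub> {g2} \<in> H" by (rule HE(5))
      then show "u \<in> H" unfolding g(1) by (simp add: sum)
    qed
  qed
qed

lemma seq_submodule_TT:
  assumes "i \<le> d"
  shows "seq_submodule (mpoly_ring N) (U :: ('k::field mpoly, (nat \<Rightarrow> 'k mpoly) set) module)
     (take i (map mpoly_var [1..<Suc d])) = TT i"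
proof -
  have set: "set (take i (map mpoly_var [1..<Suc d])) = (mpoly_var ` {1..i} :: 'k mpoly set)"
    using assms by (simp add: take_map take_upt atLeastLessThanSuc_atLeastAtMost del: upt_Suc)
  have "mpoly_var s \<odot>\<^bsub>U\<^esub> u \<in> TT i" if s: "s \<in> {1..i}" and u: "u \<in> carrier U" for s and u :: "(nat \<Rightarrow> 'k mpoly) set"
  proof -
    obtain g where g: "u = {g}" "g \<in> valid" using u by (rule U_carrierE)
    have "keys m \<inter> {1..i} \<noteq> {}" if m: "m \<in> keys (times (mpoly_var s) g l)" for l m
    proof -
      obtain b c where "m = b + c" "b \<in> keys (mpoly_var s :: 'k mpoly)" using m by (rule times_keys)
      then show ?thesis using s by (auto simp: mpoly_var_def keys_add_nat)
    qed
    then show ?thesis unfolding g(1) using g(2) by (simp add: TT_iff valid_times)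
  qed
  then show ?thesis unfolding seq_submodule_def set
    using submodule_TT TT_subset by (intro subset_antisym) blast+
qed

text \<open>Since \<open>d \<le> w l\<close>, the first \<open>d\<close> variables act freely on
  every summand, and a product of the variable number \<open>i + 1\<close> with a monomial contains
  one of the first \<open>i\<close> variables only if the monomial does. A constant in the first
  summand, present because \<open>0 < L\<close>, shows that the generated submodule is
  proper.\<close>

lemma regular_sequence_U:
  assumes d: "\<And>l. l < L \<Longrightarrow> d \<le> w l" and L: "0 < L"
  shows "set (map mpoly_var [1..<Suc d]) \<subseteq> (graded_maximal_ideal N :: 'k::field mpoly set)"
    and "regular_sequence (mpoly_ring N) (U :: ('k mpoly, (nat \<Rightarrow> 'k mpoly) set) module) (map mpoly_var [1..<Suc d])"
proof -
  interpret R: cring "mpoly_ring N :: 'k mpoly ring" by (rule cring_mpoly_ring)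
  have dN: "d \<le> N" using d[OF L] w_le[OF L] by simp
  have set: "set (map mpoly_var [1..<Suc d]) = (mpoly_var ` {1..d} :: 'k mpoly set)"
    by (simp add: atLeastLessThanSuc_atLeastAtMost del: upt_Suc)
  have sub: "mpoly_var ` {1..N} \<subseteq> carrier (mpoly_ring N :: 'k mpoly ring)" by (auto simp: mpoly_carrier_var)
  show "set (map mpoly_var [1..<Suc d]) \<subseteq> (graded_maximal_ideal N :: 'k mpoly set)"
    unfolding set graded_maximal_ideal_def using R.genideal_self[OF sub] dN by force
  have full: "seq_submodule (mpoly_ring N) U (map mpoly_var [1..<Suc d]) = (TT d :: (nat \<Rightarrow> 'k mpoly) set set)"
    using seq_submodule_TT[of d d] by simp
  have "{unit_vec 0 1} \<in> carrier U" "{unit_vec 0 1} \<notin> (TT d :: (nat \<Rightarrow> 'k mpoly) set set)"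
    using L by (auto simp: TT_iff unit_vec_def intro!: valid_unit_vec[unfolded unit_vec_def] mpoly_carrier_1)
  then have neq: "TT d \<noteq> carrier (U :: ('k mpoly, (nat \<Rightarrow> 'k mpoly) set) module)" by blast
  have nzd: "u \<in> TT i" if i: "i < d" and u: "u \<in> carrier U" and xu: "mpoly_var (Suc i) \<odot>\<^bsub>U\<^esub> u \<in> TT i"
    for i and u :: "(nat \<Rightarrow> 'k mpoly) set"
  proof -
    obtain g where g: "u = {g}" "g \<in> valid" using u by (rule U_carrierE)
    have "keys m \<inter> {1..i} \<noteq> {}" if m: "m \<in> keys (g l)" for l m
    proof -
      have l: "l < L" using m validD(2)[OF g(2), of l] by (cases "l < L") auto
      let ?m = "single (Suc i) 1 + m"
      have "Suc i \<le> w l" using d[OF l] i by simp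
      then have "inside l ?m" using m validD(1)[OF g(2) l] by (auto simp: inside_def keys_add_nat mpoly_ring_carrier)
      then have "?m \<in> keys (times (mpoly_var (Suc i)) g l)"
        using m by (simp add: times_def keys_mrestrict in_keys_iff lookup_var_mult[simplified])
      then have "keys ?m \<inter> {1..i} \<noteq> {}" using xu unfolding g(1) by (simp add: TT_iff)
      then show ?thesis by (auto simp: keys_add_nat)
    qed
    then show ?thesis unfolding g(1) using g(2) by (simp add: TT_iff)
  qed
  show "regular_sequence (mpoly_ring N) (U :: ('k mpoly, (nat \<Rightarrow> 'k mpoly) set) module) (map mpoly_var [1..<Suc d])"
    unfolding regular_sequence_def full
  proof (intro conjI allI impI ballI neq)
    show "set (map mpoly_var [1..<Suc d]) \<subseteq> carrier (mpoly_ring N :: 'k mpoly ring)"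
      unfolding set using sub dN by force
    fix i and u :: "(nat \<Rightarrow> 'k mpoly) set"
    assume i: "i < length (map (mpoly_var :: nat \<Rightarrow> 'k mpoly) [1..<Suc d])" and u: "u \<in> carrier U"
      and xu: "map mpoly_var [1..<Suc d] ! i \<odot>\<^bsub>U\<^esub> u \<in> seq_submodule (mpoly_ring N) U (take i (map mpoly_var [1..<Suc d]))"
    have id: "i < d" using i by (simp del: upt_Suc)
    then have "map mpoly_var [1..<Suc d] ! i = (mpoly_var (Suc i) :: 'k mpoly)" by (simp del: upt_Suc)
    with xu show "u \<in> seq_submodule (mpoly_ring N) U (take i (map mpoly_var [1..<Suc d]))"
      using nzd[OF id u] unfolding seq_submodule_TT[OF less_imp_le[OF id]] by (simp del: upt_Suc)
  qed
qed

end

text \<open>A list of pairs \<open>(a, w)\<close> stands for the module \<open>\<Oplus> K[x\<^sub>1,\<dots>,x\<^sub>w](-a)\<close>.\<close>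

lemma module_with_hilbert_series:
  fixes N d :: nat and xs :: "(nat \<times> nat) list"
  assumes "xs \<noteq> []" "\<And>x. x \<in> set xs \<Longrightarrow> d \<le> snd x \<and> snd x \<le> N"
  shows "\<exists>(U :: ('k::field mpoly, (nat \<Rightarrow> 'k mpoly) set) module) E fs. fg_graded_module N U E \<and>
    hilbert_series U E = fps_to_fls (\<Sum>x\<leftarrow>xs. fps_X ^ fst x * HS (snd x)) \<and>
    length fs = d \<and> set fs \<subseteq> graded_maximal_ideal N \<and> regular_sequence (mpoly_ring N) U fs"
proof -
  interpret stanley N "length xs" "\<lambda>l. fst (xs ! l)" "\<lambda>l. snd (xs ! l)"
    by unfold_locales (use assms(2) in auto)
  have "(\<Sum>x\<leftarrow>xs. fps_X ^ fst x * HS (snd x)) = (\<Sum>l<length xs. fps_X ^ fst (xs ! l) * HS (snd (xs ! l)))"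
    by (simp add: sum_list_sum_nth atLeast0LessThan)
  then show ?thesis
    using fg_graded_U hilbert_series_U regular_sequence_U[of d] assms
    by (intro exI[of _ U] exI[of _ E] exI[of _ "map mpoly_var [1..<Suc d]"]) (auto simp del: upt_Suc)
qed

section \<open>Monomial ideals\<close>

locale monomial_ideal =
  fixes N :: nat and up :: "(nat \<Rightarrow>\<^sub>0 nat) set"
  assumes up_add: "m \<in> up \<Longrightarrow> m + m' \<in> up"
begin

definition J :: "'k::field mpoly set" where
  "J = {p \<in> carrier (mpoly_ring N). keys p \<subseteq> up}"

lemma J_carrier: "p \<in> J \<Longrightarrow> p \<in> carrier (mpoly_ring N)" by (simp add: J_def)

lemma J_0: "0 \<in> J" by (simp add: J_def mpoly_carrier_0)

lemma J_add: "p \<in> J \<Longrightarrow> q \<in> J \<Longrightarrow> p + q \<in> J"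
  using Poly_Mapping.keys_add[of p q] by (auto simp: J_def mpoly_carrier_add)

lemma J_uminus: "p \<in> J \<Longrightarrow> - p \<in> J"
  by (auto simp: J_def mpoly_carrier_uminus in_keys_iff)

lemma J_mult: assumes "p \<in> carrier (mpoly_ring N)" "q \<in> J" shows "p * q \<in> J"
proof -
  have "m \<in> up" if m: "m \<in> keys (p * q)" for m
  proof -
    obtain b c where "m = b + c" "c \<in> keys q" using Poly_Mapping.keys_mult[of p q] m by blast
    then show ?thesis using assms(2) up_add[of c b] by (auto simp: J_def add.commute)
  qed
  then show ?thesis using assms by (auto simp: J_def mpoly_carrier_mult)
qed

lemma ideal_J: "ideal J (mpoly_ring N :: 'k::field mpoly ring)"
proof -
  interpret R: cring "mpoly_ring N :: 'k mpoly ring" by (rule cring_mpoly_ring)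
  show ?thesis
  proof (rule idealI[OF R.ring_axioms])
    show "subgroup J (add_monoid (mpoly_ring N :: 'k mpoly ring))"
    proof (rule R.add.subgroupI)
      fix p :: "'k mpoly" assume p: "p \<in> J"
      have "\<ominus>\<^bsub>mpoly_ring N\<^esub> p = - p"
        by (rule R.minus_equality) (use p in \<open>simp_all add: J_carrier mpoly_carrier_uminus\<close>)
      then show "\<ominus>\<^bsub>mpoly_ring N\<^esub> p \<in> J" using J_uminus[OF p] by simp
    qed (use J_carrier J_0 J_add in auto)
  next
    fix p q :: "'k mpoly" assume "p \<in> J" "q \<in> carrier (mpoly_ring N)"
    from J_mult[OF this(2,1)] show "q \<otimes>\<^bsub>mpoly_ring N\<^esub> p \<in> J" "p \<otimes>\<^bsub>mpoly_ring N\<^esub> q \<in> J"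
      by (simp_all add: mult.commute)
  qed
qed

lemma abelian_group_J: "abelian_group (ideal_module (J :: 'k::field mpoly set))"
proof (rule abelian_groupI)
  fix p :: "'k mpoly" assume "p \<in> carrier (ideal_module J)"
  then show "\<exists>q\<in>carrier (ideal_module J). q \<oplus>\<^bsub>ideal_module J\<^esub> p = \<zero>\<^bsub>ideal_module J\<^esub>"
    by (intro bexI[of _ "- p"]) (auto simp: ideal_module_def J_uminus)
qed (auto simp: ideal_module_def J_0 J_add add_ac)

lemma module_J: "module (mpoly_ring N) (ideal_module (J :: 'k::field mpoly set))"
  by (rule moduleI[OF cring_mpoly_ring abelian_group_J])
     (auto simp: ideal_module_def J_mult algebra_simps)

lemma finsum_J:
  fixes h :: "'i \<Rightarrow> 'k::field mpoly"
  assumes "finite A" "\<And>i. i \<in> A \<Longrightarrow> h i \<in> J"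
  shows "(\<Oplus>\<^bsub>ideal_module J\<^esub>i\<in>A. h i) = sum h A"
proof -
  interpret M: abelian_group "ideal_module (J :: 'k mpoly set)" by (rule abelian_group_J)
  have [simp]: "carrier (ideal_module J) = (J :: 'k mpoly set)" "zero (ideal_module J) = (0 :: 'k mpoly)"
    "add (ideal_module J) = ((+) :: 'k mpoly \<Rightarrow> _)" by (simp_all add: ideal_module_def)
  show ?thesis using assms
  proof (induction A rule: finite_induct)
    case (insert i A)
    then show ?case by (subst M.finsum_insert) (auto simp: Pi_def)
  qed simp
qed

definition Mon :: "int \<Rightarrow> (nat \<Rightarrow>\<^sub>0 nat) set" where
  "Mon j = {m. keys m \<subseteq> {1..N} \<and> int (mono_degree m) = j}"

lemma Mon_eq: "Mon j = (if j < 0 then {} else mons N (nat j))"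
  by (auto simp: Mon_def mons_def)

lemma finite_Mon: "finite (Mon j)" by (simp add: Mon_eq finite_mons)

lemma single_inj: "inj_on (\<lambda>m. single m (1 :: 'k::field)) X"
  by (rule inj_onI) (metis keys_single zero_neq_one singleton_inject)

lemma component_iff: "p \<in> mpoly_component N j \<longleftrightarrow> keys p \<subseteq> Mon j"
  by (auto simp: mpoly_component_def mpoly_ring_carrier Mon_def)

lemma basis_J:
  "is_K_basis (ideal_module (J :: 'k::field mpoly set)) (ideal_grading N J j) ((\<lambda>m. single m 1) ` (Mon j \<inter> up))"
proof -
  let ?X = "Mon j \<inter> up" and ?b = "\<lambda>m. single m (1 :: 'k)"
  have fin: "finite ?X" using finite_Mon by blast
  have bJ: "single m c \<in> J" if "m \<in> ?X" for m and c :: 'k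
    using that by (auto simp: J_def mpoly_ring_carrier Mon_def)
  have bg: "?b m \<in> ideal_grading N J j" if "m \<in> ?X" for m
    using bJ[OF that] that by (simp add: ideal_grading_def component_iff)
  have sum: "(\<Oplus>\<^bsub>ideal_module J\<^esub>b\<in>?b ` ?X. mpoly_const (\<alpha> b) \<odot>\<^bsub>ideal_module J\<^esub> b) =
     (\<Sum>m\<in>?X. single m (\<alpha> (?b m)))" for \<alpha> :: "'k mpoly \<Rightarrow> 'k"
  proof -
    have "(\<Oplus>\<^bsub>ideal_module J\<^esub>b\<in>?b ` ?X. mpoly_const (\<alpha> b) \<odot>\<^bsub>ideal_module J\<^esub> b) =
       (\<Sum>b\<in>?b ` ?X. mpoly_const (\<alpha> b) * b)"
      using fin bJ by (subst finsum_J) (auto simp: ideal_module_def mpoly_const_def mult_single)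
    also have "\<dots> = (\<Sum>m\<in>?X. mpoly_const (\<alpha> (?b m)) * ?b m)"
      by (subst sum.reindex[OF single_inj]) (simp add: comp_def)
    finally show ?thesis by (simp add: mpoly_const_def mult_single)
  qed
  have "\<exists>!\<alpha>. \<alpha> \<in> ?b ` ?X \<rightarrow>\<^sub>E UNIV \<and> v = (\<Oplus>\<^bsub>ideal_module J\<^esub>b\<in>?b ` ?X. mpoly_const (\<alpha> b) \<odot>\<^bsub>ideal_module J\<^esub> b)"
    if v: "v \<in> ideal_grading N J j" for v
  proof (rule ex1_coefficients[OF single_inj, of _ _ "\<lambda>m. lookup v m"])
    fix \<alpha> :: "'k mpoly \<Rightarrow> 'k"
    have keys: "lookup v m = 0" if "m \<notin> ?X" for m
    proof -
      have "keys v \<subseteq> ?X" using v by (auto simp: ideal_grading_def component_iff J_def)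
      then show ?thesis using that by (metis not_in_keys_iff_lookup_eq_zero subsetD)
    qed
    show "v = (\<Oplus>\<^bsub>ideal_module J\<^esub>b\<in>?b ` ?X. mpoly_const (\<alpha> b) \<odot>\<^bsub>ideal_module J\<^esub> b) \<longleftrightarrow>
      (\<forall>m\<in>?X. \<alpha> (?b m) = lookup v m)"
      unfolding sum poly_mapping_eq_iff fun_eq_iff sum_singles_lookup[OF fin] using keys by auto
  qed
  then show ?thesis unfolding is_K_basis_def using fin bg by (intro conjI ballI) auto
qed

lemma K_dim_J: "K_dim (ideal_module (J :: 'k::field mpoly set)) (ideal_grading N J j) = card (Mon j \<inter> up)"
proof -
  interpret mpoly_module N "ideal_module (J :: 'k mpoly set)"
    unfolding mpoly_module_def by (rule module_J)
  have "ideal_grading N J j \<subseteq> carrier (ideal_module (J :: 'k mpoly set))"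
    "\<zero>\<^bsub>ideal_module J\<^esub> \<in> ideal_grading N (J :: 'k mpoly set) j"
    by (auto simp: ideal_grading_def ideal_module_def J_0 component_iff)
  from K_dim_eq_card[OF basis_J this] show ?thesis by (simp add: card_image[OF single_inj])
qed

lemma hilbert_series_J:
  "fls_nth (hilbert_series (ideal_module (J :: 'k::field mpoly set)) (ideal_grading N J)) j =
     (if j < 0 then 0 else int (card (mons N (nat j) \<inter> up)))"
  unfolding hilbert_series_def K_dim_J
  by (subst nth_Abs_fls_lower_bound[of 0]) (auto simp: Mon_eq)

section \<open>Residue class rings of monomial ideals\<close>

definition coset :: "'k::field mpoly \<Rightarrow> 'k mpoly set" where "coset p = J +>\<^bsub>mpoly_ring N\<^esub> p"

lemma coset_eq: "coset p = (\<lambda>h. h + p) ` J"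
  by (auto simp: coset_def a_r_coset_def')

lemma coset_eq_iff: "coset p = coset q \<longleftrightarrow> p - q \<in> J"
proof
  assume "coset p = coset q"
  then have "0 + p \<in> (\<lambda>h. h + q) ` J" unfolding coset_eq using J_0 by blast
  then show "p - q \<in> J" by auto
next
  assume pq: "p - q \<in> J"
  have "h + p \<in> (\<lambda>h. h + q) ` J" if "h \<in> J" for h
    using J_add[OF that pq] by (intro image_eqI[of _ _ "h + (p - q)"]) auto
  moreover have "h + q \<in> (\<lambda>h. h + p) ` J" if "h \<in> J" for h
    using J_add[OF that J_uminus[OF pq]] by (intro image_eqI[of _ _ "h + - (p - q)"]) auto
  ultimately show "coset p = coset q" unfolding coset_eq by blast
qed

lemma quotient_simps:
  "carrier (quotient_module N J) = coset ` carrier (mpoly_ring N :: 'k::field mpoly ring)"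
  "zero (quotient_module N J) = (coset 0 :: 'k mpoly set)"
  "p \<in> carrier (mpoly_ring N) \<Longrightarrow> q \<in> carrier (mpoly_ring N) \<Longrightarrow>
     add (quotient_module N J) (coset p) (coset q) = (coset (p + q) :: 'k mpoly set)"
  "p \<in> carrier (mpoly_ring N) \<Longrightarrow> q \<in> carrier (mpoly_ring N) \<Longrightarrow>
     smult (quotient_module N J) p (coset q) = (coset (p * q) :: 'k mpoly set)"
proof -
  interpret I: ideal J "mpoly_ring N :: 'k mpoly ring" by (rule ideal_J)
  note defs = quotient_module_def ring.extend_def module.fields_def FactRing_def
  show "carrier (quotient_module N J) = coset ` carrier (mpoly_ring N :: 'k mpoly ring)"
    by (auto simp: defs A_RCOSETS_def' coset_def)
  show "zero (quotient_module N J) = (coset 0 :: 'k mpoly set)"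
    by (simp add: defs coset_eq)
  assume pq: "p \<in> carrier (mpoly_ring N)" "q \<in> carrier (mpoly_ring N)"
  show "add (quotient_module N J) (coset p) (coset q) = (coset (p + q) :: 'k mpoly set)"
    using I.a_rcos_sum[OF pq] by (simp add: defs coset_def)
  show "smult (quotient_module N J) p (coset q) = (coset (p * q) :: 'k mpoly set)"
    using I.rcoset_mult_add[OF pq] by (simp add: defs coset_def)
qed

lemma abelian_group_quotient: "abelian_group (quotient_module N (J :: 'k::field mpoly set))"
proof (rule abelian_groupI)
  fix u :: "'k mpoly set" assume "u \<in> carrier (quotient_module N J)"
  then obtain p where p: "u = coset p" "p \<in> carrier (mpoly_ring N)" by (auto simp: quotient_simps)
  have "coset (- p) \<oplus>\<^bsub>quotient_module N J\<^esub> u = \<zero>\<^bsub>quotient_module N J\<^esub>"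
    unfolding p(1) using p(2) by (simp add: quotient_simps mpoly_carrier_uminus)
  moreover have "coset (- p) \<in> carrier (quotient_module N J)" using p(2) by (simp add: quotient_simps mpoly_carrier_uminus)
  ultimately show "\<exists>v\<in>carrier (quotient_module N J). v \<oplus>\<^bsub>quotient_module N J\<^esub> u = \<zero>\<^bsub>quotient_module N J\<^esub>" by blast
qed (auto simp: quotient_simps mpoly_carrier_add mpoly_carrier_0 add_ac)

lemma module_quotient: "module (mpoly_ring N) (quotient_module N (J :: 'k::field mpoly set))"
  by (rule moduleI[OF cring_mpoly_ring abelian_group_quotient])
     (auto simp: quotient_simps mpoly_carrier_1 mpoly_carrier_add mpoly_carrier_mult algebra_simps)

lemma finsum_quotient:
  fixes h :: "'i \<Rightarrow> 'k::field mpoly"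
  assumes "finite A" "\<And>i. i \<in> A \<Longrightarrow> h i \<in> carrier (mpoly_ring N)"
  shows "(\<Oplus>\<^bsub>quotient_module N J\<^esub>i\<in>A. coset (h i)) = coset (sum h A)"
proof -
  interpret M: abelian_group "quotient_module N (J :: 'k mpoly set)" by (rule abelian_group_quotient)
  show ?thesis using assms
  proof (induction A rule: finite_induct)
    case empty
    show ?case by (simp add: quotient_simps)
  next
    case (insert i A)
    then show ?case by (subst M.finsum_insert) (auto simp: Pi_def quotient_simps mpoly_carrier_sum)
  qed
qed

lemma basis_quotient:
  "is_K_basis (quotient_module N (J :: 'k::field mpoly set)) (quotient_grading N J j)
     ((\<lambda>m. coset (single m 1)) ` (Mon j - up))"
    and coset_inj: "inj_on (\<lambda>m. coset (single m (1 :: 'k))) (Mon j - up)"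
proof -
  let ?X = "Mon j - up" and ?b = "\<lambda>m. coset (single m (1 :: 'k))"
  have fin: "finite ?X" using finite_Mon by blast
  have sc: "single m c \<in> carrier (mpoly_ring N)" if "m \<in> ?X" for m and c :: 'k
    using that by (auto simp: mpoly_ring_carrier Mon_def)
  have J_zero: "lookup p m = 0" if "p \<in> J" "m \<notin> up" for p :: "'k mpoly" and m
    using that by (metis (no_types, lifting) J_def mem_Collect_eq not_in_keys_iff_lookup_eq_zero subsetD)
  show inj: "inj_on ?b ?X"
  proof (rule inj_onI)
    fix m m' assume m: "m \<in> ?X" "m' \<in> ?X" "?b m = ?b m'"
    then have "lookup (single m (1 :: 'k) - single m' 1) m = 0"
      using J_zero m(1) by (metis DiffD2 coset_eq_iff)
    then show "m = m'" by (auto simp: lookup_minus lookup_single when_def split: if_splits)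
  qed
  have bg: "?b m \<in> quotient_grading N J j" if "m \<in> ?X" for m
    using that unfolding quotient_grading_def coset_def by (auto simp: component_iff)
  have sum: "(\<Oplus>\<^bsub>quotient_module N J\<^esub>b\<in>?b ` ?X. mpoly_const (\<alpha> b) \<odot>\<^bsub>quotient_module N J\<^esub> b) =
     coset (\<Sum>m\<in>?X. single m (\<alpha> (?b m)))" for \<alpha> :: "'k mpoly set \<Rightarrow> 'k"
  proof -
    interpret M: abelian_group "quotient_module N (J :: 'k mpoly set)" by (rule abelian_group_quotient)
    have sm: "mpoly_const c \<odot>\<^bsub>quotient_module N J\<^esub> ?b m = coset (single m c)" if "m \<in> ?X" for c m
      using sc[OF that] by (simp add: quotient_simps mpoly_carrier_const) (simp add: mpoly_const_def mult_single)
    have "(\<Oplus>\<^bsub>quotient_module N J\<^esub>b\<in>?b ` ?X. mpoly_const (\<alpha> b) \<odot>\<^bsub>quotient_module N J\<^esub> b) =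
       (\<Oplus>\<^bsub>quotient_module N J\<^esub>m\<in>?X. mpoly_const (\<alpha> (?b m)) \<odot>\<^bsub>quotient_module N J\<^esub> ?b m)"
      using sc by (intro M.finsum_reindex[OF _ inj]) (auto simp: sm, auto simp: quotient_simps)
    also have "\<dots> = (\<Oplus>\<^bsub>quotient_module N J\<^esub>m\<in>?X. coset (single m (\<alpha> (?b m))))"
      using sc by (intro M.finsum_cong') (auto simp: sm, auto simp: quotient_simps)
    also have "\<dots> = coset (\<Sum>m\<in>?X. single m (\<alpha> (?b m)))"
      using sc by (intro finsum_quotient fin) auto
    finally show ?thesis .
  qed
  have "\<exists>!\<alpha>. \<alpha> \<in> ?b ` ?X \<rightarrow>\<^sub>E UNIV \<and>
      v = (\<Oplus>\<^bsub>quotient_module N J\<^esub>b\<in>?b ` ?X. mpoly_const (\<alpha> b) \<odot>\<^bsub>quotient_module N J\<^esub> b)"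
    if v: "v \<in> quotient_grading N J j" for v
  proof -
    obtain p where p: "v = coset p" "p \<in> mpoly_component N j"
      using v unfolding quotient_grading_def coset_def[symmetric] by blast
    have pc: "p \<in> carrier (mpoly_ring N)" using p(2) by (rule mpoly_component_carrier)
    show ?thesis
    proof (rule ex1_coefficients[OF inj, of _ "\<lambda>m. lookup p m"])
      fix \<alpha> :: "'k mpoly set \<Rightarrow> 'k"
      let ?s = "\<Sum>m\<in>?X. single m (\<alpha> (?b m))"
      have "?s \<in> carrier (mpoly_ring N)" using sc by (intro mpoly_carrier_sum) auto
      then have c: "p - ?s \<in> carrier (mpoly_ring N)"
        using mpoly_carrier_add[OF pc mpoly_carrier_uminus] by fastforce
      have l: "lookup (p - ?s) m = lookup p m - (if m \<in> ?X then \<alpha> (?b m) else 0)" for m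
        unfolding lookup_minus sum_singles_lookup[OF fin] ..
      \<comment> \<open>Membership in \<open>J\<close> is the vanishing of the coefficients outside
        \<open>up\<close>, and there both polynomials have terms only at the monomials
        \<open>?X\<close> of degree \<open>j\<close>.\<close>
      have "p - ?s \<in> J \<longleftrightarrow> (\<forall>m\<in>?X. \<alpha> (?b m) = lookup p m)"
      proof
        assume "p - ?s \<in> J"
        then have "lookup (p - ?s) m = 0" if "m \<in> ?X" for m using J_zero that by blast
        then show "\<forall>m\<in>?X. \<alpha> (?b m) = lookup p m" unfolding l by simp
      next
        assume eq: "\<forall>m\<in>?X. \<alpha> (?b m) = lookup p m"
        have "m \<in> up" if m: "m \<in> keys (p - ?s)" for m
        proof (rule ccontr)
          assume mu: "m \<notin> up"
          have ne: "lookup (p - ?s) m \<noteq> 0" using m by (simp add: in_keys_iff)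
          show False
          proof (cases "m \<in> Mon j")
            case True
            then show ?thesis using ne eq mu unfolding l by simp
          next
            case False
            then have "lookup p m = 0"
              using p(2) unfolding component_iff by (metis not_in_keys_iff_lookup_eq_zero subsetD)
            then show ?thesis using ne False unfolding l by simp
          qed
        qed
        then show "p - ?s \<in> J" using c by (auto simp: J_def)
      qed
      then show "v = (\<Oplus>\<^bsub>quotient_module N J\<^esub>b\<in>?b ` ?X. mpoly_const (\<alpha> b) \<odot>\<^bsub>quotient_module N J\<^esub> b) \<longleftrightarrow>
        (\<forall>m\<in>?X. \<alpha> (?b m) = lookup p m)"
        unfolding sum p(1) coset_eq_iff .
    qed
  qed
  then show "is_K_basis (quotient_module N (J :: 'k mpoly set)) (quotient_grading N J j) (?b ` ?X)"
    unfolding is_K_basis_def using fin bg by (intro conjI ballI) auto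
qed

lemma K_dim_quotient:
  "K_dim (quotient_module N (J :: 'k::field mpoly set)) (quotient_grading N J j) = card (Mon j - up)"
proof -
  interpret mpoly_module N "quotient_module N (J :: 'k mpoly set)"
    unfolding mpoly_module_def by (rule module_quotient)
  have "quotient_grading N J j \<subseteq> carrier (quotient_module N (J :: 'k mpoly set))"
    unfolding quotient_grading_def coset_def[symmetric] quotient_simps
    by (auto dest: mpoly_component_carrier)
  moreover have "\<zero>\<^bsub>quotient_module N J\<^esub> \<in> quotient_grading N (J :: 'k mpoly set) j"
    unfolding quotient_grading_def coset_def[symmetric] quotient_simps by (auto simp: component_iff)
  ultimately show ?thesis using K_dim_eq_card[OF basis_quotient] by (simp add: card_image[OF coset_inj])
qed

lemma hilbert_series_quotient:
  "fls_nth (hilbert_series (quotient_module N (J :: 'k::field mpoly set)) (quotient_grading N J)) j =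
     (if j < 0 then 0 else int (card (mons N (nat j) - up)))"
  unfolding hilbert_series_def K_dim_quotient
  by (subst nth_Abs_fls_lower_bound[of 0]) (auto simp: Mon_eq)

end

lemma genideal_monomials:
  assumes F: "\<And>f. f \<in> F \<Longrightarrow> keys f \<subseteq> {1..N}"
  shows "Idl\<^bsub>mpoly_ring N\<^esub> ((\<lambda>f. single f (1 :: 'k::field)) ` F) =
    {p \<in> carrier (mpoly_ring N). keys p \<subseteq> {m. \<exists>f\<in>F. \<exists>m'. m = f + m'}}"
proof -
  interpret R: cring "mpoly_ring N :: 'k mpoly ring" by (rule cring_mpoly_ring)
  let ?G = "(\<lambda>f. single f (1 :: 'k)) ` F"
  interpret monomial_ideal N "{m. \<exists>f\<in>F. \<exists>m'. m = f + m'}"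
  proof
    fix m m' assume "m \<in> {m. \<exists>f\<in>F. \<exists>m'. m = f + m'}"
    then obtain f m'' where "f \<in> F" "m = f + m''" by blast
    then show "m + m' \<in> {m. \<exists>f\<in>F. \<exists>m'. m = f + m'}"
      unfolding mem_Collect_eq by (intro bexI[of _ f] exI[of _ "m'' + m'"]) (simp_all add: add.assoc)
  qed
  have G: "?G \<subseteq> carrier (mpoly_ring N)" using F by (auto simp: mpoly_ring_carrier)
  interpret Idl: ideal "Idl\<^bsub>mpoly_ring N\<^esub> ?G" "mpoly_ring N :: 'k mpoly ring" by (rule R.genideal_ideal[OF G])
  have "?G \<subseteq> J" using F by (force simp: J_def mpoly_ring_carrier)
  from R.genideal_minimal[OF ideal_J this] have "Idl\<^bsub>mpoly_ring N\<^esub> ?G \<subseteq> J" .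
  moreover have "p \<in> Idl\<^bsub>mpoly_ring N\<^esub> ?G" if p: "p \<in> J" for p :: "'k mpoly"
  proof -
    have mono: "single m c \<in> Idl\<^bsub>mpoly_ring N\<^esub> ?G" if m: "m \<in> keys p" for m and c :: 'k
    proof -
      obtain f m' where f: "f \<in> F" "m = f + m'" using m p by (auto simp: J_def)
      have "keys m \<subseteq> {1..N}" using m J_carrier[OF p] unfolding mpoly_ring_carrier by blast
      then have "keys m' \<subseteq> {1..N}" unfolding f(2) keys_add_nat by blast
      then have "single m' c \<in> carrier (mpoly_ring N)" by (auto simp: mpoly_ring_carrier)
      moreover have "single f 1 \<in> Idl\<^bsub>mpoly_ring N\<^esub> ?G" using R.genideal_self[OF G] f(1) by blast
      ultimately have "single m' c \<otimes>\<^bsub>mpoly_ring N\<^esub> single f 1 \<in> Idl\<^bsub>mpoly_ring N\<^esub> ?G"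
        by (intro Idl.I_l_closed)
      then show ?thesis unfolding f(2) by (simp add: mult_single add.commute)
    qed
    have "(\<Sum>m\<in>A. single m (lookup p m)) \<in> Idl\<^bsub>mpoly_ring N\<^esub> ?G"
      if "finite A" "A \<subseteq> keys p" for A
      using that
    proof (induction A rule: finite_induct)
      case empty
      show ?case using Idl.zero_closed by simp
    next
      case (insert m A)
      then show ?case using Idl.a_closed[OF mono[of m "lookup p m"]] by simp
    qed
    from this[of "keys p"] show ?thesis using mpoly_sum_monomials[of p] by simp
  qed
  ultimately show ?thesis unfolding J_def by blast
qed

section \<open>Bounds for the Hilbert depth\<close>

lemma seq_submodule_antimono:
  "set fs \<subseteq> set gs \<Longrightarrow> seq_submodule R M fs \<subseteq> seq_submodule R M gs"
  unfolding seq_submodule_def by (rule Inter_anti_mono) blast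

lemma regular_sequence_take:
  assumes "module R M" and reg: "regular_sequence R M fs"
  shows "regular_sequence R M (take d fs)"
proof -
  interpret module R M by fact
  have "submodule (carrier M) R M" by (rule submoduleI) auto
  then have "seq_submodule R M fs \<subseteq> carrier M"
    unfolding seq_submodule_def
    using reg by (intro Inter_lower) (auto simp: regular_sequence_def)
  then have "seq_submodule R M (take d fs) \<noteq> carrier M"
    using reg seq_submodule_antimono[OF set_take_subset, of R M d fs] by (auto simp: regular_sequence_def)
  then show ?thesis using reg set_take_subset[of d fs] unfolding regular_sequence_def by auto
qed

lemma difference_nth:
  fixes h :: "int fps"
  shows "fps_nth ((1 - fps_X) ^ d * h) k =
    (\<Sum>i\<le>d. (-1) ^ i * int (d choose i) * fls_nth (fps_to_fls h) (int k - int i))"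
proof -
  let ?t = "\<lambda>i. (-1) ^ i * int (d choose i) * fls_nth (fps_to_fls h) (int k - int i)"
  have "fps_nth ((1 - fps_X) ^ d * h) k = (\<Sum>i\<le>k. ?t i)"
    unfolding fps_mult_nth one_minus_X_power_nth atLeast0AtMost
    by (intro sum.cong refl) (auto simp: nat_diff_distrib)
  \<comment> \<open>Both ranges are compared with \<open>k + d\<close>: beyond \<open>k\<close> the
    Laurent coefficients have negative index and vanish, beyond \<open>d\<close> the binomial
    coefficients do.\<close>
  also have "\<dots> = (\<Sum>i\<le>k + d. ?t i)" by (rule sum.mono_neutral_left) auto
  also have "\<dots> = (\<Sum>i\<le>d. ?t i)" by (rule sum.mono_neutral_right) (auto simp: binomial_eq_0)
  finally show ?thesis .
qed

text \<open>A longer sequence could be cut to length \<open>d\<close>, which would make the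
  coefficients nonnegative. The hypothesis speaks only of the series, so the bound holds for all
  modules that share it.\<close>

lemma regular_sequence_length_less:
  fixes U :: "('k::field mpoly, 'b) module" and h :: "int fps"
  assumes N: "1 \<le> N" and U: "fg_graded_module N U E" and hs: "hilbert_series U E = fps_to_fls h"
    and neg: "fps_nth ((1 - fps_X) ^ d * h) k < 0"
    and fs: "set fs \<subseteq> graded_maximal_ideal N" "regular_sequence (mpoly_ring N) U fs"
  shows "length fs < d"
proof (rule ccontr)
  assume "\<not> length fs < d"
  then have len: "length (take d fs) = d" by simp
  have fin: "fin_gen_module (mpoly_ring N) U" and gr: "is_grading N U E" using U by (auto simp: fg_graded_module_def)
  have mod: "module (mpoly_ring N) U" using fin by (simp add: fin_gen_module_def)
  interpret fg_graded N U E
    using mod fin gr by (intro fg_graded.intro graded_mpoly_module.intro mpoly_module.intro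
        graded_mpoly_module_axioms.intro fg_graded_axioms.intro)
  have "set (take d fs) \<subseteq> graded_maximal_ideal N" using fs(1) set_take_subset[of d fs] by blast
  from hilbert_series_difference_nonneg[OF N this regular_sequence_take[OF mod fs(2)], of "int k"]
  show False using neg unfolding len hs difference_nth by simp
qed

text \<open>The empty sequence is regular precisely on nonzero modules. It makes the set of lengths
  in \<open>depth\<close> nonempty, so that \<open>GREATEST\<close> is attained.\<close>

lemma regular_sequence_Nil:
  fixes U :: "('k::field mpoly, 'b) module" and h :: "int fps"
  assumes U: "fg_graded_module N U E" and hs: "hilbert_series U E = fps_to_fls h" and h: "h \<noteq> 0"
  shows "regular_sequence (mpoly_ring N) U []"
proof -
  have fin: "fin_gen_module (mpoly_ring N) U" and gr: "is_grading N U E" using U by (auto simp: fg_graded_module_def)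
  have mod: "module (mpoly_ring N) U" using fin by (simp add: fin_gen_module_def)
  interpret fg_graded N U E
    using mod fin gr by (intro fg_graded.intro graded_mpoly_module.intro mpoly_module.intro
        graded_mpoly_module_axioms.intro fg_graded_axioms.intro)
  have "submodule {\<zero>\<^bsub>U\<^esub>} (mpoly_ring N) U" by (rule submoduleI) auto
  then have sub: "seq_submodule (mpoly_ring N) U [] \<subseteq> {\<zero>\<^bsub>U\<^esub>}" unfolding seq_submodule_def by (intro Inter_lower) auto
  have "carrier U \<noteq> {\<zero>\<^bsub>U\<^esub>}"
  proof
    assume car: "carrier U = {\<zero>\<^bsub>U\<^esub>}"
    have "E j = {\<zero>\<^bsub>U\<^esub>}" for j using D_carrier[of _ j] D_0[of j] unfolding car by blast
    then have "\<theta> ` E j = {0}" for j by (simp add: \<theta>_0)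
    then have "fls_nth (hilbert_series U E) j = 0" for j
      unfolding hilbert_series_nth using W.dim_unique[of "{}" "{0}" 0] W.independent_empty by simp
    then have "fps_nth h k = 0" for k using hs[symmetric] fps_to_fls_nth[of h "int k"] by simp
    then show False using h by (auto intro: fps_ext)
  qed
  then have "seq_submodule (mpoly_ring N) U [] \<noteq> carrier U" using sub M.zero_closed by blast
  then show ?thesis by (simp add: regular_sequence_def)
qed

lemma depth_less:
  fixes U :: "('k::field mpoly, 'b) module" and h :: "int fps"
  assumes N: "1 \<le> N" and U: "fg_graded_module N U E" and hs: "hilbert_series U E = fps_to_fls h"
    and neg: "fps_nth ((1 - fps_X) ^ d * h) k < 0"
  shows "depth N U < d"
proof -
  let ?P = "\<lambda>d. \<exists>fs. length fs = d \<and> set fs \<subseteq> graded_maximal_ideal N \<and> regular_sequence (mpoly_ring N) U fs"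
  have "h \<noteq> 0" using neg by auto
  then have "?P 0" using regular_sequence_Nil[OF U hs] by simp
  moreover have less: "d' < d" if "?P d'" for d'
    using that regular_sequence_length_less[OF N U hs neg] by blast
  ultimately have "?P (depth N U)" unfolding depth_def by (intro GreatestI_nat[of ?P 0 d]) (auto intro: less_imp_le)
  then show ?thesis by (rule less)
qed

lemma depth_eq:
  fixes U :: "('k::field mpoly, 'b) module" and h :: "int fps"
  assumes N: "1 \<le> N" and U: "fg_graded_module N U E" and hs: "hilbert_series U E = fps_to_fls h"
    and neg: "fps_nth ((1 - fps_X) ^ Suc d * h) k < 0"
    and fs: "length fs = d" "set fs \<subseteq> graded_maximal_ideal N" "regular_sequence (mpoly_ring N) U fs"
  shows "depth N U = d"
  unfolding depth_def
proof (rule Greatest_equality)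
  show "\<exists>fs. length fs = d \<and> set fs \<subseteq> graded_maximal_ideal N \<and> regular_sequence (mpoly_ring N) U fs"
    using fs by blast
  fix d' assume "\<exists>fs. length fs = d' \<and> set fs \<subseteq> graded_maximal_ideal N \<and> regular_sequence (mpoly_ring N) U fs"
  then obtain fs where "length fs = d'" "set fs \<subseteq> graded_maximal_ideal N" "regular_sequence (mpoly_ring N) U fs"
    by blast
  with regular_sequence_length_less[OF N U hs neg, of fs] show "d' \<le> d" by simp
qed

text \<open>The power series that are Hilbert series of direct sums of shifted polynomial rings in at
  least \<open>d\<close> and at most \<open>N\<close> variables.\<close>

definition decomposable :: "nat \<Rightarrow> nat \<Rightarrow> int fps \<Rightarrow> bool" where
  "decomposable d N h \<longleftrightarrow> (\<exists>xs. (\<forall>x\<in>set xs. d \<le> snd x \<and> snd x \<le> N) \<and>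
     h = (\<Sum>x\<leftarrow>xs. fps_X ^ fst x * HS (snd x)))"

lemma decomposable_0: "decomposable d N 0"
  unfolding decomposable_def by (rule exI[of _ "[]"]) simp

lemma decomposable_term: "d \<le> w \<Longrightarrow> w \<le> N \<Longrightarrow> decomposable d N (fps_X ^ a * HS w)"
  unfolding decomposable_def by (rule exI[of _ "[(a, w)]"]) simp

lemma decomposable_add: assumes "decomposable d N g" "decomposable d N h" shows "decomposable d N (g + h)"
proof -
  obtain xs ys where "\<forall>x\<in>set xs. d \<le> snd x \<and> snd x \<le> N" "g = (\<Sum>x\<leftarrow>xs. fps_X ^ fst x * HS (snd x))"
    "\<forall>x\<in>set ys. d \<le> snd x \<and> snd x \<le> N" "h = (\<Sum>x\<leftarrow>ys. fps_X ^ fst x * HS (snd x))"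
    using assms unfolding decomposable_def by blast
  then show ?thesis unfolding decomposable_def by (intro exI[of _ "xs @ ys"]) auto
qed

lemma decomposable_scale: "decomposable d N g \<Longrightarrow> decomposable d N (of_nat c * g)"
  by (induction c) (simp_all add: decomposable_0 decomposable_add distrib_right)

lemma decomposable_sum: "(\<And>i. i \<in> A \<Longrightarrow> decomposable d N (g i)) \<Longrightarrow> decomposable d N (sum g A)"
  by (induction A rule: infinite_finite_induct) (simp_all add: decomposable_0 decomposable_add)

lemma decomposable_mult:
  assumes "decomposable d N g" "d' \<le> d + w" "N + w \<le> N'"
  shows "decomposable d' N' (fps_X ^ a * HS w * g)"
proof -
  obtain xs where xs: "\<forall>x\<in>set xs. d \<le> snd x \<and> snd x \<le> N" "g = (\<Sum>x\<leftarrow>xs. fps_X ^ fst x * HS (snd x))"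
    using assms(1) unfolding decomposable_def by blast
  have "fps_X ^ a * HS w * g = (\<Sum>x\<leftarrow>xs. fps_X ^ (a + fst x) * HS (w + snd x))"
    unfolding xs(2) sum_list_const_mult[symmetric] HS_mult[symmetric] power_add by (simp add: mult_ac)
  then show ?thesis unfolding decomposable_def using xs(1) assms(2,3)
    by (intro exI[of _ "map (\<lambda>x. (a + fst x, w + snd x)) xs"]) (force simp: comp_def)
qed

lemma decomposable_module:
  assumes "decomposable d N h" "h \<noteq> 0"
  shows "\<exists>(U :: ('k::field mpoly, (nat \<Rightarrow> 'k mpoly) set) module) E fs. fg_graded_module N U E \<and>
    hilbert_series U E = fps_to_fls h \<and>
    length fs = d \<and> set fs \<subseteq> graded_maximal_ideal N \<and> regular_sequence (mpoly_ring N) U fs"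
proof -
  obtain xs where xs: "\<forall>x\<in>set xs. d \<le> snd x \<and> snd x \<le> N" "h = (\<Sum>x\<leftarrow>xs. fps_X ^ fst x * HS (snd x))"
    using assms(1) unfolding decomposable_def by blast
  have "xs \<noteq> []" using assms(2) xs(2) by auto
  then show ?thesis using module_with_hilbert_series[of xs d N] xs by auto
qed

text \<open>\<open>GREATEST\<close> satisfies its predicate only if some number does. The
  decomposability, with any \<open>d'\<close>, supplies a module with the given series in the
  required type; the negative coefficient bounds the depth of all of them.\<close>

lemma hdepth_less:
  fixes M :: "('k::field mpoly, 'b) module"
  assumes N: "1 \<le> N" and hs: "hilbert_series M D = fps_to_fls h" and dec: "decomposable d' N h"
    and neg: "fps_nth ((1 - fps_X) ^ d * h) k < 0"
  shows "hdepth N M D < d"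
proof -
  let ?P = "\<lambda>d. \<exists>(U :: ('k mpoly, (nat \<Rightarrow> 'k mpoly) set) module) E.
       fg_graded_module N U E \<and> hilbert_series U E = hilbert_series M D \<and> depth N U = d"
  have "h \<noteq> 0" using neg by auto
  then obtain d0 where d0: "?P d0" using decomposable_module[OF dec, where 'k = 'k] hs by metis
  have less: "d' < d" if "?P d'" for d' using that depth_less[OF N _ _ neg] hs by metis
  have "?P (hdepth N M D)" unfolding hdepth_def
    by (rule GreatestI_nat[of ?P, OF d0, of d]) (blast intro: less_imp_le less)
  then show ?thesis by (rule less)
qed

text \<open>The Hilbert depth is read off from the series alone: a decomposition into rings in at
  least \<open>d\<close> variables attains \<open>d\<close>, and one negative coefficient after
  multiplication by \<open>(1 - t)^(d + 1)\<close> excludes more.\<close>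

lemma hdepth_eq:
  fixes M :: "('k::field mpoly, 'b) module"
  assumes N: "1 \<le> N" and hs: "hilbert_series M D = fps_to_fls h" and dec: "decomposable d N h"
    and neg: "fps_nth ((1 - fps_X) ^ Suc d * h) k < 0"
  shows "hdepth N M D = d"
  unfolding hdepth_def
proof (rule Greatest_equality)
  have "h \<noteq> 0" using neg by auto
  from decomposable_module[OF dec this, where 'k = 'k]
  obtain U :: "('k mpoly, (nat \<Rightarrow> 'k mpoly) set) module" and E fs where U: "fg_graded_module N U E"
    "hilbert_series U E = fps_to_fls h" "length fs = d" "set fs \<subseteq> graded_maximal_ideal N"
    "regular_sequence (mpoly_ring N) U fs" by blast
  then have "depth N U = d" using depth_eq[OF N U(1,2) neg] by blast
  then show "\<exists>(U :: ('k mpoly, (nat \<Rightarrow> 'k mpoly) set) module) E.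
       fg_graded_module N U E \<and> hilbert_series U E = hilbert_series M D \<and> depth N U = d" using U hs by metis
  fix d' assume "\<exists>(U :: ('k mpoly, (nat \<Rightarrow> 'k mpoly) set) module) E.
       fg_graded_module N U E \<and> hilbert_series U E = hilbert_series M D \<and> depth N U = d'"
  then have "d' < Suc d" using depth_less[OF N _ _ neg] hs by metis
  then show "d' \<le> d" by simp
qed

section \<open>Power series identities\<close>

lemma HS_1_X: "HS 1 = 1 + fps_X * HS 1"
proof -
  have "HS 1 * (1 - fps_X) = 1" using HS_inverse[of 1] by simp
  then show ?thesis by (simp add: algebra_simps)
qed

text \<open>Multiplication by \<open>1 / (1 - X)\<close> forms partial sums, and those of a
  polynomial of degree below \<open>t\<close> are constant from degree \<open>t - 1\<close> on,
  whence the last summand.\<close>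

lemma HS_1_mult_poly:
  "HS 1 * (\<Sum>k<t. of_int (c k) * fps_X ^ k) =
     (\<Sum>k<t. of_int (\<Sum>j\<le>k. c j) * fps_X ^ k) + of_int (\<Sum>k<t. c k) * fps_X ^ t * HS 1"
proof (induction t)
  case (Suc t)
  let ?S = "of_int (\<Sum>k<t. c k) :: int fps"
  have "(\<Sum>j\<le>t. c j) = (\<Sum>k<t. c k) + c t" by (simp add: lessThan_Suc_atMost[symmetric])
  then have S: "of_int (\<Sum>j\<le>t. c j) = ?S + of_int (c t)" by (simp only: of_int_add)
  have "(\<Sum>k<Suc t. of_int (\<Sum>j\<le>k. c j) * fps_X ^ k) + of_int (\<Sum>k<Suc t. c k) * fps_X ^ Suc t * HS 1 =
    (\<Sum>k<t. of_int (\<Sum>j\<le>k. c j) * fps_X ^ k) + (?S + of_int (c t)) * fps_X ^ t * (1 + fps_X * HS 1)"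
    unfolding sum.lessThan_Suc S of_int_add by (simp add: algebra_simps del: of_int_sum)
  also have "\<dots> = (\<Sum>k<t. of_int (\<Sum>j\<le>k. c j) * fps_X ^ k) + (?S + of_int (c t)) * fps_X ^ t * HS 1"
    using HS_1_X by simp
  also have "\<dots> = HS 1 * (\<Sum>k<Suc t. of_int (c k) * fps_X ^ k)"
    unfolding sum.lessThan_Suc distrib_left Suc by (simp add: algebra_simps del: of_int_sum)
  finally show ?case ..
qed simp

lemma cn_sum: "(\<Sum>j\<le>k. cn f j) = cn (Suc f) k"
  by (induction k) (simp_all add: cn_0_right cn_Suc)

text \<open>The remainder of \<open>1 / (1 - X)^f\<close> after degree \<open>t - 1\<close> is again
  a sum of shifted series of polynomial rings, each in at least one variable. Every further factor
  \<open>1 / (1 - X)\<close> adds a variable to the old remainder and a new remainder in one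
  variable. For \<open>f = 0\<close> the series is 1, which \<open>1 \<le> t\<close> puts into the
  polynomial part.\<close>

lemma HS_tail:
  assumes "1 \<le> t"
  shows "\<exists>\<gamma>. decomposable 1 f \<gamma> \<and> HS f = (\<Sum>k<t. of_int (int (cn f k)) * fps_X ^ k) + fps_X ^ t * \<gamma>"
proof (induction f)
  case 0
  obtain t' where t: "t = Suc t'" using assms by (cases t) auto
  have "(\<Sum>k<t. of_int (int (cn 0 k)) * fps_X ^ k :: int fps) = 1"
    unfolding t sum.lessThan_Suc_shift by (simp add: cn_0_right cn_0_left)
  then show ?case using HS_0 decomposable_0 by (intro exI[of _ 0]) simp
next
  case (Suc f)
  then obtain \<gamma> where \<gamma>: "decomposable 1 f \<gamma>"
    "HS f = (\<Sum>k<t. of_int (int (cn f k)) * fps_X ^ k) + fps_X ^ t * \<gamma>" by blast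
  let ?S = "\<Sum>k<t. cn f k"
  let ?\<gamma> = "of_nat ?S * (fps_X ^ 0 * HS 1) + fps_X ^ 0 * HS 1 * \<gamma>"
  have "decomposable 1 (Suc f) ?\<gamma>"
    by (intro decomposable_add decomposable_scale decomposable_term decomposable_mult[OF \<gamma>(1)]) auto
  moreover have "HS (Suc f) = (\<Sum>k<t. of_int (int (cn (Suc f) k)) * fps_X ^ k) + fps_X ^ t * ?\<gamma>"
  proof -
    have "HS (Suc f) = HS 1 * HS f" using HS_mult[of 1 f] by simp
    also have "\<dots> = HS 1 * (\<Sum>k<t. of_int (int (cn f k)) * fps_X ^ k) + HS 1 * (fps_X ^ t * \<gamma>)"
      by (subst \<gamma>(2)) (simp only: distrib_left)
    also have "\<dots> = (\<Sum>k<t. of_int (\<Sum>j\<le>k. int (cn f j)) * fps_X ^ k) +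
        of_int (\<Sum>k<t. int (cn f k)) * fps_X ^ t * HS 1 + HS 1 * (fps_X ^ t * \<gamma>)"
      unfolding HS_1_mult_poly ..
    also have "(\<Sum>k<t. of_int (\<Sum>j\<le>k. int (cn f j)) * fps_X ^ k :: int fps) =
        (\<Sum>k<t. of_int (int (cn (Suc f) k)) * fps_X ^ k)"
      unfolding cn_sum[symmetric] by simp
    finally show ?thesis by (simp add: algebra_simps)
  qed
  ultimately show ?case by blast
qed

lemma one_minus_X_power: "(1 - fps_X :: int fps) ^ d = (\<Sum>k<Suc d. of_int ((-1) ^ k * int (d choose k)) * fps_X ^ k)"
proof (rule fps_ext)
  fix n
  have "fps_nth (\<Sum>k<Suc d. of_int ((-1) ^ k * int (d choose k)) * fps_X ^ k :: int fps) n =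
     (\<Sum>k<Suc d. if n = k then (-1) ^ k * int (d choose k) else 0)"
    unfolding fps_sum_nth by (intro sum.cong refl) (simp add: fps_of_int[symmetric] del: fps_of_int of_int_mult of_int_power)
  also have "\<dots> = (-1) ^ n * int (d choose n)" by (auto simp: sum.delta' binomial_eq_0)
  finally show "fps_nth ((1 - fps_X :: int fps) ^ d) n = fps_nth (\<Sum>k<Suc d. of_int ((-1) ^ k * int (d choose k)) * fps_X ^ k) n"
    unfolding one_minus_X_power_nth by simp
qed

lemma decomposable_poly:
  assumes "\<And>k. k < t \<Longrightarrow> 0 \<le> c k" "d \<le> w" "w \<le> N"
  shows "decomposable d N (fps_X ^ a * HS w * (\<Sum>k<t. of_int (c k) * fps_X ^ k))"
proof -
  have "fps_X ^ a * HS w * (\<Sum>k<t. of_int (c k) * fps_X ^ k) = (\<Sum>k<t. of_nat (nat (c k)) * (fps_X ^ (a + k) * HS w))"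
    unfolding sum_distrib_left using assms(1) by (intro sum.cong refl) (simp add: power_add mult_ac of_nat_nat)
  then show ?thesis using assms(2,3) by (simp only:) (intro decomposable_sum decomposable_scale decomposable_term)
qed

text \<open>Factoring out \<open>HS (s + c)\<close> leaves \<open>HS f - (1 - X)^c\<close>, and its
  coefficients are nonnegative: in degree 0 they cancel, in odd degrees both terms contribute
  positively, and in even degree \<open>k \<ge> 2\<close> the comparison of \<open>f - 1 + k\<close>
  choose \<open>k\<close> with \<open>c\<close> choose \<open>k\<close> holds because
  \<open>c \<le> f + 1 \<le> f - 1 + k\<close>. Beyond degree \<open>c\<close> only the tail of
  \<open>HS f\<close> is left.\<close>

lemma decomposable_ideal:
  fixes s c f :: nat
  assumes f: "1 \<le> f" and cf: "c = f \<or> c = Suc f"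
  shows "decomposable (s + c) (s + c + f) (fps_X ^ s * (HS (s + c + f) - HS s))"
proof -
  obtain \<gamma> where \<gamma>: "decomposable 1 f \<gamma>"
    "HS f = (\<Sum>k<Suc c. of_int (int (cn f k)) * fps_X ^ k) + fps_X ^ Suc c * \<gamma>"
    using HS_tail[of "Suc c" f] by auto
  have nonneg: "0 \<le> int (cn f k) - (-1) ^ k * int (c choose k)" for k
  proof (cases "even k \<and> k \<noteq> 0")
    case True
    then have k: "2 \<le> k" by presburger
    have "cn f k = (f - 1 + k) choose k" using cn_binomial[of "f - 1" k] f by simp
    moreover have "c choose k \<le> (f - 1 + k) choose k" using cf f k by (intro binomial_right_mono) auto
    ultimately show ?thesis using True by simp
  next
    case False
    then show ?thesis by (cases "k = 0") (auto simp: cn_0_right)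
  qed
  have "HS (s + c + f) - HS s = HS (s + c) * (HS f - (1 - fps_X) ^ c)"
    using HS_mult[of "s + c" f] HS_add[of s c] by (simp add: algebra_simps)
  also have "HS f - (1 - fps_X) ^ c =
      (\<Sum>k<Suc c. of_int (int (cn f k) - (-1) ^ k * int (c choose k)) * fps_X ^ k) + fps_X ^ Suc c * \<gamma>"
    unfolding \<gamma>(2) one_minus_X_power
    by (simp only: of_int_diff left_diff_distrib sum_subtractf diff_add_eq add_diff_eq)
  finally have eq0: "HS (s + c + f) - HS s = HS (s + c) *
     ((\<Sum>k<Suc c. of_int (int (cn f k) - (-1) ^ k * int (c choose k)) * fps_X ^ k) + fps_X ^ Suc c * \<gamma>)" .
  have distr: "a * (h * (p + b * g)) = a * h * p + a * b * h * g" for a h p b g :: "int fps"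
    by (simp add: algebra_simps)
  have eq: "fps_X ^ s * (HS (s + c + f) - HS s) =
     fps_X ^ s * HS (s + c) * (\<Sum>k<Suc c. of_int (int (cn f k) - (-1) ^ k * int (c choose k)) * fps_X ^ k) +
     fps_X ^ (s + Suc c) * HS (s + c) * \<gamma>"
    unfolding eq0 power_add[of fps_X s "Suc c"] by (rule distr)
  show ?thesis unfolding eq
    by (intro decomposable_add decomposable_poly decomposable_mult[OF \<gamma>(1)] nonneg) auto
qed

text \<open>With one more factor \<open>1 - X\<close> there remains
  \<open>HS (f - 1) - (1 - X)^(c + 1)\<close>, shifted by \<open>s\<close>. Its coefficient in
  degree 2 is \<open>f\<close> choose 2 minus \<open>c + 1\<close> choose 2, negative for
  \<open>f \<le> c\<close>.\<close>

lemma negative_coefficient_ideal: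
  fixes s c f :: nat
  assumes f: "1 \<le> f" and cf: "f \<le> c"
  shows "fps_nth ((1 - fps_X) ^ Suc (s + c) * (fps_X ^ s * (HS (s + c + f) - HS s))) (s + 2) < 0"
proof -
  have "HS (s + c + f) * (1 - fps_X) ^ Suc (s + c) = HS (f - 1)"
    using HS_add[of "f - 1" "Suc (s + c)"] f by (simp add: algebra_simps)
  moreover have "HS s * (1 - fps_X) ^ Suc (s + c) = (1 - fps_X) ^ Suc c"
  proof -
    have "(1 - fps_X :: int fps) ^ Suc (s + c) = (1 - fps_X) ^ s * (1 - fps_X) ^ Suc c"
      unfolding power_add[symmetric] by simp
    then have "HS s * (1 - fps_X) ^ Suc (s + c) = (HS s * (1 - fps_X) ^ s) * (1 - fps_X) ^ Suc c"
      by (simp only: mult.assoc)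
    then show ?thesis unfolding HS_inverse by simp
  qed
  moreover have "P * (A * (B - C)) = A * (B * P - C * P)" for P A B C :: "int fps"
    by (simp add: algebra_simps)
  ultimately have eq: "(1 - fps_X) ^ Suc (s + c) * (fps_X ^ s * (HS (s + c + f) - HS s)) =
      fps_X ^ s * (HS (f - 1) - (1 - fps_X) ^ Suc c)"
    by (simp only:)
  have "fps_nth ((1 - fps_X) ^ Suc (s + c) * (fps_X ^ s * (HS (s + c + f) - HS s))) (s + 2) =
      int (cn (f - 1) 2) - int (Suc c choose 2)"
    unfolding eq by (simp add: fps_X_power_mult_nth HS_nth one_minus_X_power_nth del: power_Suc)
  moreover have "cn (f - 1) 2 = f choose 2"
  proof (cases "f - 1")
    case 0
    then show ?thesis using f cn_0_left[of 1] by (simp add: numeral_2_eq_2)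
  next
    case (Suc g)
    then have "f = Suc (Suc g)" using f by simp
    then show ?thesis using cn_binomial[of g 2] by (simp add: numeral_2_eq_2)
  qed
  moreover have "f choose 2 \<le> c choose 2" using cf by (rule binomial_right_mono)
  moreover have "Suc c choose 2 = c + (c choose 2)" by (simp add: numeral_2_eq_2)
  ultimately show ?thesis using f cf by simp
qed

lemma HS_geometric: "HS (Suc v) * (1 - fps_X ^ s) = HS v * (\<Sum>k<s. fps_X ^ k)"
proof -
  have "1 - fps_X ^ s = (1 - fps_X) * (\<Sum>k<s. fps_X ^ k :: int fps)"
    by (rule one_diff_power_eq)
  then show ?thesis by (simp add: HS_Suc mult.assoc[symmetric])
qed

text \<open>Monomials that miss one of the first \<open>s\<close> variables give the geometric sum,
  and multiples of the product of these variables that involve no other variable give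
  \<open>X^s HS s\<close>. With lower bound 0 on the numbers of variables, this supplies the module
  that \<open>hdepth_less\<close> asks for.\<close>

lemma decomposable_quotient:
  assumes "1 \<le> s" "s \<le> v"
  shows "decomposable 0 (Suc v) (HS (Suc v) - fps_X ^ s * (HS (Suc v) - HS s))"
proof -
  have "HS (Suc v) - fps_X ^ s * (HS (Suc v) - HS s) = HS (Suc v) * (1 - fps_X ^ s) + fps_X ^ s * HS s"
    by (simp add: algebra_simps)
  also have "\<dots> = (\<Sum>k<s. fps_X ^ k * HS v) + fps_X ^ s * HS s"
    unfolding HS_geometric by (simp add: sum_distrib_left mult.commute)
  finally show ?thesis using assms by (auto intro!: decomposable_add decomposable_sum decomposable_term)
qed

text \<open>The product equals \<open>HS 1 - X^s (HS 1 - (1 - X)^(n - 1))\<close>, whose coefficient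
  in degree \<open>s + 1\<close> is \<open>1 - n\<close>. This is independent of the size of
  \<open>s\<close>, so the upper bound holds for every \<open>r\<close>.\<close>

lemma negative_coefficient_quotient:
  assumes "2 \<le> n" "1 \<le> s"
  shows "fps_nth ((1 - fps_X) ^ (s + n - 1) * (HS (s + n) - fps_X ^ s * (HS (s + n) - HS s))) (s + 1) < 0"
proof -
  have "HS (s + n) * (1 - fps_X) ^ (s + n - 1) = HS 1"
    using HS_add[of 1 "s + n - 1"] assms by (simp add: algebra_simps)
  moreover have "HS s * (1 - fps_X) ^ (s + n - 1) = (1 - fps_X) ^ (n - 1)"
  proof -
    have "s + n - 1 = s + (n - 1)" using assms by simp
    then show ?thesis using HS_inverse[of s] by (simp add: power_add flip: mult.assoc)
  qed
  ultimately have "(1 - fps_X) ^ (s + n - 1) * (HS (s + n) - fps_X ^ s * (HS (s + n) - HS s)) =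
      HS 1 - fps_X ^ s * (HS 1 - (1 - fps_X) ^ (n - 1))"
    by (simp add: algebra_simps)
  moreover have "cn 1 k = 1" for k using cn_binomial[of 0 k] by simp
  ultimately show ?thesis using assms
    by (simp add: fps_X_power_mult_nth HS_nth one_minus_X_power_nth)
qed

text \<open>Factoring out \<open>HS (s + p)\<close> leaves
  \<open>HS 2 (1 - X^s) + X^s (1 - X)^p\<close>. The first summand has the coefficients 1, 2, ...,
  \<open>s\<close> and then constantly \<open>s\<close>, so from degree \<open>s\<close> on it
  absorbs the alternating binomial coefficients of the second, the largest of which is the central
  one.\<close>

lemma decomposable_quotient_large:
  fixes s p :: nat
  assumes s: "p choose (p div 2) \<le> s"
  shows "decomposable (s + p) (s + p + 2) (HS (s + p + 2) - fps_X ^ s * (HS (s + p + 2) - HS s))"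
proof -
  let ?c = "\<lambda>k. int s + (-1) ^ k * int (p choose k)"
  have nonneg: "0 \<le> ?c k" for k
  proof -
    have "p choose k \<le> s" using binomial_maximum[of p k] s by linarith
    then show ?thesis by (cases "even k") auto
  qed
  have geo: "HS 1 * (\<Sum>k<t. fps_X ^ k) = (\<Sum>k<t. of_int (int k + 1) * fps_X ^ k) + of_int (int t) * fps_X ^ t * HS 1" for t
    using HS_1_mult_poly[of "\<lambda>_. 1" t] by (simp add: add.commute)
  have H1: "HS 1 = (\<Sum>k<Suc p. fps_X ^ k) + fps_X ^ Suc p * HS 1"
    using HS_geometric[of 0 "Suc p"] by (simp add: HS_0 algebra_simps)
  have "HS (s + p + 2) - fps_X ^ s * (HS (s + p + 2) - HS s) =
     HS (s + p) * (HS 2 * (1 - fps_X ^ s) + fps_X ^ s * (1 - fps_X) ^ p)"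
    using HS_mult[of "s + p" 2] HS_add[of s p] by (simp add: algebra_simps)
  also have "HS 2 * (1 - fps_X ^ s) = HS 1 * (\<Sum>k<s. fps_X ^ k)"
    using HS_geometric[of 1 s] by (simp add: numeral_2_eq_2)
  also have "\<dots> = (\<Sum>k<s. of_int (int k + 1) * fps_X ^ k) + of_int (int s) * fps_X ^ s * HS 1" by (rule geo)
  also have "of_int (int s) * fps_X ^ s * HS 1 =
      fps_X ^ s * (\<Sum>k<Suc p. of_int (int s) * fps_X ^ k) + of_nat s * (fps_X ^ (s + Suc p) * HS 1)"
    by (subst H1) (simp add: algebra_simps sum_distrib_left power_add)
  finally have eq: "HS (s + p + 2) - fps_X ^ s * (HS (s + p + 2) - HS s) =
      fps_X ^ 0 * HS (s + p) * (\<Sum>k<s. of_int (int k + 1) * fps_X ^ k) +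
      fps_X ^ s * HS (s + p) * (\<Sum>k<Suc p. of_int (?c k) * fps_X ^ k) +
      of_nat s * (fps_X ^ (s + Suc p) * HS (s + p + 1))"
    unfolding one_minus_X_power of_int_add distrib_right sum.distrib HS_mult[of "s + p" 1, symmetric]
    by (simp only: algebra_simps power_0 mult_1_left)
  show ?thesis unfolding eq
    by (intro decomposable_add decomposable_poly decomposable_scale decomposable_term nonneg) auto
qed

section \<open>The ideals \<open>I\<^bsub>n,r\<^esub>\<close>\<close>

definition sqfree_monomial :: "nat set \<Rightarrow> nat \<Rightarrow>\<^sub>0 nat" where
  "sqfree_monomial A = (\<Sum>j\<in>A. single j 1)"

lemma lookup_sqfree_monomial:
  "finite A \<Longrightarrow> lookup (sqfree_monomial A) i = (if i \<in> A then 1 else 0)"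
  unfolding sqfree_monomial_def by (simp add: lookup_sum lookup_single when_def sum.delta)

lemma keys_sqfree_monomial: "finite A \<Longrightarrow> keys (sqfree_monomial A) = A"
  by (auto simp: in_keys_iff lookup_sqfree_monomial split: if_splits)

lemma mono_degree_sqfree_monomial: "finite A \<Longrightarrow> mono_degree (sqfree_monomial A) = card A"
  unfolding mono_degree_def by (simp add: keys_sqfree_monomial lookup_sqfree_monomial)

lemma prod_mpoly_var: "finite A \<Longrightarrow> (\<Prod>j\<in>A. mpoly_var j) = single (sqfree_monomial A) (1 :: 'k::field)"
proof (induction A rule: finite_induct)
  case empty
  show ?case by (simp add: sqfree_monomial_def)
next
  case (insert j A)
  then show ?case by (simp add: sqfree_monomial_def mpoly_var_def mult_single)
qed

lemma sqfree_monomial_divides: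
  assumes "finite A" "A \<subseteq> keys m"
  shows "m = sqfree_monomial A + (m - sqfree_monomial A)"
proof (rule poly_mapping_eqI)
  fix i
  have "i \<in> A \<Longrightarrow> lookup m i \<noteq> 0" using assms(2) by (auto simp: in_keys_iff)
  then show "lookup m i = lookup (sqfree_monomial A + (m - sqfree_monomial A)) i"
    using assms(1) by (simp add: lookup_add lookup_minus lookup_sqfree_monomial)
qed

lemma card_mons_divisible:
  assumes "s \<le> w"
  shows "int (card {m \<in> mons w k. {1..s} \<subseteq> keys m}) = fps_nth (fps_X ^ s * HS w) k"
proof -
  let ?u = "sqfree_monomial {1..s}"
  have deg: "mono_degree ?u = s" by (simp add: mono_degree_sqfree_monomial)
  have "{m \<in> mons w k. {1..s} \<subseteq> keys m} = (if k < s then {} else (\<lambda>m. ?u + m) ` mons w (k - s))"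
  proof (rule Set.set_eqI, rule iffI)
    fix m assume m: "m \<in> {m \<in> mons w k. {1..s} \<subseteq> keys m}"
    then have eq: "m = ?u + (m - ?u)" by (intro sqfree_monomial_divides) auto
    have "mono_degree m = s + mono_degree (m - ?u)" using mono_degree_add[of ?u "m - ?u"] eq deg by simp
    moreover have "keys (m - ?u) \<subseteq> keys m" by (auto simp: in_keys_iff lookup_minus)
    ultimately have "m - ?u \<in> mons w (k - s)" "\<not> k < s" using m by (auto simp: mons_def)
    then show "m \<in> (if k < s then {} else (\<lambda>m. ?u + m) ` mons w (k - s))" using eq by auto
  next
    fix m assume "m \<in> (if k < s then {} else (\<lambda>m. ?u + m) ` mons w (k - s))"
    then obtain m' where m': "m = ?u + m'" "m' \<in> mons w (k - s)" "s \<le> k" by (auto split: if_splits)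
    have "keys m = {1..s} \<union> keys m'"
      unfolding m'(1) keys_add_nat by (simp add: keys_sqfree_monomial)
    moreover have "mono_degree m = k" using m' deg by (simp add: mono_degree_add mons_def)
    ultimately show "m \<in> {m \<in> mons w k. {1..s} \<subseteq> keys m}"
      using m'(2) assms by (auto simp: mons_def)
  qed
  moreover have "card ((\<lambda>m. ?u + m) ` mons w (k - s)) = cn w (k - s)"
    unfolding cn_def by (rule card_image) (simp add: inj_on_def)
  ultimately show ?thesis by (simp add: fps_X_power_mult_nth HS_nth)
qed

locale I_nr =
  fixes n r :: nat
  assumes n: "2 \<le> n" and r: "2 \<le> r"
begin

definition gens :: "(nat \<Rightarrow>\<^sub>0 nat) set" where
  "gens = (\<lambda>i. sqfree_monomial (insert i {1..r - 1})) ` {r..r + n - 1}"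

definition up :: "(nat \<Rightarrow>\<^sub>0 nat) set" where
  "up = {m. {1..r - 1} \<subseteq> keys m \<and> keys m \<inter> {r..r + n - 1} \<noteq> {}}"

sublocale monomial_ideal "n + r - 1" up
  by unfold_locales (auto simp: up_def keys_add_nat)

lemma up_eq: "{m. \<exists>f\<in>gens. \<exists>m'. m = f + m'} = up"
proof (rule Set.set_eqI, rule iffI)
  fix m assume "m \<in> {m. \<exists>f\<in>gens. \<exists>m'. m = f + m'}"
  then obtain i m' where i: "i \<in> {r..r + n - 1}" "m = sqfree_monomial (insert i {1..r - 1}) + m'"
    unfolding gens_def by blast
  have "keys m = insert i {1..r - 1} \<union> keys m'"
    unfolding i(2) keys_add_nat by (subst keys_sqfree_monomial) simp_all
  then show "m \<in> up" using i(1) by (auto simp: up_def)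
next
  fix m assume "m \<in> up"
  then obtain i where i: "{1..r - 1} \<subseteq> keys m" "i \<in> keys m" "i \<in> {r..r + n - 1}"
    unfolding up_def by blast
  from i(1,2) have "m = sqfree_monomial (insert i {1..r - 1}) + (m - sqfree_monomial (insert i {1..r - 1}))"
    by (intro sqfree_monomial_divides) simp_all
  then show "m \<in> {m. \<exists>f\<in>gens. \<exists>m'. m = f + m'}" unfolding gens_def using i(3) by blast
qed

lemma gens_keys: "f \<in> gens \<Longrightarrow> keys f \<subseteq> {1..n + r - 1}"
proof -
  assume "f \<in> gens"
  then obtain i where i: "i \<in> {r..r + n - 1}" "f = sqfree_monomial (insert i {1..r - 1})" unfolding gens_def by blast
  have "keys f = insert i {1..r - 1}" unfolding i(2) by (rule keys_sqfree_monomial) simp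
  then show ?thesis using i(1) r by auto
qed

lemma generator: "i \<in> {r..r + n - 1} \<Longrightarrow> (\<Prod>j\<in>{1..r - 1}. mpoly_var j) * mpoly_var i =
    single (sqfree_monomial (insert i {1..r - 1})) (1 :: 'k::field)"
proof -
  assume i: "i \<in> {r..r + n - 1}"
  then have "i \<notin> {1..r - 1}" using r by auto
  then have "(\<Prod>j\<in>insert i {1..r - 1}. mpoly_var j) = mpoly_var i * (\<Prod>j\<in>{1..r - 1}. mpoly_var j :: 'k mpoly)"
    by (intro prod.insert) simp_all
  then show ?thesis using prod_mpoly_var[of "insert i {1..r - 1}", where 'k = 'k] by (simp add: mult.commute)
qed

lemma I_ideal_eq_genideal:
  "I_ideal n r = Idl\<^bsub>mpoly_ring (n + r - 1)\<^esub> ((\<lambda>f. single f (1 :: 'k::field)) ` gens)"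
proof -
  have "(\<lambda>i. (\<Prod>j\<in>{1..r - 1}. mpoly_var j) * mpoly_var i) ` {r..r + n - 1} =
    (\<lambda>f. single f (1 :: 'k)) ` gens"
    unfolding gens_def image_image by (rule image_cong[OF refl generator])
  then show ?thesis unfolding I_ideal_def by simp
qed

lemma I_ideal_eq: "(I_ideal n r :: 'k::field mpoly set) = J"
  unfolding I_ideal_eq_genideal J_def unfolding up_eq[symmetric] by (rule genideal_monomials) (rule gens_keys)

text \<open>The Hilbert series of the ideal: its monomials are the multiples of the product of the
  first \<open>r - 1\<close> variables, except those that involve only these variables.\<close>

definition HI :: "int fps" where
  "HI = fps_X ^ (r - 1) * (HS (n + r - 1) - HS (r - 1))"

lemma card_up: "int (card (mons (n + r - 1) k \<inter> up)) = fps_nth HI k"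
proof -
  let ?A = "{m \<in> mons (n + r - 1) k. {1..r - 1} \<subseteq> keys m}"
  let ?B = "{m \<in> mons (r - 1) k. {1..r - 1} \<subseteq> keys m}"
  have "keys m \<subseteq> {1..r - 1} \<longleftrightarrow> keys m \<inter> {r..r + n - 1} = {}"
    if "keys m \<subseteq> {1..n + r - 1}" for m :: "nat \<Rightarrow>\<^sub>0 nat"
  proof -
    have "{1..n + r - 1} = {1..r - 1} \<union> {r..r + n - 1}" "{1..r - 1} \<inter> {r..r + n - 1} = {}" using r by auto
    then show ?thesis using that by blast
  qed
  moreover have "{1..r - 1} \<subseteq> {1..n + r - 1}" by auto
  ultimately have "mons (n + r - 1) k \<inter> up = ?A - ?B" "?B \<subseteq> ?A"
    unfolding mons_def up_def by blast+
  then have eq: "int (card (mons (n + r - 1) k \<inter> up)) = int (card ?A) - int (card ?B)"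
    by (simp add: card_Diff_subset finite_mons card_mono of_nat_diff)
  have A: "int (card ?A) = fps_nth (fps_X ^ (r - 1) * HS (n + r - 1)) k" by (rule card_mons_divisible) simp
  have B: "int (card ?B) = fps_nth (fps_X ^ (r - 1) * HS (r - 1)) k" by (rule card_mons_divisible) simp
  show ?thesis unfolding eq A B HI_def right_diff_distrib by simp
qed

lemma hilbert_series_I:
  "hilbert_series (ideal_module (I_ideal n r :: 'k::field mpoly set)) (ideal_grading (n + r - 1) (I_ideal n r)) =
     fps_to_fls HI"
  by (rule fls_eqI, unfold I_ideal_eq hilbert_series_J card_up) simp

lemma hilbert_series_S_mod_I:
  "hilbert_series (quotient_module (n + r - 1) (I_ideal n r :: 'k::field mpoly set))
     (quotient_grading (n + r - 1) (I_ideal n r)) = fps_to_fls (HS (n + r - 1) - HI)"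
proof (rule fls_eqI)
  fix j
  have eq: "int (card (mons (n + r - 1) k - up)) = int (cn (n + r - 1) k) - int (card (mons (n + r - 1) k \<inter> up))" for k
    using card_Diff_subset_Int[of "mons (n + r - 1) k" up] card_mono[of "mons (n + r - 1) k" "mons (n + r - 1) k \<inter> up"]
    by (simp add: cn_def finite_mons of_nat_diff)
  show "fls_nth (hilbert_series (quotient_module (n + r - 1) (I_ideal n r :: 'k mpoly set))
     (quotient_grading (n + r - 1) (I_ideal n r))) j = fls_nth (fps_to_fls (HS (n + r - 1) - HI)) j"
    unfolding I_ideal_eq hilbert_series_quotient eq card_up by (simp add: HS_nth)
qed

theorem hdepth_I: "hdepth_ideal (n + r - 1) (I_ideal n r :: 'k::field mpoly set) = r + (n - 1) div 2"
proof -
  \<comment> \<open>The \<open>n\<close> remaining variables are split into halves, \<open>c\<close>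
    being the rounded-up one. The decomposition needs \<open>c \<le> f + 1\<close> and the upper
    bound \<open>f \<le> c\<close>; then \<open>s + c\<close> is the claimed value.\<close>
  define s f c where "s = r - 1" and "f = n div 2" and "c = n - n div 2"
  have f: "1 \<le> f" "c = f \<or> c = Suc f" "f \<le> c" using n unfolding f_def c_def by presburger+
  have N: "n + r - 1 = s + c + f" using r by (auto simp: s_def c_def f_def)
  have d: "r + (n - 1) div 2 = s + c" using n r unfolding s_def c_def by presburger
  have HI: "HI = fps_X ^ s * (HS (s + c + f) - HS s)" unfolding HI_def N s_def ..
  show ?thesis unfolding hdepth_ideal_def d
  proof (rule hdepth_eq[OF _ hilbert_series_I])
    show "decomposable (s + c) (n + r - 1) HI" unfolding HI N by (rule decomposable_ideal[OF f(1,2)])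
    show "fps_nth ((1 - fps_X) ^ Suc (s + c) * HI) (s + 2) < 0"
      unfolding HI by (rule negative_coefficient_ideal[OF f(1,3)])
  qed (use r in simp)
qed

lemma negative_coefficient_S_mod_I: "fps_nth ((1 - fps_X) ^ (n + r - 2) * (HS (n + r - 1) - HI)) r < 0"
proof -
  have eqs: "n + r - 1 = r - 1 + n" "n + r - 2 = r - 1 + n - 1" "r - 1 + 1 = r" using n r by auto
  have "fps_nth ((1 - fps_X) ^ (r - 1 + n - 1) *
     (HS (r - 1 + n) - fps_X ^ (r - 1) * (HS (r - 1 + n) - HS (r - 1)))) (r - 1 + 1) < 0"
    by (rule negative_coefficient_quotient) (use n r in auto)
  then show ?thesis unfolding HI_def eqs .
qed

theorem hdepth_S_mod_I_le: "hdepth_quotient (n + r - 1) (I_ideal n r :: 'k::field mpoly set) \<le> n + r - 3"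
proof -
  have "decomposable 0 (n + r - 1) (HS (n + r - 1) - HI)"
    using decomposable_quotient[of "r - 1" "n + r - 2"] n r unfolding HI_def
    by (simp add: Suc_diff_le[symmetric] eval_nat_numeral)
  moreover have "1 \<le> n + r - 1" using r by simp
  ultimately have "hdepth_quotient (n + r - 1) (I_ideal n r :: 'k mpoly set) < n + r - 2"
    unfolding hdepth_quotient_def
    by (intro hdepth_less[OF _ hilbert_series_S_mod_I _ negative_coefficient_S_mod_I])
  then show ?thesis by simp
qed

theorem hdepth_S_mod_I_eq:
  assumes "r \<ge> 1 + ((n - 2) choose ((n - 2) div 2))"
  shows "hdepth_quotient (n + r - 1) (I_ideal n r :: 'k::field mpoly set) = n + r - 3"
  unfolding hdepth_quotient_def
proof (rule hdepth_eq[OF _ hilbert_series_S_mod_I])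
  have eqs: "n + r - 1 = r - 1 + (n - 2) + 2" "n + r - 3 = r - 1 + (n - 2)" using n r by auto
  have "(n - 2) choose ((n - 2) div 2) \<le> r - 1" using assms by simp
  from decomposable_quotient_large[OF this]
  show "decomposable (n + r - 3) (n + r - 1) (HS (n + r - 1) - HI)" unfolding HI_def eqs .
  have "Suc (n + r - 3) = n + r - 2" using n r by simp
  then show "fps_nth ((1 - fps_X) ^ Suc (n + r - 3) * (HS (n + r - 1) - HI)) r < 0"
    using negative_coefficient_S_mod_I by simp
qed (use r in simp)

section \<open>The ideal is squarefree, proper, nonzero and not principal\<close>

lemma mono_degree_up: assumes "m \<in> up" shows "r \<le> mono_degree m"
proof -
  obtain i where i: "{1..r - 1} \<subseteq> keys m" "i \<in> keys m" "i \<in> {r..r + n - 1}"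
    using assms unfolding up_def by blast
  have "i \<notin> {1..r - 1}" using i(3) r by auto
  then have card: "card (insert i {1..r - 1}) = r" using r by simp
  from i(1,2) have "m = sqfree_monomial (insert i {1..r - 1}) + (m - sqfree_monomial (insert i {1..r - 1}))"
    by (intro sqfree_monomial_divides) simp_all
  from arg_cong[where f = mono_degree, OF this] show ?thesis
    unfolding mono_degree_add mono_degree_sqfree_monomial[OF finite.insertI[OF finite_atLeastAtMost]] card
    by linarith
qed

text \<open>Every nonconstant term of \<open>p\<close> raises the degree, so at a monomial of degree
  no larger than those of \<open>g\<close> only the constant term of \<open>p\<close>
  contributes.\<close>

lemma lookup_mult_lowest_degree:
  assumes "\<And>m. m \<in> keys g \<Longrightarrow> mono_degree f \<le> mono_degree m"
  shows "lookup (p * g) f = lookup p 0 * lookup (g :: 'k::field mpoly) f"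
proof -
  define p' where "p' = p - single 0 (lookup p 0)"
  have "f \<notin> keys (p' * g)"
  proof
    assume "f \<in> keys (p' * g)"
    then obtain b c where bc: "f = b + c" "b \<in> keys p'" "c \<in> keys g"
      using Poly_Mapping.keys_mult[of p' g] by blast
    have "b \<noteq> 0" using bc(2) by (auto simp: p'_def in_keys_iff lookup_minus)
    then have "0 < mono_degree b" using mono_degree_eq_0 by blast
    then show False using assms[OF bc(3)] unfolding bc(1) by (simp add: mono_degree_add)
  qed
  then have "lookup (p' * g) f = 0" by (simp add: in_keys_iff)
  moreover have "p * g = single 0 (lookup p 0) * g + p' * g"
    by (simp add: p'_def algebra_simps)
  moreover have "lookup (single 0 c * g) f = c * lookup g f" for c
    unfolding mult_map_scale_conv_mult[symmetric] by (simp add: Poly_Mapping.map.rep_eq when_def)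
  ultimately show ?thesis by (simp add: lookup_add)
qed

lemma generator_in_I:
  assumes i: "i \<in> {r..r + n - 1}"
  shows "single (sqfree_monomial (insert i {1..r - 1})) (1 :: 'k::field) \<in> I_ideal n r"
proof -
  let ?f = "sqfree_monomial (insert i {1..r - 1})"
  have fg: "?f \<in> gens" unfolding gens_def using i by blast
  have "?f \<in> up" unfolding up_eq[symmetric] mem_Collect_eq
    using fg by (intro bexI[of _ ?f] exI[of _ 0]) simp_all
  then show ?thesis
    using gens_keys[OF fg] unfolding I_ideal_eq J_def mpoly_ring_carrier by simp
qed

text \<open>A generator \<open>g\<close>, homogeneous or not, has no terms of degree below
  \<open>r\<close>, the degree of the given monomial generators. If two of these are
  \<open>p g\<close> and \<open>q g\<close>, then in degree \<open>r\<close> the constant terms of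
  \<open>p\<close> and \<open>q\<close> alone matter: that of \<open>p\<close> is nonzero by the
  first monomial, and \<open>g\<close> contains the second one because of \<open>q\<close>, so
  \<open>p g\<close> contains it too, a contradiction.\<close>

theorem I_not_principal: "\<not> principalideal (I_ideal n r :: 'k::field mpoly set) (mpoly_ring (n + r - 1))"
proof
  interpret R: cring "mpoly_ring (n + r - 1) :: 'k mpoly ring" by (rule cring_mpoly_ring)
  assume "principalideal (I_ideal n r :: 'k mpoly set) (mpoly_ring (n + r - 1))"
  then obtain g :: "'k mpoly" where g: "g \<in> carrier (mpoly_ring (n + r - 1))"
    "I_ideal n r = Idl\<^bsub>mpoly_ring (n + r - 1)\<^esub> {g}"
    using principalideal.generate by blast
  have PI: "I_ideal n r = {p * g |p. p \<in> carrier (mpoly_ring (n + r - 1))}"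
    unfolding g(2) R.cgenideal_eq_genideal[OF g(1), symmetric] cgenideal_def by simp
  have "g = 1 * g" by simp
  then have "g \<in> I_ideal n r" unfolding PI using mpoly_carrier_1 by blast
  then have gup: "keys g \<subseteq> up" unfolding I_ideal_eq J_def by blast
  define F where "F i = sqfree_monomial (insert i {1..r - 1})" for i
  have deg: "mono_degree (F i) = r" if "i \<in> {r..r + n - 1}" for i
  proof -
    have "i \<notin> {1..r - 1}" using that r by auto
    then show ?thesis unfolding F_def using r by (simp add: mono_degree_sqfree_monomial)
  qed
  have ex: "\<exists>p. single (F i) 1 = p * g" if i: "i \<in> {r..r + n - 1}" for i
  proof -
    from generator_in_I[OF i, where 'k = 'k] show ?thesis unfolding F_def[symmetric] PI by blast
  qed
  have ir: "r \<in> {r..r + n - 1}" "Suc r \<in> {r..r + n - 1}" using n by auto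
  obtain p q where p: "single (F r) 1 = p * g" and q: "single (F (Suc r)) 1 = q * g"
    using ex[OF ir(1)] ex[OF ir(2)] by blast
  have low: "lookup (x * g) (F i) = lookup x 0 * lookup g (F i)"
    if "i \<in> {r..r + n - 1}" for x i
    by (rule lookup_mult_lowest_degree) (use gup mono_degree_up deg[OF that] in auto)
  have "F r \<noteq> F (Suc r)"
  proof
    assume "F r = F (Suc r)"
    then have "keys (F r) = keys (F (Suc r))" by simp
    then have "insert r {1..r - 1} = insert (Suc r) {1..r - 1}" unfolding F_def by (simp add: keys_sqfree_monomial)
    then have "Suc r \<in> insert r {1..r - 1}" by blast
    then show False by simp
  qed
  then have "lookup p 0 * lookup g (F (Suc r)) = 0"
    "lookup p 0 * lookup g (F r) = 1"
    "lookup q 0 * lookup g (F (Suc r)) = 1"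
    unfolding low[OF ir(1), symmetric] low[OF ir(2), symmetric] p[symmetric] q[symmetric]
    by (simp_all add: lookup_single)
  then show False by (metis mult_eq_0_iff zero_neq_one)
qed

lemma I_squarefree: "squarefree_monomial_ideal (n + r - 1) (I_ideal n r :: 'k::field mpoly set)"
  unfolding squarefree_monomial_ideal_def
proof (intro exI[of _ "(\<lambda>i. insert i {1..r - 1}) ` {r..r + n - 1}"] conjI)
  show "(\<lambda>i. insert i {1..r - 1}) ` {r..r + n - 1} \<subseteq> Pow {1..n + r - 1}" using r by auto
  have "(\<lambda>A. \<Prod>i\<in>A. mpoly_var i) ` (\<lambda>i. insert i {1..r - 1}) ` {r..r + n - 1} =
    (\<lambda>f. single f (1 :: 'k)) ` gens"
    unfolding gens_def image_image by (rule image_cong[OF refl], rule prod_mpoly_var) simp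
  then show "I_ideal n r = Idl\<^bsub>mpoly_ring (n + r - 1)\<^esub> ((\<lambda>A. \<Prod>i\<in>A. mpoly_var i :: 'k mpoly) `
      (\<lambda>i. insert i {1..r - 1}) ` {r..r + n - 1})"
    unfolding I_ideal_eq_genideal by (simp only:)
qed

text \<open>Excludes the cases in which one of the two Hilbert depths would concern the zero
  module.\<close>

lemma I_proper: "(I_ideal n r :: 'k::field mpoly set) \<noteq> {0}" "(I_ideal n r :: 'k mpoly set) \<noteq> carrier (mpoly_ring (n + r - 1))"
proof -
  have "0 \<notin> up" using mono_degree_up[of 0] r by auto
  then have "1 \<notin> (I_ideal n r :: 'k mpoly set)" unfolding I_ideal_eq J_def by simp
  then show "(I_ideal n r :: 'k mpoly set) \<noteq> carrier (mpoly_ring (n + r - 1))" using mpoly_carrier_1 by blast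
  have "r \<in> {r..r + n - 1}" using n by auto
  from generator_in_I[OF this, where 'k = 'k] show "(I_ideal n r :: 'k mpoly set) \<noteq> {0}"
    by (metis keys_eq_empty keys_single insert_not_empty singletonD zero_neq_one keys_zero)
qed

end

theorem mainTheorem7:
  shows
    "(\<forall>n r :: nat. n \<ge> 2 \<and> r \<ge> 2 \<longrightarrow>
       (let S = (mpoly_ring (n + r - 1) :: 'k::field mpoly ring);
            I = (I_ideal n r :: 'k mpoly set);
            hS = hdepth_quotient (n + r - 1) I;
            hI = hdepth_ideal (n + r - 1) I
        in \<not> principalideal I S \<and>
           hS \<le> n + r - 3 \<and>
           (r \<ge> 1 + ((n - 2) choose ((n - 2) div 2)) \<longrightarrow> hS = n + r - 3) \<and>
           hI = r + (n - 1) div 2 \<and>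
           (r \<ge> 1 + ((n - 2) choose ((n - 2) div 2)) \<longrightarrow>
              int hS - int hI = int (n div 2) - 2))) \<and>
     (\<forall>k :: nat. \<exists>(N :: nat) (I :: 'k mpoly set).
        squarefree_monomial_ideal N I \<and> I \<noteq> {0} \<and> I \<noteq> carrier (mpoly_ring N) \<and>
        hdepth_quotient N I = hdepth_ideal N I + k)"
proof (intro conjI allI impI)
  fix n r :: nat assume "n \<ge> 2 \<and> r \<ge> 2"
  then interpret I_nr n r by unfold_locales auto
  \<comment> \<open>For either parity \<open>n - 3 - (n - 1) div 2\<close> is
    \<open>n div 2 - 2\<close>. Thus the constant is -2 and not the -1 of the informal statement:
    for \<open>n = 2\<close> the Hilbert depths are \<open>r - 1\<close> and \<open>r\<close>. As
    the difference can be negative, it is taken in \<open>int\<close>.\<close>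
  have "int (n + r - 3) - int (r + (n - 1) div 2) = int (n div 2) - 2" using n r by presburger
  then show "let S = (mpoly_ring (n + r - 1) :: 'k mpoly ring);
            I = (I_ideal n r :: 'k mpoly set);
            hS = hdepth_quotient (n + r - 1) I;
            hI = hdepth_ideal (n + r - 1) I
        in \<not> principalideal I S \<and>
           hS \<le> n + r - 3 \<and>
           (r \<ge> 1 + ((n - 2) choose ((n - 2) div 2)) \<longrightarrow> hS = n + r - 3) \<and>
           hI = r + (n - 1) div 2 \<and>
           (r \<ge> 1 + ((n - 2) choose ((n - 2) div 2)) \<longrightarrow>
              int hS - int hI = int (n div 2) - 2)"
    unfolding Let_def hdepth_I
    by (intro conjI impI I_not_principal hdepth_S_mod_I_le hdepth_S_mod_I_eq refl) (simp_all only: hdepth_S_mod_I_eq)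
next
  fix k :: nat
  \<comment> \<open>The choice of \<open>n\<close> makes \<open>n div 2 - 2\<close> equal to
    \<open>k\<close>, and \<open>r\<close> is the smallest admissible value; the positivity of the
    binomial coefficient gives \<open>2 \<le> r\<close>.\<close>
  define n r where "n = 2 * k + 4" and "r = 1 + ((n - 2) choose ((n - 2) div 2))"
  have pos: "0 < (n - 2) choose ((n - 2) div 2)" by (rule zero_less_binomial) simp
  interpret I_nr n r
  proof
    show "2 \<le> n" by (simp add: n_def)
    show "2 \<le> r" using pos unfolding r_def by linarith
  qed
  have "hdepth_quotient (n + r - 1) (I_ideal n r :: 'k mpoly set) = n + r - 3"
    by (rule hdepth_S_mod_I_eq) (simp add: r_def)
  moreover have "n + r - 3 = r + (n - 1) div 2 + k" unfolding n_def by simp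
  ultimately show "\<exists>(N :: nat) (I :: 'k mpoly set).
        squarefree_monomial_ideal N I \<and> I \<noteq> {0} \<and> I \<noteq> carrier (mpoly_ring N) \<and>
        hdepth_quotient N I = hdepth_ideal N I + k"
    by (intro exI[of _ "n + r - 1"] exI[of _ "I_ideal n r"] conjI I_squarefree I_proper) (simp only: hdepth_I)
qed

end
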